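(* Let $n\ge 1$, let $Q$ be a real symmetric positive definite $n\times n$ matrix and let $B$ be a real $n\times n$ matrix all of whose eigenvalues have negative real parts. With the notation of the context, the maximal operator $$\mathcal H_* f(x)=\sup_{t>0}\big|\mathcal H_t^{UO}f(x)\big|$$ is bounded from $L^1(\gamma_{-\infty})$ to $L^{1,\infty}(\gamma_{-\infty})$, i.e. there is a constant $C=C(n,Q,B)<\infty$ such that $$\gamma_{-\infty}\{x\in\mathbb R^n:\ \mathcal H_*f(x)>\alpha\}\le \frac{C}{\alpha}\,\|f\|_{L^1(\gamma_{-\infty})}$$ for all $f\in L^1(\gamma_{-\infty})$ and all $\alpha>0$; moreover $\mathcal H_*$ is bounded on $L^p(\gamma_{-\infty})$ for every $1<p\le\infty$.
   Context: For $t\in(0,+\infty]$ let $Q_t=\int_0^t e^{sB}Qe^{sB^*}\,ds$ (symmetric and positive definite). Let $R(x)=\frac12\langle Q_\infty^{-1}x,x\rangle$ for $x\in\mathbb R^n$, and $D_t=Q_\infty e^{-tB^*}Q_\infty^{-1}$ for $t\in\mathbb R$. The inverse Gaussian measure is $d\gamma_{-\infty}(x)=(2\pi)^{n/2}(\det Q_\infty)^{1/2}e^{R(x)}\,dx$. The inverse Ornstein--Uhlenbeck operator is $\mathcal A^{Q,B}=\frac12\mathrm{tr}(Q\nabla^2)-\langle Bx,\nabla\rangle$, and $\mathcal H_t^{UO}=e^{t\mathcal A^{Q,B}}$, $t>0$, is the semigroup it generates; it acts by $\mathcal H_t^{UO}f(x)=\int K_t^{UO}(x,u)f(u)\,d\gamma_{-\infty}(u)$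 with $$K_t^{UO}(x,u)=(2\pi)^{-n}(\det Q_\infty\det Q_t)^{-1/2}e^{t\,\mathrm{tr}B}e^{-R(x)}\exp\Big[-\tfrac12\big\langle (Q_t^{-1}-Q_\infty^{-1})(x-D_tu),\,x-D_tu\big\rangle\Big].$$ *)

theory Defs
  imports "HOL-Analysis.Analysis"
begin

fun matpow :: "real^'n^'n \<Rightarrow> nat \<Rightarrow> real^'n^'n" where
  "matpow A 0 = mat 1"
| "matpow A (Suc k) = A ** matpow A k"

definition mexp :: "real^'n^'n \<Rightarrow> real^'n^'n" where
  "mexp A = (\<Sum>k. inverse (fact k) *\<^sub>R matpow A k)"

definition cplx_eigenvalue :: "real^'n^'n \<Rightarrow> complex \<Rightarrow> bool" where
  "cplx_eigenvalue B z \<longleftrightarrow>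
     det ((\<chi> i j. (if i = j then z else 0) - complex_of_real (B $ i $ j)) :: complex^'n^'n) = 0"

definition sym_pos_def :: "real^'n^'n \<Rightarrow> bool" where
  "sym_pos_def Q \<longleftrightarrow> transpose Q = Q \<and> (\<forall>x. x \<noteq> 0 \<longrightarrow> x \<bullet> (Q *v x) > 0)"

definition Qt :: "real^'n^'n \<Rightarrow> real^'n^'n \<Rightarrow> real \<Rightarrow> real^'n^'n" where
  "Qt Q B t = integral {0..t} (\<lambda>s. mexp (s *\<^sub>R B) ** Q ** transpose (mexp (s *\<^sub>R B)))"

definition Qinf :: "real^'n^'n \<Rightarrow> real^'n^'n \<Rightarrow> real^'n^'n" where
  "Qinf Q B = integral {0..} (\<lambda>s. mexp (s *\<^sub>R B) ** Q ** transpose (mexp (s *\<^sub>R B)))"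

definition Rfun :: "real^'n^'n \<Rightarrow> real^'n^'n \<Rightarrow> real^'n \<Rightarrow> real" where
  "Rfun Q B x = (1/2) * ((matrix_inv (Qinf Q B) *v x) \<bullet> x)"

definition Dt :: "real^'n^'n \<Rightarrow> real^'n^'n \<Rightarrow> real \<Rightarrow> real^'n^'n" where
  "Dt Q B t = Qinf Q B ** mexp ((- t) *\<^sub>R transpose B) ** matrix_inv (Qinf Q B)"

definition inv_gauss :: "real^'n^'n \<Rightarrow> real^'n^'n \<Rightarrow> (real^'n) measure" where
  "inv_gauss Q B = density lborel (\<lambda>x. ennreal ((2*pi) powr (real CARD('n) / 2)
       * sqrt (det (Qinf Q B)) * exp (Rfun Q B x)))"

definition KUO :: "real^'n^'n \<Rightarrow> real^'n^'n \<Rightarrow> real \<Rightarrow> real^'n \<Rightarrow> real^'n \<Rightarrow> real" where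
  "KUO Q B t x u = (2*pi) powr (- real CARD('n)) * inverse (sqrt (det (Qinf Q B) * det (Qt Q B t)))
     * exp (t * trace B) * exp (- Rfun Q B x)
     * exp (- (1/2) * (((matrix_inv (Qt Q B t) - matrix_inv (Qinf Q B)) *v (x - Dt Q B t *v u))
                        \<bullet> (x - Dt Q B t *v u)))"

definition HUO :: "real^'n^'n \<Rightarrow> real^'n^'n \<Rightarrow> real \<Rightarrow> (real^'n \<Rightarrow> real) \<Rightarrow> real^'n \<Rightarrow> real" where
  "HUO Q B t f x = (\<integral>u. KUO Q B t x u * f u \<partial>inv_gauss Q B)"

text \<open>Real powers of extended nonnegative reals (for p > 0): x^p, with infinity^p = infinity.\<close>
definition ennpow :: "ennreal \<Rightarrow> real \<Rightarrow> ennreal" where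
  "ennpow x p = (if x = \<infinity> then \<infinity> else ennreal (enn2real x powr p))"

definition Hstar :: "real^'n^'n \<Rightarrow> real^'n^'n \<Rightarrow> (real^'n \<Rightarrow> real) \<Rightarrow> real^'n \<Rightarrow> ennreal" where
  "Hstar Q B f x = (SUP t\<in>{0<..}. ennreal \<bar>HUO Q B t f x\<bar>)"

end

theory Submission
  imports Defs "HOL-Computational_Algebra.Fundamental_Theorem_Algebra"
begin

text \<open>
  The kernel of the semigroup is explicit. For times \<open>t \<le> 1\<close> and points \<open>u\<close> with
  \<open>|x - u| (1 + |x|) \<le> 1\<close> it is dominated by a maximal function over balls of radius at most
  \<open>1 / (1 + |x|)\<close>, on which the measure is doubling, so Vitali's covering lemma applies.
  For the remaining part, write \<open>D\<close> for the flow \<open>Dt Q B\<close>, along which \<open>R\<close> grows like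
  \<open>R (D s x) \<ge> R x + c s |x|\<^sup>2\<close>. The quantity \<open>e\<^bsup>R x\<^esup>\<close> times the kernel has a majorant
  \<open>g (z, u)\<close> which is the same for all \<open>x\<close> on the orbit segment
  \<open>{x. D \<sigma> x = z, 0 \<le> \<sigma> \<le> 1}\<close>. Hence \<open>e\<^bsup>R x\<^esup> \<le> H z := (2 / \<alpha>) \<integral> g (z, u) f u\<close> at every such point \<open>x\<close>
  of the level set, and integrating \<open>e\<^bsup>R\<^esup>\<close> over the part of the orbit where \<open>e\<^bsup>R\<^esup> \<le> H z\<close> costs only
  \<open>H z / (1 + |z|)\<^sup>2\<close>: the density varies exponentially along orbits. Averaging over
  \<open>\<sigma>\<close> and using Tonelli, the weak type (1,1) bound is reduced to the estimate
  \<open>\<integral> g (z, u) / (1 + |z|)\<^sup>2 dz \<le> C\<close> uniformly in \<open>u\<close>, which follows from the scaling of the kernels.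
  The bounds for \<open>1 < p < \<infinity>\<close> follow by interpolation with the trivial bound for \<open>p = \<infinity>\<close>.
\<close>

section \<open>The matrix exponential\<close>

text \<open>The obstacle is the supremum over \<open>t\<close>: Tonelli needs a majorant that is
  free of \<open>t\<close> and still integrable. For this reason the Gaussians are weakened at once
  to rational kernels of degree \<open>n\<close> or \<open>n + 1\<close>. Over a suitable short
  window of time such a kernel changes only by a constant factor, so its value at one time is at
  most an integral over the window divided by the window length, and the weight
  \<open>(1 + |z|)^-2\<close> absorbs that division. Without the average over
  \<open>\<sigma>\<close> this weight would be missing, since a single slice
  \<open>D \<sigma> x = z\<close> gives no gain over \<open>H z\<close>. All kernel algebra rests on
  one identity, \<open>Qinf = Qt + E Qinf E^T\<close> with \<open>E = e^(tB)\<close>. It yields the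
  growth of \<open>R\<close> along \<open>D\<close>, and it rewrites the exponent either in terms of
  \<open>D (- t) x - u\<close> or, after multiplication by \<open>e^(R u)\<close>, in terms of
  \<open>x - E t u\<close>. The first form feeds the global part; the second one controls the local
  part and the integral of the kernel, hence the case \<open>p = \<infinity>\<close>. Measurability
  of the maximal function is a separate matter, settled by continuity of the semigroup in
  \<open>x\<close> at each fixed time.\<close>

lemma bounded_bilinear_matrix_mult:
  "bounded_bilinear ((**) :: real^'n^'m \<Rightarrow> real^'p^'n \<Rightarrow> real^'p^'m)"
proof -
  have "bilinear ((**) :: real^'n^'m \<Rightarrow> real^'p^'n \<Rightarrow> real^'p^'m)"
    unfolding bilinear_def
    by (auto intro!: linearI simp: matrix_matrix_mult_def vec_eq_iff sum.distrib sum_distrib_left algebra_simps)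
  then show ?thesis by (simp add: bilinear_conv_bounded_bilinear)
qed

lemma bounded_bilinear_matrix_vector_mult:
  "bounded_bilinear ((*v) :: real^'n^'m \<Rightarrow> real^'n \<Rightarrow> real^'m)"
proof -
  have "bilinear ((*v) :: real^'n^'m \<Rightarrow> real^'n \<Rightarrow> real^'m)"
    unfolding bilinear_def
    by (auto intro!: linearI simp: matrix_vector_mult_def vec_eq_iff sum.distrib
        sum_distrib_left algebra_simps)
  then show ?thesis by (simp add: bilinear_conv_bounded_bilinear)
qed

lemma bounded_linear_transpose:
  "bounded_linear (transpose :: real^'n^'m \<Rightarrow> real^'m^'n)"
  unfolding linear_conv_bounded_linear[symmetric]
  by (rule linearI) (auto simp: transpose_def vec_eq_iff)

lemmas matrix_mult_left_linear = bounded_bilinear.bounded_linear_right[OF bounded_bilinear_matrix_mult]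
lemmas matrix_mult_right_linear = bounded_bilinear.bounded_linear_left[OF bounded_bilinear_matrix_mult]

lemma scaleR_matrix_mult:
  "(c *\<^sub>R A) ** B = c *\<^sub>R (A ** B)" "A ** (c *\<^sub>R B) = c *\<^sub>R (A ** B)"
  for A :: "real^'n^'m" and B :: "real^'p^'n"
  using bounded_bilinear.scaleR_left[OF bounded_bilinear_matrix_mult]
    bounded_bilinear.scaleR_right[OF bounded_bilinear_matrix_mult] by auto

lemma norm_matrix_le_sum: "norm (M :: real^'n^'m) \<le> (\<Sum>i\<in>UNIV. \<Sum>j\<in>UNIV. \<bar>M $ i $ j\<bar>)"
proof -
  have "norm M \<le> (\<Sum>i\<in>UNIV. norm (M $ i))"
    unfolding norm_vec_def by (rule L2_set_le_sum) auto
  also have "\<dots> \<le> (\<Sum>i\<in>UNIV. \<Sum>j\<in>UNIV. \<bar>M $ i $ j\<bar>)"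
    by (intro sum_mono norm_le_l1_cart)
  finally show ?thesis .
qed

text \<open>The sum of all absolute entries is submultiplicative already at the level of single
  entries, so a scalar exponential series dominates the series of \<open>mexp\<close> and no
  operator norm is involved.\<close>

lemma matpow_entry_bound:
  "\<bar>matpow A k $ i $ j\<bar> \<le> (\<Sum>i\<in>UNIV. \<Sum>j\<in>UNIV. \<bar>A $ i $ j\<bar>) ^ k"
proof (induction k arbitrary: i)
  case 0
  then show ?case by (simp add: mat_def)
next
  case (Suc k)
  let ?b = "\<Sum>i\<in>UNIV. \<Sum>j\<in>UNIV. \<bar>A $ i $ j\<bar>"
  have "\<bar>matpow A (Suc k) $ i $ j\<bar> = \<bar>\<Sum>l\<in>UNIV. A $ i $ l * matpow A k $ l $ j\<bar>"
    by (simp add: matrix_matrix_mult_def)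
  also have "\<dots> \<le> (\<Sum>l\<in>UNIV. \<bar>A $ i $ l\<bar> * ?b ^ k)"
    by (rule order_trans[OF sum_abs]) (auto intro!: sum_mono mult_left_mono Suc zero_le_power sum_nonneg simp: abs_mult)
  also have "\<dots> = (\<Sum>l\<in>UNIV. \<bar>A $ i $ l\<bar>) * ?b ^ k" by (simp add: sum_distrib_right)
  also have "\<dots> \<le> ?b * ?b ^ k"
    by (intro mult_right_mono member_le_sum[of i UNIV "\<lambda>i. \<Sum>j\<in>UNIV. \<bar>A $ i $ j\<bar>"])
       (auto intro!: sum_nonneg zero_le_power)
  finally show ?case by simp
qed

lemma summable_mexp: "summable (\<lambda>k. inverse (fact k) *\<^sub>R matpow (A :: real^'n^'n) k)"
proof (rule summable_comparison_test')
  let ?b = "\<Sum>i\<in>UNIV. \<Sum>j\<in>UNIV. \<bar>A $ i $ j\<bar>"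
  show "summable (\<lambda>k. real CARD('n) * real CARD('n) * (inverse (fact k) * ?b ^ k))"
    by (intro summable_mult summable_exp)
  fix k :: nat
  have "norm (matpow A k) \<le> (\<Sum>i\<in>(UNIV::'n set). \<Sum>j\<in>(UNIV::'n set). ?b ^ k)"
    by (rule order_trans[OF norm_matrix_le_sum]) (intro sum_mono matpow_entry_bound)
  also have "\<dots> = real CARD('n) * real CARD('n) * ?b ^ k" by simp
  finally have "norm (inverse (fact k) *\<^sub>R matpow A k) \<le> inverse (fact k) * (real CARD('n) * real CARD('n) * ?b ^ k)"
    by (simp add: mult_left_mono divide_simps)
  then show "norm (inverse (fact k) *\<^sub>R matpow A k) \<le> real CARD('n) * real CARD('n) * (inverse (fact k) * ?b ^ k)"
    by (simp add: mult_ac)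
qed

lemma matpow_scaleR: "matpow (t *\<^sub>R A) k = t ^ k *\<^sub>R matpow A k"
  by (induction k) (auto simp: scaleR_matrix_mult)

lemma matpow_commute: "matpow A k ** A = A ** matpow A k"
proof (induction k)
  case (Suc k)
  then show ?case by (simp add: matrix_mul_assoc[symmetric])
qed simp

lemma mexp_commute: "mexp A ** A = A ** mexp A"
proof -
  have "mexp A ** A = (\<Sum>k. (inverse (fact k) *\<^sub>R matpow A k) ** A)"
    unfolding mexp_def by (rule bounded_linear.suminf[OF matrix_mult_right_linear summable_mexp])
  also have "\<dots> = (\<Sum>k. A ** (inverse (fact k) *\<^sub>R matpow A k))"
    by (simp add: scaleR_matrix_mult matpow_commute)
  also have "\<dots> = A ** mexp A"
    unfolding mexp_def by (rule bounded_linear.suminf[OF matrix_mult_left_linear summable_mexp, symmetric])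
  finally show ?thesis .
qed

lemma transpose_mexp: "transpose (mexp A) = mexp (transpose A)"
proof -
  have "transpose (matpow A k) = matpow (transpose A) k" for k
    by (induction k) (auto simp: matrix_transpose_mul matpow_commute)
  moreover have "transpose (mexp A) = (\<Sum>k. transpose (inverse (fact k) *\<^sub>R matpow A k))"
    unfolding mexp_def by (rule bounded_linear.suminf[OF bounded_linear_transpose summable_mexp])
  ultimately show ?thesis
    unfolding mexp_def by (simp add: transpose_scalar linear_cmul[OF bounded_linear.linear[OF bounded_linear_transpose]])
qed

lemma mexp_0: "mexp (0 :: real^'n^'n) = mat 1"
proof -
  have "matpow (0 :: real^'n^'n) k = (if k = 0 then mat 1 else 0)" for k
    by (cases k) (auto simp: matrix_matrix_mult_def vec_eq_iff)
  then have "mexp (0 :: real^'n^'n) = (\<Sum>k. if k = 0 then mat 1 else 0)"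
    unfolding mexp_def by (intro suminf_cong) auto
  also have "\<dots> = mat 1" by (subst suminf_finite[of "{0}"]) auto
  finally show ?thesis .
qed

text \<open>Turns calculus for the matrix exponential into calculus for scalar power series in
  \<open>t\<close> that converge everywhere, which may be differentiated term by term.\<close>

lemma mexp_entry_sums: "(\<lambda>k. inverse (fact k) * matpow A k $ i $ j * t ^ k) sums (mexp (t *\<^sub>R A) $ i $ j)"
proof -
  have "bounded_linear (\<lambda>M. M $ i $ j)"
    by (intro bounded_linear_compose[OF bounded_linear_vec_nth bounded_linear_vec_nth])
  from bounded_linear.sums[OF this summable_sums[OF summable_mexp[of "t *\<^sub>R A"]]]
  show ?thesis unfolding mexp_def by (simp add: matpow_scaleR mult_ac)
qed

lemma mexp_entry_deriv:
  "((\<lambda>t. mexp (t *\<^sub>R A) $ i $ j) has_real_derivative (A ** mexp (t *\<^sub>R A)) $ i $ j) (at t)"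
proof -
  define c where "c = (\<lambda>k. inverse (fact k) * matpow A k $ i $ j)"
  have eq: "mexp (t *\<^sub>R A) $ i $ j = (\<Sum>k. c k * t ^ k)" for t
    using sums_unique[OF mexp_entry_sums[of A i j t]] by (simp add: c_def)
  have "((\<lambda>t. \<Sum>k. c k * t ^ k) has_real_derivative (\<Sum>k. diffs c k * t ^ k)) (at t)"
    by (rule termdiffs_strong_converges_everywhere)
       (use sums_summable[OF mexp_entry_sums] in \<open>auto simp: c_def\<close>)
  moreover have "(\<Sum>k. diffs c k * t ^ k) = (A ** mexp (t *\<^sub>R A)) $ i $ j"
  proof -
    \<comment> \<open>The factor \<open>Suc k\<close> from \<open>diffs\<close> cancels against the
      factorial, and the recursion of \<open>matpow\<close> releases one factor
      \<open>A\<close>.\<close>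
    have "diffs c k = (\<Sum>l\<in>UNIV. A $ i $ l * (inverse (fact k) * matpow A k $ l $ j))" for k
      by (simp add: diffs_def c_def matrix_matrix_mult_def sum_distrib_left field_simps del: of_nat_Suc)
    then have "(\<lambda>k. diffs c k * t ^ k) = (\<lambda>k. \<Sum>l\<in>UNIV. A $ i $ l * (inverse (fact k) * matpow A k $ l $ j * t ^ k))"
      by (simp add: sum_distrib_right sum_distrib_left mult_ac)
    moreover have "(\<lambda>k. \<Sum>l\<in>UNIV. A $ i $ l * (inverse (fact k) * matpow A k $ l $ j * t ^ k)) sums
        (\<Sum>l\<in>UNIV. A $ i $ l * mexp (t *\<^sub>R A) $ l $ j)"
      by (intro sums_sum sums_mult mexp_entry_sums)
    ultimately show ?thesis by (simp add: sums_unique[symmetric] matrix_matrix_mult_def)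
  qed
  ultimately show ?thesis by (simp add: eq[abs_def])
qed

lemma has_vector_derivative_vec_nth:
  fixes f :: "real \<Rightarrow> 'a::real_normed_vector^'n"
  assumes "\<And>i. ((\<lambda>t. f t $ i) has_vector_derivative f' $ i) (at t within S)"
  shows "(f has_vector_derivative f') (at t within S)"
  using assms unfolding has_vector_derivative_def has_derivative_def
  by (auto intro!: bounded_linear_intros vec_tendstoI)

lemma mexp_deriv:
  "((\<lambda>t. mexp (t *\<^sub>R A)) has_vector_derivative A ** mexp (t *\<^sub>R A)) (at t within S)"
  by (intro has_vector_derivative_vec_nth)
     (use mexp_entry_deriv[of A] in \<open>auto simp: has_real_derivative_iff_has_vector_derivative intro: has_vector_derivative_at_within\<close>)

lemma continuous_on_mexp: "continuous_on S (\<lambda>t. mexp (t *\<^sub>R A))"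
  by (rule continuous_on_vector_derivative) (rule mexp_deriv)

lemma mexp_scaleR_commute: "mexp (t *\<^sub>R A) ** A = A ** mexp (t *\<^sub>R A)"
proof (cases "t = 0")
  case False
  then show ?thesis using mexp_commute[of "t *\<^sub>R A"] by (simp add: scaleR_matrix_mult)
qed (simp add: mexp_0)

text \<open>The product \<open>mexp (- t A) ** mexp ((t + r) A)\<close> has zero derivative in
  \<open>t\<close>, hence equals its value \<open>mexp (r A)\<close> at \<open>t = 0\<close>. The
  case \<open>r = 0\<close> gives inverses, and these turn the general case into the group
  law.\<close>

lemma mexp_add: "mexp ((s + t) *\<^sub>R A) = mexp (s *\<^sub>R A) ** mexp (t *\<^sub>R A)"
proof -
  define F where "F r t = mexp ((- t) *\<^sub>R A) ** mexp ((t + r) *\<^sub>R A)" for r t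
  note comm = mexp_scaleR_commute[of _ A]
  have F: "F r t = mexp (r *\<^sub>R A)" for r t
  proof -
    have neg: "((\<lambda>t. mexp ((- t) *\<^sub>R A)) has_vector_derivative - (A ** mexp ((- t) *\<^sub>R A))) (at t)" for t
    proof -
      have "(uminus has_vector_derivative (-1 :: real)) (at t)"
        by (auto intro!: derivative_eq_intros)
      from vector_diff_chain_at[OF this mexp_deriv] show ?thesis
        by (simp add: o_def)
    qed
    have sh: "((\<lambda>t. mexp ((t + r) *\<^sub>R A)) has_vector_derivative (A ** mexp ((t + r) *\<^sub>R A))) (at t)" for t
    proof -
      have "((\<lambda>t. t + r) has_vector_derivative (1 :: real)) (at t)"
        by (auto intro!: derivative_eq_intros)
      from vector_diff_chain_at[OF this mexp_deriv] show ?thesis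
        by (simp add: o_def)
    qed
    have "((F r) has_vector_derivative 0) (at t)" for t
    proof -
      have "((F r) has_vector_derivative (mexp ((- t) *\<^sub>R A) ** (A ** mexp ((t + r) *\<^sub>R A))
          + (- (A ** mexp ((- t) *\<^sub>R A))) ** mexp ((t + r) *\<^sub>R A))) (at t)"
        unfolding F_def by (rule bounded_bilinear.has_vector_derivative[OF bounded_bilinear_matrix_mult neg sh])
      moreover have "mexp ((- t) *\<^sub>R A) ** (A ** mexp ((t + r) *\<^sub>R A)) = (A ** mexp ((- t) *\<^sub>R A)) ** mexp ((t + r) *\<^sub>R A)"
        using comm[of "- t"] by (simp add: matrix_mul_assoc)
      ultimately show ?thesis
        using bounded_bilinear.minus_left[OF bounded_bilinear_matrix_mult, of "A ** mexp ((- t) *\<^sub>R A)" "mexp ((t + r) *\<^sub>R A)"]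
        by simp
    qed
    then obtain c where "F r x = c" if "x \<in> UNIV" for x
      using has_vector_derivative_zero_constant[of UNIV "F r"] by auto
    then have "F r t = F r 0" by simp
    then show ?thesis by (simp add: F_def mexp_0)
  qed
  have inv: "mexp (s *\<^sub>R A) ** mexp ((- s) *\<^sub>R A) = mat 1" for s
    using F[of 0 "- s"] by (simp add: F_def mexp_0)
  have "mexp (s *\<^sub>R A) ** mexp (t *\<^sub>R A) = mexp (s *\<^sub>R A) ** (mexp ((- s) *\<^sub>R A) ** mexp ((s + t) *\<^sub>R A))"
    using F[of t s] by (simp add: F_def)
  also have "\<dots> = mexp ((s + t) *\<^sub>R A)"
    using inv by (simp add: matrix_mul_assoc)
  finally show ?thesis by simp
qed

text \<open>Multiplicativity of \<open>det\<close> and the group law reduce the claim to the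
  derivative at \<open>0\<close>, which the Leibniz formula shows to be the trace; the resulting
  scalar equation is solved by showing that \<open>\<phi> t * exp (- t * trace A)\<close> is
  constant.\<close>

lemma det_mexp:
  fixes A :: "real^'n^'n"
  shows "det (mexp (t *\<^sub>R A)) = exp (t * trace A)"
proof -
  define M where "M = (\<lambda>t. mexp (t *\<^sub>R A))"
  define \<phi> where "\<phi> = (\<lambda>t. det (M t))"
  have d0: "(\<phi> has_real_derivative trace A) (at 0)"
  proof -
    have M0: "M 0 $ i $ j = (if i = j then 1 else 0)" for i j by (simp add: M_def mexp_0 mat_def)
    have dM: "((\<lambda>t. M t $ i $ j) has_real_derivative A $ i $ j) (at 0)" for i j
      using mexp_entry_deriv[of A i j 0] by (simp add: M_def mexp_0)
    have eq: "(\<Sum>p\<in>{p. p permutes UNIV}. of_int (sign p) *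
        (\<Sum>i\<in>UNIV. A $ i $ p i * (\<Prod>j\<in>UNIV - {i}. M 0 $ j $ p j))) = trace A"
    proof -
      \<comment> \<open>A permutation other than the identity moves at least two points.
        Differentiating one factor therefore leaves another off-diagonal entry of the identity
        matrix in the product.\<close>
      have z: "(\<Sum>i\<in>UNIV. A $ i $ p i * (\<Prod>j\<in>UNIV - {i}. M 0 $ j $ p j)) = 0"
        if p: "p permutes (UNIV :: 'n set)" "p \<noteq> id" for p
      proof (rule sum.neutral, safe)
        fix i
        have "\<exists>j. j \<noteq> i \<and> p j \<noteq> j"
        proof (rule ccontr)
          assume *: "\<nexists>j. j \<noteq> i \<and> p j \<noteq> j"
          have "inj p" using p(1) by (rule permutes_inj)
          have "p i = i"
          proof (rule ccontr)
            assume "p i \<noteq> i"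
            then have "p (p i) = p i" using * by auto
            then show False using \<open>inj p\<close> \<open>p i \<noteq> i\<close> by (auto dest: injD)
          qed
          then have "p = id" using * by (auto simp: fun_eq_iff)
          then show False using p by simp
        qed
        then obtain j where "j \<noteq> i" "p j \<noteq> j" by auto
        then have "(\<Prod>j\<in>UNIV - {i}. M 0 $ j $ p j) = 0"
          by (intro prod_zero bexI[of _ j]) (auto simp: M0)
        then show "A $ i $ p i * (\<Prod>j\<in>UNIV - {i}. M 0 $ j $ p j) = 0" by simp
      qed
      have "(\<Sum>p\<in>{p. p permutes (UNIV :: 'n set)}. of_int (sign p) *
        (\<Sum>i\<in>UNIV. A $ i $ p i * (\<Prod>j\<in>UNIV - {i}. M 0 $ j $ p j))) =
        (\<Sum>p\<in>{id}. of_int (sign p) *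
        (\<Sum>i\<in>UNIV. A $ i $ p i * (\<Prod>j\<in>UNIV - {i}. M 0 $ j $ p j)))"
        by (rule sum.mono_neutral_right) (auto simp: permutes_id z finite_permutations)
      also have "\<dots> = trace A"
        by (simp add: sign_id trace_def M0)
      finally show ?thesis .
    qed
    show ?thesis
      unfolding \<phi>_def det_def eq[symmetric]
      by (intro derivative_eq_intros DERIV_sum DERIV_cmult has_field_derivative_prod dM refl)
  qed
  have mul: "\<phi> (s + t) = \<phi> s * \<phi> t" for s t by (simp add: \<phi>_def M_def mexp_add det_mul)
  have dphi: "(\<phi> has_real_derivative \<phi> t * trace A) (at t)" for t
  proof -
    have "((\<lambda>x. \<phi> (x - t)) has_real_derivative trace A) (at t)"
      using d0 by (subst DERIV_shift[of _ _ _ "- t", simplified, symmetric]) simp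
    then have "((\<lambda>x. \<phi> t * \<phi> (x - t)) has_real_derivative \<phi> t * trace A) (at t)"
      by (rule DERIV_cmult)
    moreover have "(\<lambda>x. \<phi> t * \<phi> (x - t)) = \<phi>" by (auto simp: mul[symmetric])
    ultimately show ?thesis by simp
  qed
  have "((\<lambda>t. \<phi> t * exp (- t * trace A)) has_real_derivative 0) (at x)" for x
    by (auto intro!: derivative_eq_intros dphi)
  then have "\<phi> t * exp (- t * trace A) = \<phi> 0 * exp (- 0 * trace A)"
    by (intro DERIV_isconst_all) blast
  also have "\<dots> = 1" by (simp add: \<phi>_def M_def mexp_0)
  finally show ?thesis by (simp add: \<phi>_def M_def exp_minus field_simps)
qed

section \<open>Exponential decay from the spectrum\<close>

definition cmat :: "real^'n^'n \<Rightarrow> complex^'n^'n" where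
  "cmat M = (\<chi> i j. complex_of_real (M $ i $ j))"

definition eig_op :: "real^'n^'n \<Rightarrow> complex \<Rightarrow> complex^'n \<Rightarrow> complex^'n" where
  "eig_op B z v = cmat B *v v - z *s v"

lemma cmat_mult: "cmat (M ** N) = cmat M ** cmat N"
  by (simp add: cmat_def matrix_matrix_mult_def vec_eq_iff)

lemma eig_op_commute: "eig_op B y (eig_op B z v) = eig_op B z (eig_op B y v)"
  by (simp add: eig_op_def matrix_vector_mult_diff_distrib vector_scalar_commute
      vec.scale_right_diff_distrib vector_smult_assoc algebra_simps)

lemma fold_eig_op_commute: "fold (eig_op B) zs (eig_op B z v) = eig_op B z (fold (eig_op B) zs v)"
  
proof (induction zs arbitrary: v)
  case (Cons y zs)
  show ?case by (simp add: Cons eig_op_commute[of B y z v])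
qed simp

lemma eig_op_inj:
  fixes B :: "real^'n^'n"
  assumes "\<not> cplx_eigenvalue B z" "eig_op B z v = 0"
  shows "v = 0"
proof -
  let ?M = "(\<chi> i j. (if i = j then z else 0) - complex_of_real (B $ i $ j)) :: complex^'n^'n"
  have "invertible ?M"
    using assms(1) by (simp add: cplx_eigenvalue_def invertible_det_nz)
  moreover have "?M *v v = - eig_op B z v"
    by (simp add: eig_op_def cmat_def vec_eq_iff matrix_vector_mult_def algebra_simps sum_subtractf
        if_distrib[of "\<lambda>x. _ * x"] cong: if_cong)
  ultimately show ?thesis
    using assms(2) injD[OF inj_matrix_vector_mult[of ?M], of v 0] by simp
qed

text \<open>Replaces the Jordan form by induction over linear factors \<open>B - z\<close>. A factor
  at a non-eigenvalue is injective and, since the factors commute, can be moved outermost and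
  dropped. At an eigenvalue the component \<open>w\<close> of the orbit solves
  \<open>w' = z w + g\<close>, where \<open>g\<close> is the same component for
  \<open>u = (B - z) v\<close> and decays by induction.\<close>

lemma fold_eig_op_eq_zero_decay:
  fixes B :: "real^'n^'n"
  assumes "fold (eig_op B) zs v = 0"
    and "\<And>z. z \<in> set zs \<Longrightarrow> cplx_eigenvalue B z \<Longrightarrow> Re z < - b"
  shows "\<exists>C. \<forall>t\<ge>0. norm ((cmat (mexp (t *\<^sub>R B)) *v v) $ i) \<le> C * exp (- b * t)"
  using assms
proof (induction zs arbitrary: v)
  case Nil
  then show ?case by (auto intro!: exI[of _ 0])
next
  case (Cons z zs)
  show ?case
  proof (cases "cplx_eigenvalue B z")
    case False
    have "eig_op B z (fold (eig_op B) zs v) = 0"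
      using Cons.prems(1) by (simp add: fold_eig_op_commute)
    then have "fold (eig_op B) zs v = 0" by (rule eig_op_inj[OF False])
    then show ?thesis using Cons by auto
  next
    case True
    \<comment> \<open>The strict gap \<open>a > b\<close> makes the forcing term integrable against
      the integrating factor with no polynomial loss, even for repeated factors.\<close>
    define a where "a = - Re z"
    have ab: "a > b" using Cons.prems(2)[of z] True by (simp add: a_def)
    define u where "u = eig_op B z v"
    obtain C where C: "\<And>t. t \<ge> 0 \<Longrightarrow> norm ((cmat (mexp (t *\<^sub>R B)) *v u) $ i) \<le> C * exp (- b * t)"
      using Cons.IH[of u] Cons.prems by (auto simp: u_def)
    define w where "w = (\<lambda>t. (cmat (mexp (t *\<^sub>R B)) *v v) $ i)"
    have dw: "(w has_vector_derivative (cmat (B ** mexp (t *\<^sub>R B)) *v v) $ i) (at t)" for t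
    proof -
      have "((\<lambda>t. complex_of_real (mexp (t *\<^sub>R B) $ i $ j)) has_vector_derivative
          complex_of_real ((B ** mexp (t *\<^sub>R B)) $ i $ j)) (at t)" for j
        using mexp_entry_deriv[of B i j t]
        by (intro has_vector_derivative_of_real) (simp add: has_real_derivative_iff_has_vector_derivative)
      then show ?thesis
        unfolding w_def cmat_def matrix_vector_mult_def
        by (auto intro!: has_vector_derivative_sum has_vector_derivative_mult_left)
    qed
    have eq: "(cmat (B ** mexp (t *\<^sub>R B)) *v v) $ i - z * w t = (cmat (mexp (t *\<^sub>R B)) *v u) $ i" for t
    proof -
      have "cmat (mexp (t *\<^sub>R B)) *v (cmat B *v v) = cmat (B ** mexp (t *\<^sub>R B)) *v v"
        by (simp only: matrix_vector_mul_assoc cmat_mult[symmetric] mexp_scaleR_commute)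
      then show ?thesis
        by (simp add: u_def eig_op_def w_def matrix_vector_mult_diff_distrib vector_scalar_commute)
    qed
    \<comment> \<open>Integrating factor: the derivative of \<open>h\<close> contains only the
      forcing term.\<close>
    define h where "h = (\<lambda>t::real. exp (- z * of_real t) * w t)"
    have dh: "(h has_vector_derivative exp (- z * of_real t) * (cmat (mexp (t *\<^sub>R B)) *v u) $ i) (at t)" for t
    proof -
      have "((\<lambda>t::real. exp (- z * of_real t)) has_vector_derivative (- z * exp (- z * of_real t))) (at t)"
        by (rule has_vector_derivative_real_field[of "\<lambda>x. exp (- z * x)"])
           (auto intro!: derivative_eq_intros)
      from has_vector_derivative_mult[OF this dw[of t]]
      show ?thesis
        unfolding h_def eq[symmetric] by (simp add: algebra_simps)
    qed
    \<comment> \<open>A primitive of the bound \<open>C * exp ((a - b) * t)\<close> on the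
      derivative of \<open>h\<close>, for comparison by the mean value inequality.\<close>
    define \<phi> where "\<phi> = (\<lambda>t. C / (a - b) * exp ((a - b) * t))"
    have dphi: "(\<phi> has_vector_derivative C * exp ((a - b) * t)) (at t)" for t
      unfolding \<phi>_def has_real_derivative_iff_has_vector_derivative[symmetric]
      using ab by (auto intro!: derivative_eq_intros)
    have bound: "norm (w t) \<le> (norm (w 0) + \<bar>C / (a - b)\<bar>) * exp (- b * t)" if t: "t \<ge> 0" for t
    proof -
      have "norm (h t - h 0) \<le> \<phi> t - \<phi> 0"
      proof (cases "t = 0")
        case False
        show ?thesis
        proof (rule differentiable_bound_general[of 0 t h \<phi>])
          show "0 < t" using t False by simp
          show "continuous_on {0..t} h"
            by (rule continuous_on_vector_derivative[OF has_vector_derivative_at_within[OF dh]])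
          show "continuous_on {0..t} \<phi>"
            by (rule continuous_on_vector_derivative[OF has_vector_derivative_at_within[OF dphi]])
          fix x assume x: "0 < x" "x < t"
          have "norm (exp (- z * of_real x) * (cmat (mexp (x *\<^sub>R B)) *v u) $ i) \<le> exp (a * x) * (C * exp (- b * x))"
            using C[of x] x by (auto simp: norm_mult a_def intro!: mult_mono)
          also have "\<dots> = C * exp ((a - b) * x)" by (simp add: exp_add[symmetric] algebra_simps)
          finally show "norm (exp (- z * of_real x) * (cmat (mexp (x *\<^sub>R B)) *v u) $ i) \<le> C * exp ((a - b) * x)" .
        qed (rule dh dphi)+
      qed simp
      moreover have "norm (h t) \<le> norm (h 0) + norm (h t - h 0)"
        using norm_triangle_ineq[of "h 0" "h t - h 0"] by simp
      ultimately have "norm (h t) \<le> norm (w 0) + \<phi> t - \<phi> 0" by (simp add: h_def)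
      also have "\<dots> \<le> norm (w 0) + \<bar>C / (a - b)\<bar> * exp ((a - b) * t)"
      proof -
        have "C / (a - b) * (exp ((a - b) * t) - 1) \<le> \<bar>C / (a - b)\<bar> * (exp ((a - b) * t) - 1)"
          using ab t by (intro mult_right_mono abs_ge_self) simp
        also have "\<dots> \<le> \<bar>C / (a - b)\<bar> * exp ((a - b) * t)" by (intro mult_left_mono) auto
        finally show ?thesis by (simp add: \<phi>_def algebra_simps)
      qed
      also have "\<dots> \<le> (norm (w 0) + \<bar>C / (a - b)\<bar>) * exp ((a - b) * t)"
        using ab t mult_left_mono[of 1 "exp ((a - b) * t)" "norm (w 0)"] by (simp add: distrib_right)
      finally have "exp (- (a * t)) * norm (h t) \<le> exp (- (a * t)) * ((norm (w 0) + \<bar>C / (a - b)\<bar>) * exp ((a - b) * t))"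
        by (intro mult_left_mono) auto
      also have "\<dots> = (norm (w 0) + \<bar>C / (a - b)\<bar>) * (exp (- (a * t)) * exp ((a - b) * t))" by simp
      also have "exp (- (a * t)) * exp ((a - b) * t) = exp (- b * t)"
        by (simp add: exp_add[symmetric] algebra_simps)
      also have "exp (- (a * t)) * norm (h t) = norm (w t)"
        by (simp add: h_def norm_mult a_def mult.assoc[symmetric] exp_add[symmetric])
      finally show ?thesis .
    qed
    then show ?thesis unfolding w_def by blast
  qed
qed

text \<open>The vector \<open>p(B) v\<close>. The summation range is a parameter independent of the
  degree, so that the sums for a polynomial and for its factors run over the same indices.\<close>

definition poly_act :: "nat \<Rightarrow> real^'n^'n \<Rightarrow> complex poly \<Rightarrow> complex^'n \<Rightarrow> complex^'n" where
  "poly_act N B p v = (\<Sum>k\<le>N. coeff p k *s (cmat (matpow B k) *v v))"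

text \<open>Multiplication by \<open>B\<close> shifts all indices up by one; the strict degree bound
  says that the top coefficient, which would be pushed beyond \<open>N\<close>, is zero.\<close>

lemma poly_act_linear_factor:
  assumes "degree q < N"
  shows "poly_act N B ([:- z, 1:] * q) v = eig_op B z (poly_act N B q v)"
proof -
  obtain N' where N: "N = Suc N'" using assms by (cases N) auto
  have "coeff q N = 0" using assms by (rule coeff_eq_0)
  have "cmat B *v poly_act N B q v = (\<Sum>k\<le>N. coeff q k *s (cmat (matpow B (Suc k)) *v v))"
    unfolding poly_act_def
    by (simp add: vec.linear_sum[OF matrix_vector_mul_linear_gen] vector_scalar_commute cmat_mult
        matrix_vector_mul_assoc)
  also have "\<dots> = (\<Sum>k\<le>N'. coeff q k *s (cmat (matpow B (Suc k)) *v v))"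
    using \<open>coeff q N = 0\<close> by (simp add: N)
  also have "\<dots> = (\<Sum>k\<le>N. coeff (pCons 0 q) k *s (cmat (matpow B k) *v v))"
    unfolding N by (subst sum.atMost_Suc_shift) simp
  finally have "cmat B *v poly_act N B q v = (\<Sum>k\<le>N. coeff (pCons 0 q) k *s (cmat (matpow B k) *v v))" .
  moreover have "[:- z, 1:] * q = pCons 0 q - smult z q" by simp
  ultimately show ?thesis
    by (simp add: eig_op_def poly_act_def vec.scale_left_diff_distrib sum_subtractf vec.scale_sum_right)
qed

text \<open>Roots are split off one at a time by the fundamental theorem of algebra; the constant
  that remains at the end is the scalar \<open>a\<close>.\<close>

lemma poly_act_factorization:
  fixes B :: "real^'n^'n"
  assumes "degree p \<le> N" "p \<noteq> 0"
  shows "\<exists>zs a. a \<noteq> 0 \<and> (\<forall>v. poly_act N B p v = a *s fold (eig_op B) zs v)"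
  using assms
proof (induction "degree p" arbitrary: p)
  case 0
  then obtain a where p: "p = [:a:]" by (metis degree_eq_zeroE)
  then have "a \<noteq> 0" using 0 by auto
  moreover have "poly_act N B p v = a *s v" for v
  proof -
    have "poly_act N B p v = (\<Sum>k\<in>{0}. coeff p k *s (cmat (matpow B k) *v v))"
      unfolding poly_act_def by (rule sum.mono_neutral_right) (auto simp: p coeff_pCons split: nat.splits)
    moreover have "cmat (mat 1 :: real^'n^'n) = mat 1" by (simp add: cmat_def mat_def vec_eq_iff)
    ultimately show ?thesis by (simp add: p)
  qed
  ultimately show ?case by (intro exI[of _ "[]"] exI[of _ a]) simp
next
  case (Suc d)
  have "\<not> constant (poly p)" using Suc.hyps(2) by (simp add: constant_degree)
  then obtain z where "poly p z = 0" using fundamental_theorem_of_algebra by blast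
  then obtain q where q: "p = [:- z, 1:] * q" by (metis dvdE poly_eq_0_iff_dvd)
  have "q \<noteq> 0" using Suc q by auto
  then have dq: "degree p = Suc (degree q)" unfolding q by (subst degree_mult_eq) auto
  then obtain zs a where a: "a \<noteq> 0" "\<And>v. poly_act N B q v = a *s fold (eig_op B) zs v"
    using Suc.hyps(1)[of q] Suc.hyps(2) Suc.prems \<open>q \<noteq> 0\<close> by auto
  have "poly_act N B p v = a *s fold (eig_op B) (z # zs) v" for v
  proof -
    have "poly_act N B p v = eig_op B z (a *s fold (eig_op B) zs v)"
      unfolding q a(2)[symmetric] using dq Suc.prems by (intro poly_act_linear_factor) auto
    also have "\<dots> = a *s eig_op B z (fold (eig_op B) zs v)"
      by (simp add: eig_op_def vector_scalar_commute vec.scale_right_diff_distrib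
          vector_smult_assoc mult.commute)
    finally show ?thesis by (simp add: fold_eig_op_commute)
  qed
  then show ?case using a(1) by blast
qed

text \<open>The \<open>CARD('n) + 1\<close> vectors \<open>e, B e, B^2 e, ...\<close> in a space of
  dimension \<open>CARD('n)\<close> are linearly dependent. The polynomial may depend on
  \<open>e\<close>, so Cayley-Hamilton is avoided. Two coinciding powers form a separate case,
  because dependence is a property of the set of vectors rather than of the family.\<close>

lemma annihilating_poly:
  fixes B :: "real^'n^'n" and e :: "real^'n"
  shows "\<exists>N p. p \<noteq> 0 \<and> degree p \<le> N \<and> poly_act N B p (\<chi> i. complex_of_real (e $ i)) = 0"
proof -
  define N where "N = CARD('n)"
  define f where "f = (\<lambda>k. matpow B k *v e)"
  have "\<exists>c k0. k0 \<le> N \<and> c k0 \<noteq> 0 \<and> (\<Sum>k\<le>N. c k *\<^sub>R f k) = 0"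
  proof (cases "inj_on f {..N}")
    case True
    have "dependent (f ` {..N})"
      using card_image[OF True] by (intro dependent_biggerset) (auto simp: N_def)
    then obtain u v where uv: "v \<in> f ` {..N}" "u v \<noteq> 0" "(\<Sum>v\<in>f ` {..N}. u v *\<^sub>R v) = 0"
      by (subst (asm) real_vector.dependent_finite) auto
    then obtain k0 where "k0 \<le> N" "u (f k0) \<noteq> 0" by auto
    moreover have "(\<Sum>k\<le>N. u (f k) *\<^sub>R f k) = 0"
      using uv(3) by (simp add: sum.reindex[OF True] o_def)
    ultimately show ?thesis by (intro exI[of _ "\<lambda>k. u (f k)"] exI[of _ k0]) auto
  next
    case False
    then obtain k l where kl: "k \<le> N" "l \<le> N" "k \<noteq> l" "f k = f l" by (auto simp: inj_on_def)
    define c where "c = (\<lambda>j. if j = k then 1 else if j = l then - 1 else (0 :: real))"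
    have "(\<Sum>j\<le>N. c j *\<^sub>R f j) = (\<Sum>j\<in>{k, l}. c j *\<^sub>R f j)"
      by (rule sum.mono_neutral_right) (use kl in \<open>auto simp: c_def\<close>)
    also have "\<dots> = 0" using kl by (simp add: c_def)
    finally show ?thesis using kl by (intro exI[of _ c] exI[of _ k]) (auto simp: c_def)
  qed
  then obtain c k0 where c: "k0 \<le> N" "c k0 \<noteq> (0 :: real)" "(\<Sum>k\<le>N. c k *\<^sub>R f k) = 0" by auto
  define p where "p = (\<Sum>k\<le>N. monom (complex_of_real (c k)) k)"
  have cf: "coeff p k = (if k \<le> N then of_real (c k) else 0)" for k
    by (simp add: p_def coeff_sum sum.delta)
  have "p \<noteq> 0" using cf[of k0] c by auto
  moreover have "degree p \<le> N" by (rule degree_le) (simp add: cf)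
  moreover have "poly_act N B p (\<chi> i. complex_of_real (e $ i)) = 0"
  proof -
    have "poly_act N B p (\<chi> i. complex_of_real (e $ i)) $ i = complex_of_real ((\<Sum>k\<le>N. c k *\<^sub>R f k) $ i)" for i
      by (simp add: poly_act_def cf cmat_def matrix_vector_mult_def f_def sum_component)
    then show ?thesis using c(3) by (simp add: vec_eq_iff)
  qed
  ultimately show ?thesis by blast
qed

text \<open>Column \<open>j\<close> is the orbit of the \<open>j\<close>-th unit vector, to which
  the decay for annihilated vectors applies entry by entry; finitely many entries allow one common
  rate.\<close>

lemma mexp_decay:
  fixes B :: "real^'n^'n"
  assumes hB: "\<forall>z. cplx_eigenvalue B z \<longrightarrow> Re z < 0"
  shows "\<exists>C b. b > 0 \<and> (\<forall>t\<ge>0. norm (mexp (t *\<^sub>R B)) \<le> C * exp (- b * t))"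
proof -
  have ex: "\<exists>C b. b > 0 \<and> (\<forall>t\<ge>0. \<bar>mexp (t *\<^sub>R B) $ i $ j\<bar> \<le> C * exp (- b * t))" for i j
  proof -
    define e :: "real^'n" where "e = axis j 1"
    define v where "v = (\<chi> i. complex_of_real (e $ i))"
    obtain N p where p: "p \<noteq> 0" "degree p \<le> N" "poly_act N B p v = 0"
      using annihilating_poly[of B e] by (auto simp: v_def)
    then obtain zs a where "a \<noteq> 0" "\<forall>v. poly_act N B p v = a *s fold (eig_op B) zs v"
      using poly_act_factorization by blast
    then have z: "fold (eig_op B) zs v = 0" using p(3) by simp
    \<comment> \<open>The element \<open>1\<close> keeps the set nonempty when no root is an
      eigenvalue; halving the minimum afterwards yields the strict inequality
      \<open>Re z < - b\<close>.\<close>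
    define S where "S = insert 1 ((\<lambda>z. - Re z) ` {z \<in> set zs. cplx_eigenvalue B z})"
    define b where "b = Min S / 2"
    have S: "finite S" "S \<noteq> {}" "\<And>x. x \<in> S \<Longrightarrow> x > 0" using hB by (auto simp: S_def)
    then have b: "b > 0" using Min_in[of S] by (auto simp: b_def)
    have "Re z < - b" if "z \<in> set zs" "cplx_eigenvalue B z" for z
    proof -
      have "Min S \<le> - Re z" using S(1) that by (intro Min_le) (auto simp: S_def)
      then show ?thesis using b by (simp add: b_def)
    qed
    from fold_eig_op_eq_zero_decay[OF z this, of i]
    obtain C where "\<forall>t\<ge>0. norm ((cmat (mexp (t *\<^sub>R B)) *v v) $ i) \<le> C * exp (- b * t)" by auto
    moreover have "norm ((cmat (mexp (t *\<^sub>R B)) *v v) $ i) = \<bar>mexp (t *\<^sub>R B) $ i $ j\<bar>" for t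
    proof -
      have "(cmat (mexp (t *\<^sub>R B)) *v v) $ i = (\<Sum>k\<in>UNIV. if k = j then complex_of_real (mexp (t *\<^sub>R B) $ i $ k) else 0)"
        unfolding cmat_def matrix_vector_mult_def v_def e_def axis_def
        by (intro trans[OF vec_lambda_beta] sum.cong) auto
      then show ?thesis by simp
    qed
    ultimately show ?thesis using b by auto
  qed
  then obtain C b where b: "\<And>i j. b i j > 0"
    and C: "\<And>i j t. t \<ge> 0 \<Longrightarrow> \<bar>mexp (t *\<^sub>R B) $ i $ j\<bar> \<le> C i j * exp (- b i j * t)" by metis
  define b0 where "b0 = Min (range (\<lambda>(i, j). b i j))"
  have b0: "b0 \<le> b i j" for i j unfolding b0_def by (rule Min_le) (auto intro: range_eqI[of _ _ "(i, j)"])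
  have "b0 > 0" unfolding b0_def by (subst Min_gr_iff) (auto simp: b)
  moreover have "norm (mexp (t *\<^sub>R B)) \<le> (\<Sum>i\<in>UNIV. \<Sum>j\<in>UNIV. \<bar>C i j\<bar>) * exp (- b0 * t)" if t: "t \<ge> 0" for t
  proof -
    have "norm (mexp (t *\<^sub>R B)) \<le> (\<Sum>i\<in>UNIV. \<Sum>j\<in>UNIV. \<bar>mexp (t *\<^sub>R B) $ i $ j\<bar>)"
      by (rule norm_matrix_le_sum)
    also have "\<dots> \<le> (\<Sum>i\<in>UNIV. \<Sum>j\<in>UNIV. \<bar>C i j\<bar> * exp (- b0 * t))"
    proof (intro sum_mono)
      fix i j
      have "\<bar>mexp (t *\<^sub>R B) $ i $ j\<bar> \<le> C i j * exp (- b i j * t)" by (rule C[OF t])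
      also have "\<dots> \<le> \<bar>C i j\<bar> * exp (- b0 * t)"
        using t b0[of i j] by (intro mult_mono) (auto intro: mult_right_mono)
      finally show "\<bar>mexp (t *\<^sub>R B) $ i $ j\<bar> \<le> \<bar>C i j\<bar> * exp (- b0 * t)" .
    qed
    finally show ?thesis by (simp add: sum_distrib_right)
  qed
  ultimately show ?thesis by blast
qed

section \<open>Linear change of variables without a well-ordered index type\<close>

text \<open>
  The library's formula for the volume of a linear image is restricted to well-ordered index types.
  It is transferred to an arbitrary finite index type through a copy of that type which is ordered
  by an arbitrary enumeration.
\<close>

typedef 'a wo_copy = "UNIV :: 'a set" morphisms of_wo to_wo by simp

lemma inj_of_wo: "inj of_wo" by (rule injI) (simp add: of_wo_inject)

lemma surj_of_wo: "surj of_wo" by (rule surjI[of _ to_wo]) (simp add: to_wo_inverse)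

instance wo_copy :: (finite) finite
proof
  show "finite (UNIV :: 'a wo_copy set)"
    by (rule finite_imageD[OF _ inj_of_wo]) simp
qed

instantiation wo_copy :: (finite) wellorder
begin

definition wo_index :: "'a wo_copy \<Rightarrow> nat" where
  "wo_index = (SOME f. inj f)"

definition less_eq_wo_copy :: "'a wo_copy \<Rightarrow> 'a wo_copy \<Rightarrow> bool" where
  "x \<le> y \<longleftrightarrow> wo_index x \<le> wo_index y"

definition less_wo_copy :: "'a wo_copy \<Rightarrow> 'a wo_copy \<Rightarrow> bool" where
  "x < y \<longleftrightarrow> wo_index x < wo_index y"

lemma inj_wo_index: "inj (wo_index :: 'a wo_copy \<Rightarrow> nat)"
proof -
  have "\<exists>f :: 'a wo_copy \<Rightarrow> nat. inj f"
    using finite_imp_inj_to_nat_seg[of "UNIV :: 'a wo_copy set"] by auto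
  then show ?thesis unfolding wo_index_def by (rule someI_ex)
qed

instance
proof
  fix P :: "'a wo_copy \<Rightarrow> bool" and a
  assume step: "\<And>x. (\<And>y. y < x \<Longrightarrow> P y) \<Longrightarrow> P x"
  show "P a"
  proof (induction a rule: measure_induct_rule[of wo_index])
    case (less x)
    show ?case using less by (auto intro: step[of x] simp: less_wo_copy_def)
  qed
qed (auto simp: less_eq_wo_copy_def less_wo_copy_def dest: injD[OF inj_wo_index])

end

lemma bij_of_wo: "bij of_wo" using inj_of_wo surj_of_wo by (rule bijI)

text \<open>Rows and columns are renamed simultaneously, so each permutation in the Leibniz sum is
  only conjugated by the bijection and keeps its sign.\<close>

lemma det_reindex_wo:
  fixes A :: "real^'n^'n"
  shows "det (\<chi> i j. A $ of_wo i $ of_wo j) = det A"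
proof -
  let ?m = "map_permutation UNIV (of_wo :: 'n wo_copy \<Rightarrow> 'n)"
  let ?m' = "map_permutation UNIV (to_wo :: 'n \<Rightarrow> 'n wo_copy)"
  have b': "bij (to_wo :: 'n \<Rightarrow> 'n wo_copy)"
    by (rule bijI[OF injI surjI[of _ of_wo]]) (auto simp: to_wo_inject of_wo_inverse)
  have "det (\<chi> i j. A $ of_wo i $ of_wo j) =
      (\<Sum>q\<in>{q. q permutes (UNIV :: 'n wo_copy set)}. of_int (sign (?m q)) * (\<Prod>i\<in>UNIV. A $ i $ ?m q i))"
    unfolding det_def
  proof (rule sum.cong[OF refl])
    fix q :: "'n wo_copy \<Rightarrow> 'n wo_copy" assume q: "q \<in> {q. q permutes UNIV}"
    have "(\<Prod>i\<in>UNIV. A $ i $ ?m q i) = (\<Prod>i\<in>UNIV. A $ of_wo i $ ?m q (of_wo i))"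
      by (rule prod.reindex_bij_betw[OF bij_of_wo, symmetric])
    also have "\<dots> = (\<Prod>i\<in>UNIV. A $ of_wo i $ of_wo (q i))"
      by (simp add: map_permutation_apply[OF inj_of_wo])
    finally show "of_int (sign q) * (\<Prod>i\<in>UNIV. (\<chi> i j. A $ of_wo i $ of_wo j) $ i $ q i) =
        of_int (sign (?m q)) * (\<Prod>i\<in>UNIV. A $ i $ ?m q i)"
      using q by (simp add: sign_map_permutation[OF inj_of_wo])
  qed
  also have "\<dots> = (\<Sum>p\<in>{p. p permutes (UNIV :: 'n set)}. of_int (sign p) * (\<Prod>i\<in>UNIV. A $ i $ p i))"
  proof (rule sum.reindex_bij_betw)
    show "bij_betw ?m {q. q permutes UNIV} {p. p permutes UNIV}"
    proof (rule bij_betwI[where g = ?m'])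
      show "?m \<in> {q. q permutes UNIV} \<rightarrow> {p. p permutes UNIV}"
        using map_permutation_permutes[OF bij_of_wo] by auto
      show "?m' \<in> {p. p permutes UNIV} \<rightarrow> {q. q permutes UNIV}"
        using map_permutation_permutes[OF b'] by auto
      show "?m' (?m q) = q" if "q \<in> {q. q permutes UNIV}" for q
        using map_permutation_compose_inv[OF bij_of_wo, of q to_wo] that by (auto simp: of_wo_inverse)
      show "?m (?m' p) = p" if "p \<in> {p. p permutes UNIV}" for p
        using map_permutation_compose_inv[OF b', of p of_wo] that by (auto simp: to_wo_inverse)
    qed
  qed
  finally show ?thesis unfolding det_def .
qed

lemma prod_Basis_cart:
  fixes f :: "real^'n \<Rightarrow> 'b::comm_monoid_mult"
  shows "(\<Prod>b\<in>Basis. f b) = (\<Prod>i\<in>UNIV. f (axis i 1))"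
proof -
  have B: "(Basis :: (real^'n) set) = range (\<lambda>i. axis i 1)" by (auto simp: Basis_vec_def)
  have inj: "inj (\<lambda>i. axis i 1 :: real^'n)" by (auto simp: inj_def axis_eq_axis)
  show ?thesis unfolding B prod.reindex[OF inj] by (simp add: o_def)
qed

text \<open>Renaming coordinates carries boxes to boxes with the same side lengths, and boxes
  determine Lebesgue measure.\<close>

lemma distr_lborel_reindex_wo:
  "distr lborel borel (\<lambda>x :: real^'n. \<chi> i. x $ of_wo i) = (lborel :: (real^'n wo_copy) measure)"
proof (rule lborel_eqI[symmetric])
  let ?r = "\<lambda>x :: real^'n. \<chi> i. x $ of_wo i"
  have "linear ?r" by (rule linearI) (auto simp: vec_eq_iff)
  then have [measurable]: "?r \<in> borel_measurable borel"
    by (intro borel_measurable_continuous_onI linear_continuous_on) (simp add: linear_conv_bounded_linear)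
  fix l u :: "real^'n wo_copy"
  assume le: "\<And>b. b \<in> Basis \<Longrightarrow> l \<bullet> b \<le> u \<bullet> b"
  define l' u' where "l' = (\<chi> i. l $ to_wo i)" and "u' = (\<chi> i. u $ to_wo i)"
  have le': "l $ i \<le> u $ i" for i using le[of "axis i 1"] by (simp add: inner_axis)
  have "?r -` box l u = box l' u'"
    by (auto simp: mem_box_cart l'_def u'_def) (metis of_wo_inverse to_wo_inverse UNIV_I)+
  then have "emeasure (distr lborel borel ?r) (box l u) = emeasure lborel (box l' u')"
    by (simp add: emeasure_distr)
  also have "\<dots> = (\<Prod>b\<in>Basis. (u' - l') \<bullet> b)"
    using le' by (intro emeasure_lborel_box) (auto simp: Basis_vec_def inner_axis l'_def u'_def)
  also have "(\<Prod>b\<in>Basis. (u' - l') \<bullet> b) = (\<Prod>i\<in>UNIV. u' $ i - l' $ i)"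
    by (simp add: prod_Basis_cart inner_axis)
  also have "\<dots> = (\<Prod>i\<in>UNIV. u' $ of_wo i - l' $ of_wo i)"
    by (rule prod.reindex_bij_betw[OF bij_of_wo, symmetric])
  also have "\<dots> = (\<Prod>b\<in>Basis. (u - l) \<bullet> b)"
    by (simp add: prod_Basis_cart inner_axis l'_def u'_def of_wo_inverse)
  finally show "emeasure (distr lborel borel ?r) (box l u) = ennreal (\<Prod>b\<in>Basis. (u - l) \<bullet> b)" .
qed simp

lemma borel_measurable_matrix_vector_mult [measurable]:
  "(\<lambda>x. (T :: real^'n^'m) *v x) \<in> borel_measurable borel"
  by (rule borel_measurable_continuous_onI) (rule matrix_vector_mult_linear_continuous_on)

text \<open>The volume formula for linear images is applied to the preimage of a box, which is open
  and bounded; agreement on boxes upgrades it to an identity of measures.\<close>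

lemma lborel_eq_scaled_linear_image_wo:
  fixes T :: "real^'n::{finite,wellorder}^'n::_"
  assumes "det T \<noteq> 0"
  shows "lborel = scale_measure (ennreal \<bar>det T\<bar>) (distr lborel borel ((*v) T))"
proof (rule lborel_eqI)
  fix l u :: "(real, 'n) vec"
  assume le: "\<And>b. b \<in> Basis \<Longrightarrow> l \<bullet> b \<le> u \<bullet> b"
  obtain T' where T': "T' ** T = mat 1" "T ** T' = mat 1"
    using assms invertible_det_nz[of T] by (auto simp: invertible_def)
  have 1: "T' *v (T *v x) = x" "T *v (T' *v x) = x" for x
    by (auto simp: matrix_vector_mul_assoc T')
  define V where "V = (\<lambda>x. T *v x) -` box l u"
  have VI: "V = (\<lambda>x. T' *v x) ` box l u"
    unfolding V_def by (auto simp: 1 image_iff intro!: exI[of _ "T *v _"] bexI[of _ "T *v _"])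
  have "open V" unfolding V_def by (intro open_vimage matrix_vector_mult_linear_continuous_on) auto
  moreover have "bounded V" unfolding VI
    by (intro bounded_linear_image bounded_box) simp
  ultimately have V: "V \<in> lmeasurable" "V \<in> sets borel" by (auto intro: lmeasurable_open)
  have "(\<lambda>x. T *v x) ` V = box l u" unfolding VI by (auto simp: image_image 1)
  then have "measure lebesgue (box l u) = \<bar>det T\<bar> * measure lebesgue V"
    using measure_linear_image[of "(*v) T" V] V(1) by simp
  then have *: "measure lborel (box l u) = \<bar>det T\<bar> * measure lborel V"
    using V(2) by (simp add: measure_completion)
  have fin: "emeasure lborel V < \<infinity>"
    using V by (auto simp: fmeasurable_def emeasure_completion)
  have "emeasure (scale_measure (ennreal \<bar>det T\<bar>) (distr lborel borel ((*v) T))) (box l u) =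
      ennreal \<bar>det T\<bar> * emeasure lborel V"
    by (simp add: emeasure_distr V_def)
  also have "\<dots> = ennreal \<bar>det T\<bar> * ennreal (measure lborel V)"
    using fin by (simp add: emeasure_eq_ennreal_measure top.not_eq_extremum)
  also have "\<dots> = ennreal (measure lborel (box l u))"
    by (simp add: * ennreal_mult)
  also have "\<dots> = ennreal (\<Prod>b\<in>Basis. (u - l) \<bullet> b)"
    using le by (simp add: measure_lborel_box_eq)
  finally show "emeasure (scale_measure (ennreal \<bar>det T\<bar>) (distr lborel borel ((*v) T))) (box l u) = ennreal (\<Prod>b\<in>Basis. (u - l) \<bullet> b)" .
qed simp

text \<open>The integral is carried to the ordered copy, where the scaling identity holds, and back;
  the matrix conjugated by the renaming has the same determinant.\<close>

lemma nn_integral_linear_image: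
  fixes T :: "real^'n^'n"
  assumes [measurable]: "f \<in> borel_measurable borel" and det: "det T \<noteq> 0"
  shows "(\<integral>\<^sup>+x. f x \<partial>lborel) = ennreal \<bar>det T\<bar> * (\<integral>\<^sup>+x. f (T *v x) \<partial>lborel)"
proof -
  let ?r = "\<lambda>x :: real^'n. \<chi> i. x $ of_wo i"
  let ?s = "\<lambda>x :: real^'n wo_copy. \<chi> i. x $ to_wo i"
  define T' where "T' = (\<chi> i j. T $ of_wo i $ of_wo j)"
  have dT: "det T' = det T" by (simp add: T'_def det_reindex_wo)
  have "linear ?r" "linear ?s" by (auto intro!: linearI simp: vec_eq_iff)
  then have [measurable]: "?r \<in> borel_measurable borel" "?s \<in> borel_measurable borel"
    by (auto intro!: borel_measurable_continuous_onI linear_continuous_on simp: linear_conv_bounded_linear)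
  have sr: "?s (?r x) = x" for x by (simp add: vec_eq_iff to_wo_inverse)
  have Tr: "T' *v ?r x = ?r (T *v x)" for x
    unfolding T'_def matrix_vector_mult_def vec_eq_iff
    by (simp add: sum.reindex_bij_betw[OF bij_of_wo, of "\<lambda>j. T $ _ $ j * x $ j"])
  have eq: "(\<integral>\<^sup>+x. g (?r x) \<partial>lborel) = (\<integral>\<^sup>+y. g y \<partial>lborel)" if [measurable]: "g \<in> borel_measurable borel" for g
    by (subst distr_lborel_reindex_wo[symmetric], subst nn_integral_distr) auto
  have "(\<integral>\<^sup>+x. f x \<partial>lborel) = (\<integral>\<^sup>+x. f (?s (?r x)) \<partial>lborel)" by (simp only: sr)
  also have "\<dots> = (\<integral>\<^sup>+y. f (?s y) \<partial>lborel)" by (rule eq) measurable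
  also have "\<dots> = (\<integral>\<^sup>+y. f (?s y) \<partial>scale_measure (ennreal \<bar>det T\<bar>) (distr lborel borel ((*v) T')))"
    by (subst lborel_eq_scaled_linear_image_wo[of T']) (auto simp: dT det)
  also have "\<dots> = ennreal \<bar>det T\<bar> * (\<integral>\<^sup>+y. f (?s (T' *v y)) \<partial>lborel)"
    by (subst nn_integral_scale_measure, measurable, subst nn_integral_distr) auto
  also have "(\<integral>\<^sup>+y. f (?s (T' *v y)) \<partial>lborel) = (\<integral>\<^sup>+x. f (?s (T' *v ?r x)) \<partial>lborel)"
    by (rule eq[symmetric]) measurable
  also have "\<dots> = (\<integral>\<^sup>+x. f (T *v x) \<partial>lborel)" by (simp only: Tr sr)
  finally show ?thesis .
qed

section \<open>Positive definite matrices\<close>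

text \<open>The norm of a matrix, as a vector of rows, is the Frobenius norm, and it dominates the
  operator norm by Cauchy-Schwarz in each row.\<close>

lemma norm_matrix_vector_le: "norm ((A :: real^'n^'m) *v x) \<le> norm A * norm x"
proof -
  have "norm (A *v x) = L2_set (\<lambda>i. \<bar>A $ i \<bullet> x\<bar>) UNIV"
    by (simp add: norm_vec_def matrix_vector_mul_component)
  also have "\<dots> \<le> L2_set (\<lambda>i. norm (A $ i) * norm x) UNIV"
    by (rule L2_set_mono) (auto simp: Cauchy_Schwarz_ineq2)
  also have "\<dots> = norm A * norm x"
    by (simp add: norm_vec_def[of A] L2_set_left_distrib)
  finally show ?thesis .
qed

lemma norm_transpose: "norm (transpose (A :: real^'n^'m)) = norm A"
proof -
  have "(\<Sum>i\<in>UNIV. \<Sum>j\<in>UNIV. (A $ j $ i)\<^sup>2) = (\<Sum>j\<in>UNIV. \<Sum>i\<in>UNIV. (A $ j $ i)\<^sup>2)"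
    by (rule sum.swap)
  then show ?thesis by (simp add: norm_vec_def L2_set_def transpose_def sum_nonneg)
qed

lemma norm_matrix_mult_le: "norm ((A :: real^'n^'m) ** (B :: real^'p^'n)) \<le> norm A * norm B"
proof -
  have "norm ((A ** B) $ i) \<le> norm B * norm (A $ i)" for i
  proof -
    have "(A ** B) $ i = transpose B *v (A $ i)"
      by (simp add: vec_eq_iff matrix_matrix_mult_def matrix_vector_mult_def transpose_def mult.commute)
    then show ?thesis using norm_matrix_vector_le[of "transpose B" "A $ i"] by (simp add: norm_transpose)
  qed
  then have "L2_set (\<lambda>i. norm ((A ** B) $ i)) UNIV \<le> L2_set (\<lambda>i. norm B * norm (A $ i)) UNIV"
    by (intro L2_set_mono) auto
  also have "\<dots> = norm A * norm B"
    by (simp add: norm_vec_def[of A] L2_set_right_distrib mult.commute)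
  finally show ?thesis by (simp add: norm_vec_def[of "A ** B"])
qed

lemma inner_matrix_transpose: "x \<bullet> ((A :: real^'n^'m) *v y) = (transpose A *v x) \<bullet> y"
  by (simp add: dot_lmul_matrix[symmetric] transpose_matrix_vector)

lemma mexp_near_identity:
  fixes A :: "real^'n^'n"
  shows "\<exists>C\<ge>0. \<forall>s. \<bar>s\<bar> \<le> 1 \<longrightarrow> norm (mexp (s *\<^sub>R A)) \<le> C \<and> norm (mexp (s *\<^sub>R A) - mat 1) \<le> C * \<bar>s\<bar>"
proof -
  have "bounded ((\<lambda>s. mexp (s *\<^sub>R A)) ` {-1..1})"
    by (intro compact_imp_bounded compact_continuous_image continuous_on_mexp) auto
  then obtain K where K: "\<And>s. s \<in> {-1..1} \<Longrightarrow> norm (mexp (s *\<^sub>R A)) \<le> K"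
    unfolding bounded_iff by blast
  have "K \<ge> 0" by (rule order_trans[OF norm_ge_zero K[of 0]]) simp
  define L where "L = norm A * K"
  have L: "L \<ge> 0" using \<open>K \<ge> 0\<close> by (simp add: L_def)
  have near: "norm (mexp (s *\<^sub>R A) - mat 1) \<le> L * \<bar>s\<bar>" if s: "\<bar>s\<bar> \<le> 1" for s
  proof -
    have "norm (mexp (s *\<^sub>R A) - mexp (0 *\<^sub>R A)) \<le> L * norm (s - 0)"
    proof (rule differentiable_bound[of "{-1..1}"])
      fix x :: real assume x: "x \<in> {-1..1}"
      show "((\<lambda>s. mexp (s *\<^sub>R A)) has_derivative (\<lambda>h. h *\<^sub>R (A ** mexp (x *\<^sub>R A)))) (at x within {-1..1})"
        using mexp_deriv[of A x "{-1..1}"] by (simp add: has_vector_derivative_def)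
      have "norm (A ** mexp (x *\<^sub>R A)) \<le> L"
        using K[OF x] unfolding L_def
        by (rule order_trans[OF norm_matrix_mult_le mult_left_mono]) simp
      then show "onorm (\<lambda>h. h *\<^sub>R (A ** mexp (x *\<^sub>R A))) \<le> L"
        by (intro onorm_bound L) (simp add: mult.commute[of L] mult_left_mono)
    qed (use s in auto)
    then show ?thesis by (simp add: mexp_0)
  qed
  show ?thesis
  proof (intro exI[of _ "max K L"] conjI allI impI)
    fix s :: real assume s: "\<bar>s\<bar> \<le> 1"
    show "norm (mexp (s *\<^sub>R A)) \<le> max K L" using K[of s] s by (simp add: abs_le_iff le_max_iff_disj)
    show "norm (mexp (s *\<^sub>R A) - mat 1) \<le> max K L * \<bar>s\<bar>"
      using near[OF s] by (rule order_trans) (intro mult_right_mono, auto)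
  qed (use \<open>K \<ge> 0\<close> in auto)
qed

text \<open>Compactness of the unit sphere provides the minimum, and homogeneity extends it to all
  vectors.\<close>

lemma quadratic_form_lower_bound:
  fixes M :: "real^'n^'n"
  assumes "\<And>x. x \<noteq> 0 \<Longrightarrow> x \<bullet> (M *v x) > 0"
  shows "\<exists>a>0. \<forall>x. a * (norm x)\<^sup>2 \<le> x \<bullet> (M *v x)"
proof -
  have "compact (sphere (0 :: real^'n) 1)" by simp
  moreover have "sphere (0 :: real^'n) 1 \<noteq> {}" by simp
  moreover have "continuous_on (sphere 0 1) (\<lambda>x. x \<bullet> (M *v x))" by (intro continuous_intros)
  ultimately obtain x0 where x0: "x0 \<in> sphere 0 1" "\<And>x. x \<in> sphere 0 1 \<Longrightarrow> x0 \<bullet> (M *v x0) \<le> x \<bullet> (M *v x)"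
    using continuous_attains_inf[of "sphere (0 :: real^'n) 1" "\<lambda>x. x \<bullet> (M *v x)"] by blast
  define a where "a = x0 \<bullet> (M *v x0)"
  have "x0 \<noteq> 0" using x0 by auto
  then have "a > 0" using assms by (simp add: a_def)
  moreover have "a * (norm x)\<^sup>2 \<le> x \<bullet> (M *v x)" for x
  proof (cases "x = 0")
    case False
    define y where "y = inverse (norm x) *\<^sub>R x"
    have "y \<in> sphere 0 1" using False by (simp add: y_def)
    then have "a \<le> y \<bullet> (M *v y)" using x0(2) by (simp add: a_def)
    also have "\<dots> = (x \<bullet> (M *v x)) / (norm x)\<^sup>2"
      by (simp add: y_def matrix_vector_mult_scaleR power2_eq_square divide_simps)
    finally show ?thesis using False by (simp add: field_simps)
  qed simp
  ultimately show ?thesis by blast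
qed

lemma continuous_on_det:
  assumes "continuous_on S f"
  shows "continuous_on S (\<lambda>s. det (f s :: real^'n^'n))"
proof -
  have "continuous_on S (\<lambda>s. f s $ i $ j)" for i j
    using assms by (intro continuous_on_component)
  then show ?thesis
    unfolding det_def by (intro continuous_on_sum continuous_on_mult continuous_on_prod continuous_on_const)
qed

text \<open>Everything is read off from two-sided bounds on the quadratic form, without
  diagonalising \<open>M\<close>. The constants are explicit so that they can be followed uniformly
  in \<open>t\<close> for \<open>M = Qt Q B t\<close>.\<close>

lemma posdef_matrix:
  fixes M :: "real^'n^'n"
  assumes a: "a > 0" "\<And>x. a * (norm x)\<^sup>2 \<le> x \<bullet> (M *v x)"
    and b: "b > 0" "\<And>x. x \<bullet> (M *v x) \<le> b * (norm x)\<^sup>2"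
    and sym: "transpose M = M"
  shows "matrix_inv M ** M = mat 1" "M ** matrix_inv M = mat 1"
    and "transpose (matrix_inv M) = matrix_inv M"
    and "(norm x)\<^sup>2 / b \<le> x \<bullet> (matrix_inv M *v x)"
    and "a ^ CARD('n) \<le> det M"
proof -
  have inj: "M *v x = 0 \<Longrightarrow> x = 0" for x using a(2)[of x] a(1) by (auto simp: mult_le_0_iff)
  have dnz: "det N \<noteq> 0" if "\<And>x. N *v x = 0 \<Longrightarrow> x = 0" for N :: "real^'n^'n"
    using that by (simp flip: invertible_det_nz add: invertible_left_inverse matrix_left_invertible_ker)
  have "invertible M" using dnz[OF inj] by (simp add: invertible_det_nz)
  then have "matrix_inv M ** M = mat 1 \<and> M ** matrix_inv M = mat 1"
    unfolding invertible_def matrix_inv_def by (rule someI2_ex) blast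
  then show I: "matrix_inv M ** M = mat 1" "M ** matrix_inv M = mat 1" by auto
  have "transpose (matrix_inv M) ** M = mat 1"
    using arg_cong[OF I(2), of transpose] by (simp add: matrix_transpose_mul sym transpose_mat)
  then show "transpose (matrix_inv M) = matrix_inv M"
  proof -
    assume *: "transpose (matrix_inv M) ** M = mat 1"
    have "transpose (matrix_inv M) = (transpose (matrix_inv M) ** M) ** matrix_inv M"
      by (simp add: matrix_mul_assoc[symmetric] I)
    then show ?thesis by (simp add: *)
  qed
  show "(norm x)\<^sup>2 / b \<le> x \<bullet> (matrix_inv M *v x)"
  proof -
    \<comment> \<open>Testing positivity of the form at \<open>z - x / b\<close> is the optimal
      choice: the mixed term \<open>- 2 |x|^2 / b\<close> outweighs
      \<open>b |y|^2 = |x|^2 / b\<close> and leaves exactly the desired bound.\<close>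
    define z y where "z = matrix_inv M *v x" and "y = inverse b *\<^sub>R x"
    have Mz: "M *v z = x" by (simp add: z_def matrix_vector_mul_assoc I)
    have "0 \<le> (z - y) \<bullet> (M *v (z - y))" 
      by (rule order_trans[OF _ a(2)]) (use a(1) in simp)
    also have "\<dots> = x \<bullet> z - 2 * (x \<bullet> y) + y \<bullet> (M *v y)"
    proof -
      have "z \<bullet> (M *v y) = x \<bullet> y" by (simp add: inner_matrix_transpose sym Mz)
      then show ?thesis by (simp add: matrix_vector_mult_diff_distrib Mz inner_diff inner_commute)
    qed
    also have "\<dots> \<le> x \<bullet> z - 2 * (x \<bullet> y) + b * (norm y)\<^sup>2" using b(2)[of y] by simp
    also have "\<dots> = x \<bullet> z - (norm x)\<^sup>2 / b"
      using b(1) by (simp add: y_def dot_square_norm power_mult_distrib field_simps power2_eq_square)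
    finally show ?thesis by (simp add: z_def)
  qed
  show "a ^ CARD('n) \<le> det M"
  proof -
    \<comment> \<open>The segment from the identity to \<open>M\<close> consists of matrices with
      positive form, hence nonzero determinant, so the determinant keeps the sign it has at the
      identity.\<close>
    have pos: "det M > 0"
    proof (rule ccontr)
      assume "\<not> det M > 0"
      define N where "N s = (1 - s) *\<^sub>R mat 1 + s *\<^sub>R M" for s
      have "continuous_on {0..1} (\<lambda>s. det (N s))"
        unfolding N_def by (intro continuous_on_det continuous_intros)
      moreover have "det (N 0) > 0" "det (N 1) \<le> 0" using \<open>\<not> det M > 0\<close> by (auto simp: N_def)
      ultimately obtain s where s: "0 \<le> s" "s \<le> 1" "det (N s) = 0"
        using IVT2'[of "\<lambda>s. det (N s)" 1 0 0] by auto
      have "x = 0" if "N s *v x = 0" for x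
      proof -
        have "0 = x \<bullet> (N s *v x)" by (simp add: that)
        also have "\<dots> = (1 - s) * (norm x)\<^sup>2 + s * (x \<bullet> (M *v x))"
          by (simp add: N_def matrix_vector_mult_add_rdistrib scaleR_matrix_vector_assoc[symmetric]
              inner_add_right power2_norm_eq_inner)
        also have "\<dots> \<ge> (1 - s) * (norm x)\<^sup>2 + s * (a * (norm x)\<^sup>2)"
          using a(2)[of x] s by (intro add_left_mono mult_left_mono) auto
        finally have "((1 - s) + s * a) * (norm x)\<^sup>2 \<le> 0" by (simp add: algebra_simps)
        moreover have "(1 - s) + s * a > 0"
        proof (cases "s = 0")
          case False
          then show ?thesis using s a(1) by (intro add_nonneg_pos) auto
        qed simp
        ultimately show ?thesis by (simp add: mult_le_0_iff)
      qed
      then show False using dnz s(3) by blast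
    qed
    \<comment> \<open>Volume comparison: \<open>a |x|^2 \<le> |x| |M x|\<close> puts the preimage of
      the ball of radius \<open>a\<close> inside the unit ball, so the volume \<open>a ^ n\<close>
      of the former, up to the unit ball volume, is at most \<open>det M\<close>.\<close>
    have "ennreal (unit_ball_vol (real CARD('n)) * a ^ CARD('n)) = emeasure lborel (cball (0 :: real^'n) a)"
      using a by (simp add: emeasure_cball)
    also have "\<dots> = (\<integral>\<^sup>+x. indicator (cball (0 :: real^'n) a) x \<partial>lborel)" by simp
    also have "\<dots> = ennreal \<bar>det M\<bar> * (\<integral>\<^sup>+x. indicator (cball (0 :: real^'n) a) (M *v x) \<partial>lborel)"
      using pos by (intro nn_integral_linear_image borel_measurable_indicator) auto
    also have "\<dots> \<le> ennreal \<bar>det M\<bar> * (\<integral>\<^sup>+x. indicator (cball (0 :: real^'n) 1) x \<partial>lborel)"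
    proof (intro mult_left_mono nn_integral_mono)
      fix x :: "real^'n"
      have "norm x \<le> 1" if "norm (M *v x) \<le> a"
      proof -
        have "a * (norm x)\<^sup>2 \<le> norm x * norm (M *v x)"
          using order_trans[OF a(2) norm_cauchy_schwarz] .
        also have "\<dots> \<le> norm x * a" using that by (intro mult_left_mono) auto
        finally have "(norm x) * (norm x) \<le> norm x * 1" using a(1) by (simp add: power2_eq_square)
        then show ?thesis by (cases "x = 0") (auto dest: mult_left_le_imp_le)
      qed
      then show "indicator (cball 0 a) (M *v x) \<le> (indicator (cball 0 1) x :: ennreal)"
        by (auto simp: indicator_def)
    qed auto
    also have "\<dots> = ennreal (det M * unit_ball_vol (real CARD('n)))"
      using pos by (simp add: emeasure_cball ennreal_mult)
    finally have "unit_ball_vol (real CARD('n)) * a ^ CARD('n) \<le> det M * unit_ball_vol (real CARD('n))"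
      using pos by (subst (asm) ennreal_le_iff) auto
    moreover have "unit_ball_vol (real CARD('n)) > 0" by simp
    ultimately show ?thesis by (simp add: mult.commute)
  qed
qed

text \<open>Follows from \<open>1 + b \<le> e^b\<close> and
  \<open>N b \<le> N^2 / (4 c) + c b^2\<close>; this is where Gaussian decay is traded for rational
  decay.\<close>

lemma exp_neg_square_le:
  assumes c: "c > 0" and b: "b \<ge> 0"
  shows "exp (- (c * b\<^sup>2)) \<le> exp ((real N)\<^sup>2 / (4 * c)) / (1 + b) ^ N"
proof -
  have "(1 + b) ^ N \<le> exp b ^ N" using b by (intro power_mono) (auto simp: add.commute)
  also have "\<dots> = exp (real N * b)" by (simp add: exp_of_nat_mult)
  also have "\<dots> \<le> exp ((real N)\<^sup>2 / (4 * c) + c * b\<^sup>2)"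
  proof -
    have "0 \<le> (real N - 2 * c * b)\<^sup>2 / (4 * c)" using c by simp
    also have "\<dots> = (real N)\<^sup>2 / (4 * c) - real N * b + c * b\<^sup>2"
      using c by (simp add: field_simps power2_eq_square)
    finally show ?thesis by simp
  qed
  finally have "(1 + b) ^ N * exp (- (c * b\<^sup>2)) \<le> exp ((real N)\<^sup>2 / (4 * c) + c * b\<^sup>2) * exp (- (c * b\<^sup>2))"
    by (intro mult_right_mono) auto
  also have "\<dots> = exp ((real N)\<^sup>2 / (4 * c))" by (simp add: exp_add[symmetric])
  finally show ?thesis using b by (simp add: field_simps)
qed

section \<open>The covariance matrices\<close>

locale stable_pair =
  fixes Q B :: "real^'n^'n"
  assumes hQ: "sym_pos_def Q"
    and hB: "\<forall>z. cplx_eigenvalue B z \<longrightarrow> Re z < 0"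
begin

definition E :: "real \<Rightarrow> real^'n^'n" where "E t = mexp (t *\<^sub>R B)"

definition F :: "real \<Rightarrow> real^'n^'n" where "F s = E s ** Q ** transpose (E s)"

abbreviation "Qi \<equiv> Qinf Q B"
abbreviation "P \<equiv> matrix_inv Qi"
abbreviation "S t \<equiv> matrix_inv (Qt Q B t)"
abbreviation "D t \<equiv> Dt Q B t"
abbreviation "R \<equiv> Rfun Q B"

lemma E_0: "E 0 = mat 1" by (simp add: E_def mexp_0)

lemma E_add: "E (s + t) = E s ** E t" by (simp add: E_def mexp_add)

lemma E_minus: "E s ** E (- s) = mat 1" "E (- s) ** E s = mat 1"
  using E_add[of s "- s"] E_add[of "- s" s] by (simp_all add: E_0)

lemma continuous_on_E: "continuous_on X E"
  unfolding E_def[abs_def] by (rule continuous_on_mexp)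

lemma det_E: "det (E t) = exp (t * trace B)"
  by (simp add: E_def det_mexp)

lemma E_near: "\<exists>C\<ge>1. \<forall>s. \<bar>s\<bar> \<le> 1 \<longrightarrow> norm (E s) \<le> C \<and> norm (E s - mat 1) \<le> C * \<bar>s\<bar>"
proof -
  obtain C where C: "C \<ge> 0" "\<And>s. \<bar>s\<bar> \<le> 1 \<Longrightarrow> norm (E s) \<le> C \<and> norm (E s - mat 1) \<le> C * \<bar>s\<bar>"
    using mexp_near_identity[of B] by (auto simp: E_def)
  show ?thesis
    by (rule exI[of _ "C + 1"]) (use C in \<open>force simp: distrib_right\<close>)
qed

lemma E_decay: "\<exists>C b. b > 0 \<and> C \<ge> 1 \<and> (\<forall>t\<ge>0. norm (E t) \<le> C * exp (- b * t))"
proof -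
  obtain C b where b: "b > 0" and C: "\<And>t. t \<ge> 0 \<Longrightarrow> norm (E t) \<le> C * exp (- b * t)"
    using mexp_decay[OF hB] by (auto simp: E_def)
  have "norm (E t) \<le> max C 1 * exp (- b * t)" if "t \<ge> 0" for t
    using C[OF that] by (rule order_trans) (intro mult_right_mono, auto)
  then show ?thesis using b by (intro exI[of _ "max C 1"] exI[of _ b]) auto
qed

lemma transpose_Q: "transpose Q = Q"
  using hQ by (simp add: sym_pos_def_def)

lemma transpose_F: "transpose (F s) = F s"
  by (simp add: F_def matrix_transpose_mul transpose_Q matrix_mul_assoc)

lemma F_add: "F (t + s) = E t ** F s ** transpose (E t)"
  by (simp add: F_def E_add matrix_transpose_mul matrix_mul_assoc)

lemma F_form: "x \<bullet> (F s *v x) = (transpose (E s) *v x) \<bullet> (Q *v (transpose (E s) *v x))"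
  by (simp add: F_def inner_matrix_transpose matrix_vector_mul_assoc[symmetric])

lemma F_form_nonneg: "0 \<le> x \<bullet> (F s *v x)"
proof -
  have "0 \<le> y \<bullet> (Q *v y)" for y
    using hQ by (cases "y = 0") (auto simp: sym_pos_def_def less_imp_le)
  then show ?thesis unfolding F_form by blast
qed

lemma continuous_on_F: "continuous_on X F"
  unfolding F_def[abs_def]
  by (intro bounded_bilinear.continuous_on[OF bounded_bilinear_matrix_mult]
      bounded_linear.continuous_on[OF bounded_linear_transpose] continuous_on_E continuous_on_const)

lemma F_bound: "\<exists>C b. b > 0 \<and> C > 0 \<and> (\<forall>s\<ge>0. norm (F s) \<le> C * exp (- b * s))"
proof -
  obtain C b where b: "b > 0" "C \<ge> 1" and C: "\<And>t. t \<ge> 0 \<Longrightarrow> norm (E t) \<le> C * exp (- b * t)"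
    using E_decay by auto
  have "norm (F s) \<le> (C\<^sup>2 * norm Q + 1) * exp (- (2 * b) * s)" if s: "s \<ge> 0" for s
  proof -
    have "norm (F s) \<le> norm (E s) * norm Q * norm (E s)"
      unfolding F_def
      by (rule order_trans[OF norm_matrix_mult_le])
         (simp add: norm_transpose mult_right_mono norm_matrix_mult_le)
    also have "\<dots> \<le> (C * exp (- b * s)) * norm Q * (C * exp (- b * s))"
      using C[OF s] b(2) by (intro mult_mono) auto
    also have "\<dots> = C\<^sup>2 * norm Q * (exp (- b * s) * exp (- b * s))"
      by (simp add: power2_eq_square)
    also have "exp (- b * s) * exp (- b * s) = exp (- (2 * b) * s)"
      by (simp add: exp_add[symmetric])
    also have "C\<^sup>2 * norm Q * exp (- (2 * b) * s) \<le> (C\<^sup>2 * norm Q + 1) * exp (- (2 * b) * s)"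
      by (intro mult_right_mono) auto
    finally show ?thesis .
  qed
  moreover have "C\<^sup>2 * norm Q + 1 > 0" by (rule add_nonneg_pos) auto
  ultimately show ?thesis using b(1) by (intro exI[of _ "C\<^sup>2 * norm Q + 1"] exI[of _ "2 * b"]) auto
qed

lemma set_integrable_F: "set_integrable lborel {0..} F"
proof -
  obtain C b where b: "b > 0" "C > 0" and C: "\<And>s. s \<ge> 0 \<Longrightarrow> norm (F s) \<le> C * exp (- b * s)"
    using F_bound by auto
  have [measurable]: "F \<in> borel_measurable borel"
    by (intro borel_measurable_continuous_onI continuous_on_F)
  have "F absolutely_integrable_on {0..}"
  proof (rule measurable_bounded_by_integrable_imp_absolutely_integrable)
    show "F \<in> borel_measurable (lebesgue_on {0..})"
      by (intro continuous_imp_measurable_on_sets_lebesgue continuous_on_F) auto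
    show "(\<lambda>s. C * exp (- b * s)) integrable_on {0..}"
      using integrable_on_exp_minus_to_infinity[of b 0] b by (intro integrable_on_mult_right) auto
  qed (use C in auto)
  then show ?thesis
    unfolding set_integrable_def by (subst (asm) integrable_completion) auto
qed

text \<open>Shifting time by \<open>t\<close> conjugates the integrand by \<open>E t\<close>, and
  this constant linear map can be taken out of the integral.\<close>

lemma F_has_integral_tail:
  assumes t: "t \<ge> 0"
  shows "(F has_integral (E t ** Qi ** transpose (E t))) {t..}"
proof -
  have si: "set_integrable lborel {t..} F"
    by (rule set_integrable_subset[OF set_integrable_F]) (use t in auto)
  have lin: "bounded_linear (\<lambda>M. E t ** M ** transpose (E t))"
    by (intro bounded_linear_compose[OF matrix_mult_right_linear matrix_mult_left_linear])
  have "integral {t..} F = (LINT s|lborel. indicator {t..} s *\<^sub>R F s)"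
    using set_borel_integral_eq_integral(2)[OF si] by (simp add: set_lebesgue_integral_def)
  also have "\<dots> = (LINT s|lborel. indicator {t..} (t + s) *\<^sub>R F (t + s))"
    by (subst lborel_integral_real_affine[of 1 _ t]) auto
  also have "\<dots> = (LINT s|lborel. E t ** (indicator {0..} s *\<^sub>R F s) ** transpose (E t))"
    by (intro Bochner_Integration.integral_cong refl)
       (auto simp: F_add indicator_def bounded_bilinear.zero_left[OF bounded_bilinear_matrix_mult]
         bounded_bilinear.zero_right[OF bounded_bilinear_matrix_mult])
  also have "\<dots> = E t ** (LINT s|lborel. indicator {0..} s *\<^sub>R F s) ** transpose (E t)"
    using set_integrable_F unfolding set_integrable_def by (rule integral_bounded_linear[OF lin])
  also have "(LINT s|lborel. indicator {0..} s *\<^sub>R F s) = Qi"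
    using set_borel_integral_eq_integral(2)[OF set_integrable_F]
    by (simp add: set_lebesgue_integral_def Qinf_def F_def[abs_def] E_def)
  finally show ?thesis
    using set_borel_integral_eq_integral(1)[OF si] by (simp add: has_integral_iff)
qed

lemma F_has_integral_Qt: "(F has_integral Qt Q B t) {0..t}"
proof -
  have "F integrable_on {0..t}"
    by (intro integrable_continuous_real continuous_on_F)
  then show ?thesis by (simp add: has_integral_iff Qt_def F_def[abs_def] E_def)
qed

text \<open>Splitting the time axis at \<open>t\<close> gives the identity from which the growth of
  \<open>R\<close> and both forms of the kernel exponent are derived.\<close>

lemma Qinf_eq:
  assumes t: "t \<ge> 0"
  shows "Qi = Qt Q B t + E t ** Qi ** transpose (E t)"
proof -
  have "negligible ({0..t} \<inter> {t..})"
    by (rule negligible_subset[of "{t}"]) auto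
  from has_integral_Un[OF F_has_integral_Qt F_has_integral_tail[OF t] this]
  have "(F has_integral (Qt Q B t + E t ** Qi ** transpose (E t))) {0..}"
  proof -
    assume "(F has_integral (Qt Q B t + E t ** Qi ** transpose (E t))) ({0..t} \<union> {t..})"
    moreover have "{0..t} \<union> {t..} = {0..}" using t by auto
    ultimately show ?thesis by simp
  qed
  moreover have "(F has_integral Qi) {0..}"
    using F_has_integral_tail[of 0] by (simp add: E_0 transpose_mat)
  ultimately show ?thesis by (rule has_integral_unique[symmetric])
qed

lemma Qt_form: "((\<lambda>s. x \<bullet> (F s *v x)) has_integral (x \<bullet> (Qt Q B t *v x))) {0..t}"
proof -
  have "bounded_linear (\<lambda>M :: real^'n^'n. x \<bullet> (M *v x))"
    by (intro bounded_linear_compose[OF bounded_linear_inner_right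
          bounded_bilinear.bounded_linear_left[OF bounded_bilinear_matrix_vector_mult]])
  from has_integral_linear[OF F_has_integral_Qt this] show ?thesis by (simp add: o_def)
qed

lemma transpose_Qt: "transpose (Qt Q B t) = Qt Q B t"
proof (rule has_integral_unique)
  show "(F has_integral transpose (Qt Q B t)) {0..t}"
    using has_integral_linear[OF F_has_integral_Qt bounded_linear_transpose, of t]
    by (simp add: o_def transpose_F)
qed (rule F_has_integral_Qt)

lemma transpose_Qi: "transpose Qi = Qi"
proof -
  have Qi: "(F has_integral Qi) {0..}"
    using F_has_integral_tail[of 0] by (simp add: E_0 transpose_mat)
  have "(F has_integral transpose Qi) {0..}"
    using has_integral_linear[OF Qi bounded_linear_transpose] by (simp add: o_def transpose_F)
  then show ?thesis using Qi by (rule has_integral_unique)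
qed

text \<open>The covariance behaves like \<open>t\<close> times the identity up to time
  \<open>1\<close> and like the identity afterwards. One pair of constants serves all three ranges,
  so that later estimates are uniform in \<open>t\<close>.\<close>

lemma quadratic_bounds:
  "\<exists>m b. m > 0 \<and> b > 0 \<and> (\<forall>t x. 0 < t \<longrightarrow> t \<le> 1 \<longrightarrow>
        m * t * (norm x)\<^sup>2 \<le> x \<bullet> (Qt Q B t *v x) \<and> x \<bullet> (Qt Q B t *v x) \<le> b * t * (norm x)\<^sup>2) \<and>
     (\<forall>t x. 1 \<le> t \<longrightarrow>
        m * (norm x)\<^sup>2 \<le> x \<bullet> (Qt Q B t *v x) \<and> x \<bullet> (Qt Q B t *v x) \<le> b * (norm x)\<^sup>2) \<and>
     (\<forall>x. m * (norm x)\<^sup>2 \<le> x \<bullet> (Qi *v x) \<and> x \<bullet> (Qi *v x) \<le> b * (norm x)\<^sup>2)"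
proof -
  obtain q where q: "q > 0" "\<And>x. q * (norm x)\<^sup>2 \<le> x \<bullet> (Q *v x)"
    using quadratic_form_lower_bound[of Q] hQ by (auto simp: sym_pos_def_def)
  obtain K where K: "K \<ge> 1" "\<And>s. \<bar>s\<bar> \<le> 1 \<Longrightarrow> norm (E s) \<le> K" using E_near by blast
  obtain L b0 where L: "L > 0" "b0 > 0" "\<And>s. s \<ge> 0 \<Longrightarrow> norm (F s) \<le> L * exp (- b0 * s)"
    using F_bound by auto
  \<comment> \<open>With \<open>y = E(s)^T x\<close> one has \<open>|x| \<le> K |y|\<close>, so the
    lower bound \<open>q\<close> for the form of \<open>Q\<close> loses the factor
    \<open>K^2\<close>.\<close>
  define m where "m = q / K\<^sup>2"
  define b where "b = L + norm Qi"
  have m: "m > 0" using q K by (simp add: m_def)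
  have b: "b > 0" using L by (simp add: b_def add_pos_nonneg)
  have Flow: "m * (norm x)\<^sup>2 \<le> x \<bullet> (F s *v x)" if "0 \<le> s" "s \<le> 1" for s x
  proof -
    let ?y = "transpose (E s) *v x"
    have y: "transpose (E (- s)) *v ?y = x"
      unfolding matrix_vector_mul_assoc matrix_transpose_mul[symmetric] E_minus transpose_mat
      by (rule matrix_vector_mul_lid)
    have "norm x \<le> norm (transpose (E (- s))) * norm ?y"
      using norm_matrix_vector_le[of "transpose (E (- s))" ?y] unfolding y .
    also have "\<dots> \<le> K * norm ?y" using K(2)[of "- s"] that by (intro mult_right_mono) (auto simp: norm_transpose)
    finally have "(norm x)\<^sup>2 \<le> (K * norm ?y)\<^sup>2" by (intro power_mono) auto
    then have "m * (norm x)\<^sup>2 \<le> q * (norm ?y)\<^sup>2"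
      using q(1) K(1) by (simp add: m_def divide_le_eq power_mult_distrib mult_left_mono mult_ac)
    then show ?thesis using q(2)[of ?y] unfolding F_form by linarith
  qed
  have Fup: "x \<bullet> (F s *v x) \<le> L * (norm x)\<^sup>2" if "0 \<le> s" for s x
  proof -
    have "x \<bullet> (F s *v x) \<le> norm x * (norm (F s) * norm x)"
      by (rule order_trans[OF norm_cauchy_schwarz]) (intro mult_left_mono norm_matrix_vector_le, auto)
    also have "\<dots> \<le> norm x * (L * norm x)"
    proof (intro mult_left_mono mult_right_mono)
      have "L * exp (- b0 * s) \<le> L * 1" using L that by (intro mult_left_mono) auto
      then show "norm (F s) \<le> L" using L(3)[OF that] by simp
    qed auto
    finally show ?thesis by (simp add: power2_eq_square mult_ac)
  qed
  have 1: "m * t * (norm x)\<^sup>2 \<le> x \<bullet> (Qt Q B t *v x)" "x \<bullet> (Qt Q B t *v x) \<le> b * t * (norm x)\<^sup>2"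
    if "0 < t" "t \<le> 1" for t x
  proof -
    have c: "((\<lambda>s. k) has_integral (t * k)) {0..t}" for k :: real
      using has_integral_const_real[of k 0 t] that by simp
    have "t * (m * (norm x)\<^sup>2) \<le> x \<bullet> (Qt Q B t *v x)"
      by (rule has_integral_le[OF c Qt_form]) (use Flow that in auto)
    then show "m * t * (norm x)\<^sup>2 \<le> x \<bullet> (Qt Q B t *v x)" by (simp add: mult_ac)
    have "x \<bullet> (Qt Q B t *v x) \<le> t * (L * (norm x)\<^sup>2)"
      by (rule has_integral_le[OF Qt_form c]) (use Fup that in auto)
    also have "\<dots> \<le> t * (b * (norm x)\<^sup>2)" using that by (intro mult_left_mono mult_right_mono) (auto simp: b_def)
    finally show "x \<bullet> (Qt Q B t *v x) \<le> b * t * (norm x)\<^sup>2" by (simp add: mult_ac)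
  qed
  have Qi_up: "x \<bullet> (Qi *v x) \<le> b * (norm x)\<^sup>2" for x
  proof -
    have "x \<bullet> (Qi *v x) \<le> norm x * (norm Qi * norm x)"
      by (rule order_trans[OF norm_cauchy_schwarz]) (intro mult_left_mono norm_matrix_vector_le, auto)
    also have "\<dots> \<le> norm x * (b * norm x)"
      using L by (intro mult_left_mono mult_right_mono) (auto simp: b_def)
    finally show ?thesis by (simp add: power2_eq_square mult_ac)
  qed
  have sandwich: "x \<bullet> ((A ** M ** transpose A) *v x) = (transpose A *v x) \<bullet> (M *v (transpose A *v x))"
    for A M and x :: "real^'n"
    by (simp add: inner_matrix_transpose matrix_vector_mul_assoc[symmetric])
  have Qi_split: "x \<bullet> (Qi *v x) = x \<bullet> (Qt Q B t *v x) + (transpose (E t) *v x) \<bullet> (Qi *v (transpose (E t) *v x))"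
    if "t \<ge> 0" for t x
    by (subst Qinf_eq[OF that]) (simp only: matrix_vector_mult_add_rdistrib inner_add_right sandwich)
  have Qi_nonneg: "0 \<le> x \<bullet> (Qi *v x)" for x
  proof -
    have "bounded_linear (\<lambda>M :: real^'n^'n. x \<bullet> (M *v x))"
      by (intro bounded_linear_compose[OF bounded_linear_inner_right
          bounded_bilinear.bounded_linear_left[OF bounded_bilinear_matrix_vector_mult]])
    from has_integral_linear[OF F_has_integral_tail[of 0] this]
    have "((\<lambda>s. x \<bullet> (F s *v x)) has_integral (x \<bullet> (Qi *v x))) {0..}"
      by (simp add: o_def E_0 transpose_mat)
    then show ?thesis by (rule has_integral_nonneg) (rule F_form_nonneg)
  qed
  have 2: "m * (norm x)\<^sup>2 \<le> x \<bullet> (Qt Q B t *v x)" "x \<bullet> (Qt Q B t *v x) \<le> b * (norm x)\<^sup>2"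
    if "1 \<le> t" for t x
  proof -
    \<comment> \<open>The form of \<open>Qt\<close> increases with \<open>t\<close> and stays below
      that of \<open>Qinf\<close>: time \<open>1\<close> supplies the lower bound and
      \<open>Qinf\<close> the upper one.\<close>
    have "x \<bullet> (Qt Q B 1 *v x) \<le> x \<bullet> (Qt Q B t *v x)"
      by (rule has_integral_subset_le[OF _ Qt_form Qt_form]) (use that F_form_nonneg in auto)
    then show "m * (norm x)\<^sup>2 \<le> x \<bullet> (Qt Q B t *v x)" using 1(1)[of 1 x] by simp
    show "x \<bullet> (Qt Q B t *v x) \<le> b * (norm x)\<^sup>2"
      using Qi_split[of t x] Qi_nonneg[of "transpose (E t) *v x"] Qi_up[of x] that by linarith
  qed
  have 3: "m * (norm x)\<^sup>2 \<le> x \<bullet> (Qi *v x)" for x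
    using Qi_split[of 1 x] Qi_nonneg[of "transpose (E 1) *v x"] 1(1)[of 1 x] by simp
  show ?thesis
    by (intro exI[of _ m] exI[of _ b] conjI allI impI m b 1 2 3 Qi_up)
qed

end

section \<open>Kernel estimates\<close>

context stable_pair
begin

lemma P_facts:
  "P ** Qi = mat 1" "Qi ** P = mat 1" "transpose P = P" "det Qi > 0"
  "\<exists>b>0. \<forall>x. (norm x)\<^sup>2 / b \<le> x \<bullet> (P *v x)"
proof -
  obtain m b where mb: "m > 0" "b > 0" "\<And>x. m * (norm x)\<^sup>2 \<le> x \<bullet> (Qi *v x)" "\<And>x. x \<bullet> (Qi *v x) \<le> b * (norm x)\<^sup>2"
    using quadratic_bounds by blast
  note * = posdef_matrix[OF mb(1) mb(3) mb(2) mb(4) transpose_Qi]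
  show "P ** Qi = mat 1" "Qi ** P = mat 1" "transpose P = P" using *(1,2,3) by auto
  show "det Qi > 0" using *(5) mb(1) by (meson less_le_trans zero_less_power)
  show "\<exists>b>0. \<forall>x. (norm x)\<^sup>2 / b \<le> x \<bullet> (P *v x)" using *(4) mb(2) by blast
qed

lemma S_facts:
  assumes t: "t > 0"
  shows "S t ** Qt Q B t = mat 1" "Qt Q B t ** S t = mat 1" "transpose (S t) = S t" "det (Qt Q B t) > 0"
proof -
  have "\<exists>m b. m > 0 \<and> b > 0 \<and> (\<forall>x. m * (norm x)\<^sup>2 \<le> x \<bullet> (Qt Q B t *v x)) \<and> (\<forall>x. x \<bullet> (Qt Q B t *v x) \<le> b * (norm x)\<^sup>2)"
  proof -
    obtain m b where mb: "m > 0" "b > 0"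
      "\<And>t x. 0 < t \<Longrightarrow> t \<le> 1 \<Longrightarrow> m * t * (norm x)\<^sup>2 \<le> x \<bullet> (Qt Q B t *v x)"
      "\<And>t x. 0 < t \<Longrightarrow> t \<le> 1 \<Longrightarrow> x \<bullet> (Qt Q B t *v x) \<le> b * t * (norm x)\<^sup>2"
      "\<And>t x. 1 \<le> t \<Longrightarrow> m * (norm x)\<^sup>2 \<le> x \<bullet> (Qt Q B t *v x)"
      "\<And>t x. 1 \<le> t \<Longrightarrow> x \<bullet> (Qt Q B t *v x) \<le> b * (norm x)\<^sup>2"
      using quadratic_bounds by blast
    show ?thesis
    proof (cases "t \<le> 1")
      case True
      then show ?thesis using mb t by (intro exI[of _ "m * t"] exI[of _ "b * t"]) auto
    next
      case False
      then show ?thesis using mb by (intro exI[of _ m] exI[of _ b]) auto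
    qed
  qed
  then obtain m b where mb: "m > 0" "b > 0" "\<And>x. m * (norm x)\<^sup>2 \<le> x \<bullet> (Qt Q B t *v x)" "\<And>x. x \<bullet> (Qt Q B t *v x) \<le> b * (norm x)\<^sup>2"
    by blast
  note * = posdef_matrix[OF mb(1) mb(3) mb(2) mb(4) transpose_Qt]
  show "S t ** Qt Q B t = mat 1" "Qt Q B t ** S t = mat 1" "transpose (S t) = S t" using *(1,2,3) by auto
  show "det (Qt Q B t) > 0" using *(5) mb(1) by (meson less_le_trans zero_less_power)
qed

lemma S_bounds:
  "\<exists>m b. m > 0 \<and> b > 0 \<and>
     (\<forall>t x. 0 < t \<longrightarrow> t \<le> 1 \<longrightarrow> (norm x)\<^sup>2 / (b * t) \<le> x \<bullet> (S t *v x) \<and> (m * t) ^ CARD('n) \<le> det (Qt Q B t)) \<and>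
     (\<forall>t x. 1 \<le> t \<longrightarrow> (norm x)\<^sup>2 / b \<le> x \<bullet> (S t *v x) \<and> m ^ CARD('n) \<le> det (Qt Q B t))"
proof -
  obtain m b where mb: "m > 0" "b > 0"
      "\<And>t x. 0 < t \<Longrightarrow> t \<le> 1 \<Longrightarrow> m * t * (norm x)\<^sup>2 \<le> x \<bullet> (Qt Q B t *v x)"
      "\<And>t x. 0 < t \<Longrightarrow> t \<le> 1 \<Longrightarrow> x \<bullet> (Qt Q B t *v x) \<le> b * t * (norm x)\<^sup>2"
      "\<And>t x. 1 \<le> t \<Longrightarrow> m * (norm x)\<^sup>2 \<le> x \<bullet> (Qt Q B t *v x)"
      "\<And>t x. 1 \<le> t \<Longrightarrow> x \<bullet> (Qt Q B t *v x) \<le> b * (norm x)\<^sup>2"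
    using quadratic_bounds by blast
  have 1: "(norm x)\<^sup>2 / (b * t) \<le> x \<bullet> (S t *v x) \<and> (m * t) ^ CARD('n) \<le> det (Qt Q B t)"
    if t: "0 < t" "t \<le> 1" for t x
  proof -
    have "0 < m * t" "0 < b * t" using mb t by auto
    from posdef_matrix(4,5)[OF this(1) mb(3)[OF t] this(2) mb(4)[OF t] transpose_Qt]
    show ?thesis by blast
  qed
  have 2: "(norm x)\<^sup>2 / b \<le> x \<bullet> (S t *v x) \<and> m ^ CARD('n) \<le> det (Qt Q B t)" if t: "1 \<le> t" for t x
    using posdef_matrix(4,5)[OF mb(1) mb(5)[OF t] mb(2) mb(6)[OF t] transpose_Qt] by blast
  show ?thesis
    by (rule exI[of _ m], rule exI[of _ b]) (use mb(1,2) 1 2 in auto)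
qed

section \<open>The flow \<open>D\<close> and the growth of \<open>R\<close> along it\<close>

lemma D_eq: "D t = Qi ** transpose (E (- t)) ** P"
proof -
  have "transpose ((- t) *\<^sub>R B) = (- t) *\<^sub>R transpose B"
    by (simp add: vec_eq_iff transpose_def)
  then show ?thesis by (simp only: Dt_def E_def transpose_mexp)
qed

lemma D_0: "D 0 = mat 1"
  unfolding D_eq by (simp add: E_0 transpose_mat P_facts)

lemma D_add: "D (s + t) = D s ** D t"
proof -
  have "D s ** D t = Qi ** transpose (E (- s)) ** (P ** Qi) ** transpose (E (- t)) ** P"
    unfolding D_eq by (simp only: matrix_mul_assoc)
  also have "\<dots> = Qi ** (transpose (E (- s)) ** transpose (E (- t))) ** P"
    by (simp add: P_facts matrix_mul_assoc)
  also have "transpose (E (- s)) ** transpose (E (- t)) = transpose (E (- (s + t)))"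
    unfolding matrix_transpose_mul[symmetric] E_add[symmetric] by (simp add: add.commute)
  finally show ?thesis by (simp only: D_eq)
qed

lemma det_D: "det (D s) = exp (- trace B * s)"
proof -
  have "det Qi * det P = 1" using arg_cong[OF P_facts(2), of det] by (simp add: det_mul)
  then show ?thesis
    unfolding D_eq by (simp add: det_mul det_transpose det_E mult.commute)
qed

lemma continuous_on_D: "continuous_on X D"
proof -
  have "continuous_on X (\<lambda>t. E (- t))"
    by (rule continuous_on_compose2[OF continuous_on_E]) (auto intro: continuous_intros)
  then show ?thesis
    unfolding D_eq[abs_def]
    by (rule bounded_linear.continuous_on[OF bounded_linear_compose[OF matrix_mult_right_linear
          bounded_linear_compose[OF matrix_mult_left_linear bounded_linear_transpose]]])
qed

lemma D_near: "\<exists>C\<ge>1. \<forall>s x. \<bar>s\<bar> \<le> 1 \<longrightarrow> norm (D s *v x) \<le> C * norm x \<and> norm (D s *v x - x) \<le> C * \<bar>s\<bar> * norm x"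
proof -
  obtain K where K: "K \<ge> 1" "\<And>s. \<bar>s\<bar> \<le> 1 \<Longrightarrow> norm (E s) \<le> K \<and> norm (E s - mat 1) \<le> K * \<bar>s\<bar>"
    using E_near by blast
  define C where "C = norm Qi * K * norm P + 1"
  have 1: "norm (D s) \<le> C" if "\<bar>s\<bar> \<le> 1" for s
  proof -
    have "norm (D s) \<le> norm Qi * norm (E (- s)) * norm P"
      unfolding D_eq by (rule order_trans[OF norm_matrix_mult_le])
        (intro mult_right_mono order_trans[OF norm_matrix_mult_le], auto simp: norm_transpose)
    also have "\<dots> \<le> norm Qi * K * norm P"
      using K(2)[of "- s"] that by (intro mult_right_mono mult_left_mono) auto
    finally show ?thesis by (simp add: C_def)
  qed
  have 2: "norm (D s - mat 1) \<le> C * \<bar>s\<bar>" if "\<bar>s\<bar> \<le> 1" for s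
  proof -
    have "D s - mat 1 = Qi ** transpose (E (- s) - mat 1) ** P"
      unfolding D_eq linear_diff[OF bounded_linear.linear[OF bounded_linear_transpose]]
        bounded_bilinear.diff_right[OF bounded_bilinear_matrix_mult]
        bounded_bilinear.diff_left[OF bounded_bilinear_matrix_mult]
      by (simp add: transpose_mat P_facts)
    also have "norm \<dots> \<le> norm Qi * norm (E (- s) - mat 1) * norm P"
      by (rule order_trans[OF norm_matrix_mult_le])
        (intro mult_right_mono order_trans[OF norm_matrix_mult_le], auto simp: norm_transpose)
    also have "\<dots> \<le> norm Qi * (K * \<bar>s\<bar>) * norm P"
      using K(2)[of "- s"] that by (intro mult_right_mono mult_left_mono) auto
    also have "\<dots> \<le> C * \<bar>s\<bar>" by (simp add: C_def algebra_simps)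
    finally show ?thesis .
  qed
  show ?thesis
  proof (intro exI[of _ C] conjI allI impI)
    show "C \<ge> 1" using K(1) by (simp add: C_def)
    fix s :: real and x :: "real^'n" assume s: "\<bar>s\<bar> \<le> 1"
    show "norm (D s *v x) \<le> C * norm x"
      by (rule order_trans[OF norm_matrix_vector_le]) (intro mult_right_mono 1 s, auto)
    have "D s *v x - x = (D s - mat 1) *v x" by (simp add: matrix_vector_mult_diff_rdistrib)
    also have "norm \<dots> \<le> C * \<bar>s\<bar> * norm x"
      by (rule order_trans[OF norm_matrix_vector_le]) (intro mult_right_mono 2 s, auto)
    finally show "norm (D s *v x - x) \<le> C * \<bar>s\<bar> * norm x" .
  qed
qed

text \<open>\<open>D (- s)\<close> is conjugate to the transpose of \<open>E s\<close>, so
  \<open>D\<close> contracts backwards in time and expands forwards.\<close>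

lemma D_decay: "\<exists>C c. C \<ge> 1 \<and> c > 0 \<and> (\<forall>s\<ge>0. \<forall>x. norm (D (- s) *v x) \<le> C * exp (- c * s) * norm x)"
proof -
  obtain K c where K: "c > 0" "K \<ge> 1" "\<And>s. s \<ge> 0 \<Longrightarrow> norm (E s) \<le> K * exp (- c * s)"
    using E_decay by auto
  define C where "C = norm Qi * K * norm P + 1"
  have "norm (D (- s)) \<le> C * exp (- c * s)" if "s \<ge> 0" for s
  proof -
    have "norm (D (- s)) \<le> norm Qi * norm (E s) * norm P"
      unfolding D_eq minus_minus by (rule order_trans[OF norm_matrix_mult_le])
        (intro mult_right_mono order_trans[OF norm_matrix_mult_le], auto simp: norm_transpose)
    also have "\<dots> \<le> norm Qi * (K * exp (- c * s)) * norm P"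
      by (intro mult_right_mono mult_left_mono K(3)[OF that]) auto
    also have "\<dots> \<le> C * exp (- c * s)" by (simp add: C_def algebra_simps)
    finally show ?thesis .
  qed
  then have "norm (D (- s) *v x) \<le> C * exp (- c * s) * norm x" if "s \<ge> 0" for s x
    using that by (intro order_trans[OF norm_matrix_vector_le] mult_right_mono) auto
  moreover have "C \<ge> 1" using K(2) by (simp add: C_def)
  ultimately show ?thesis using K(1) by blast
qed

lemma R_eq: "2 * R x = x \<bullet> (P *v x)"
  by (simp add: Rfun_def inner_commute)

lemma P_sym: "a \<bullet> (P *v b) = b \<bullet> (P *v a)"
  unfolding inner_matrix_transpose[of a] P_facts(3) by (rule inner_commute)

text \<open>A difference of quadratic forms factorises as
  \<open>(u - x) \<bullet> P (u + x)\<close>. On the scale \<open>1 / (1 + |x|)\<close> around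
  \<open>x\<close> the function \<open>R\<close> therefore varies by a bounded amount.\<close>

lemma R_near: "\<exists>C\<ge>1. \<forall>x u. \<bar>R u - R x\<bar> \<le> C * norm (u - x) * (norm u + norm x)"
proof -
  have "\<bar>R u - R x\<bar> \<le> (norm P + 1) * norm (u - x) * (norm u + norm x)" for u x
  proof -
    have "2 * (R u - R x) = (u - x) \<bullet> (P *v (u + x))"
      using P_sym[of u x] R_eq[of u] R_eq[of x]
      by (simp add: algebra_simps inner_diff_left inner_add_right matrix_vector_right_distrib)
    then have "2 * \<bar>R u - R x\<bar> = \<bar>(u - x) \<bullet> (P *v (u + x))\<bar>" by (metis abs_mult abs_numeral)
    also have "\<dots> \<le> norm (u - x) * (norm P * norm (u + x))"
      by (rule order_trans[OF Cauchy_Schwarz_ineq2]) (intro mult_left_mono norm_matrix_vector_le, auto)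
    also have "\<dots> \<le> norm (u - x) * ((norm P + 1) * (norm u + norm x))"
      by (intro mult_left_mono mult_mono norm_triangle_ineq) auto
    finally have "2 * \<bar>R u - R x\<bar> \<le> (norm P + 1) * norm (u - x) * (norm u + norm x)"
      by (simp only: mult_ac)
    moreover have "\<bar>R u - R x\<bar> \<le> 2 * \<bar>R u - R x\<bar>" by simp
    ultimately show ?thesis by (rule order_trans[rotated])
  qed
  then show ?thesis by (intro exI[of _ "norm P + 1"]) auto
qed

lemma continuous_on_R: "continuous_on X R"
proof -
  have "R = (\<lambda>x. 1/2 * (x \<bullet> (P *v x)))"
  proof
    fix x show "R x = 1/2 * (x \<bullet> (P *v x))" using R_eq[of x] by simp
  qed
  moreover have "continuous_on X (\<lambda>x. 1/2 * (x \<bullet> (P *v x)))" by (intro continuous_intros)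
  ultimately show ?thesis by metis
qed

text \<open>Put \<open>y = P (D s x)\<close>, that is \<open>y = E(-s)^T P x\<close>. The splitting
  of \<open>Qinf\<close> at time \<open>s\<close>, tested on \<open>y\<close>, reads
  \<open>2 R (D s x) = y \<bullet> Qs y + 2 R x\<close>; here \<open>Qs\<close> is at least
  \<open>m s\<close>, and \<open>|y|\<close> is at least a multiple of \<open>|x|\<close>.\<close>

lemma R_flow: "\<exists>c>0. \<forall>s x. 0 \<le> s \<longrightarrow> s \<le> 1 \<longrightarrow> R x + c * s * (norm x)\<^sup>2 \<le> R (D s *v x)"
proof -
  obtain m b where mb: "m > 0" 
      "\<And>t x. 0 < t \<Longrightarrow> t \<le> 1 \<Longrightarrow> m * t * (norm x)\<^sup>2 \<le> x \<bullet> (Qt Q B t *v x)"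
    using quadratic_bounds by blast
  obtain K where K: "K \<ge> 1" "\<And>s. \<bar>s\<bar> \<le> 1 \<Longrightarrow> norm (E s) \<le> K" using E_near by blast
  define L where "L = (norm Qi + 1) * K"
  have L: "L > 0" using K by (simp add: L_def add_nonneg_pos)
  have "R x + m / (2 * L\<^sup>2) * s * (norm x)\<^sup>2 \<le> R (D s *v x)" if s: "0 \<le> s" "s \<le> 1" for s x
  proof (cases "s = 0")
    case True
    then show ?thesis by (simp add: D_0)
  next
    case False
    define q y where "q = P *v x" and "y = transpose (E (- s)) *v q"
    have Dx: "D s *v x = Qi *v y"
      unfolding D_eq q_def y_def by (simp only: matrix_vector_mul_assoc matrix_mul_assoc)
    have x: "x = Qi *v q" unfolding q_def by (simp add: matrix_vector_mul_assoc P_facts)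
    have q: "transpose (E s) *v y = q"
      unfolding y_def matrix_vector_mul_assoc matrix_transpose_mul[symmetric] E_minus transpose_mat
      by (rule matrix_vector_mul_lid)
    have PQ: "P *v (Qi *v z) = z" for z by (simp add: matrix_vector_mul_assoc P_facts)
    have "2 * R (D s *v x) = y \<bullet> (Qi *v y)" by (simp add: R_eq Dx PQ inner_commute)
    also have "\<dots> = y \<bullet> (Qt Q B s *v y) + y \<bullet> ((E s ** Qi ** transpose (E s)) *v y)"
      by (subst Qinf_eq[OF s(1)]) (simp only: matrix_vector_mult_add_rdistrib inner_add_right)
    also have "y \<bullet> ((E s ** Qi ** transpose (E s)) *v y) = q \<bullet> (Qi *v q)"
      unfolding matrix_vector_mul_assoc[symmetric] inner_matrix_transpose[of y "E s"] q ..
    also have "q \<bullet> (Qi *v q) = 2 * R x"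
    proof -
      have "q \<bullet> (Qi *v q) = q \<bullet> x" by (rule arg_cong[OF x[symmetric]])
      then show ?thesis by (simp add: R_eq q_def inner_commute)
    qed
    finally have 1: "2 * R (D s *v x) = y \<bullet> (Qt Q B s *v y) + 2 * R x" .
    have "norm x \<le> norm Qi * norm q" by (subst x) (rule norm_matrix_vector_le)
    also have "norm q \<le> norm (E s) * norm y"
      using norm_matrix_vector_le[of "transpose (E s)" y] unfolding q norm_transpose .
    also have "norm (E s) * norm y \<le> K * norm y" using K(2)[of s] s by (intro mult_right_mono) auto
    also have "norm Qi * (K * norm y) \<le> L * norm y"
      using K(1) by (simp add: L_def mult.assoc[symmetric] mult_right_mono)
    finally have "norm x \<le> L * norm y" by (simp add: mult_left_mono)
    then have "(norm x)\<^sup>2 \<le> (L * norm y)\<^sup>2" by (intro power_mono) auto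
    then have "m / L\<^sup>2 * s * (norm x)\<^sup>2 \<le> m / L\<^sup>2 * s * (L\<^sup>2 * (norm y)\<^sup>2)"
      using mb(1) L s by (intro mult_left_mono) (auto simp: power_mult_distrib)
    also have "\<dots> = m * s * (norm y)\<^sup>2" using L by simp
    also have "\<dots> \<le> y \<bullet> (Qt Q B s *v y)" using mb(2)[of s y] s False by simp
    finally have "m / L\<^sup>2 * s * (norm x)\<^sup>2 \<le> y \<bullet> (Qt Q B s *v y)" .
    moreover have "m / (2 * L\<^sup>2) * s * (norm x)\<^sup>2 = (m / L\<^sup>2 * s * (norm x)\<^sup>2) / 2" by simp
    moreover have "r + a' \<le> r'" if "a \<le> b" "a' = a / 2" "2 * r' = b + 2 * r" for a a' b r r' :: real
      using that by simp
    ultimately show ?thesis using 1 by blast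
  qed
  moreover have "m / (2 * L\<^sup>2) > 0" using mb L by simp
  ultimately show ?thesis by blast
qed

section \<open>Algebra of the exponent and the four kernel bounds\<close>

lemma S_sym: "t > 0 \<Longrightarrow> a \<bullet> (S t *v b) = b \<bullet> (S t *v a)"
  unfolding inner_matrix_transpose[of a] S_facts(3) by (rule inner_commute)

text \<open>\<open>D t\<close> is inverse to the adjoint of \<open>E t\<close> for the inner product
  given by \<open>P\<close>.\<close>

lemma E_P_D: "transpose (E t) ** P ** D t = P"
proof -
  have "transpose (E t) ** P ** D t = transpose (E t) ** (P ** Qi) ** transpose (E (- t)) ** P"
    unfolding D_eq by (simp only: matrix_mul_assoc)
  also have "\<dots> = (transpose (E t) ** transpose (E (- t))) ** P"
    by (simp add: P_facts)
  also have "\<dots> = P"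
    unfolding matrix_transpose_mul[symmetric] E_minus by (simp add: transpose_mat)
  finally show ?thesis .
qed

lemma E_P_D_vec: "transpose (E t) *v (P *v (D t *v a)) = P *v a"
  unfolding matrix_vector_mul_assoc matrix_mul_assoc E_P_D ..

text \<open>Multiplying \<open>Qinf = Qt + E Qinf E^T\<close> by \<open>S t\<close> on the left and
  \<open>P\<close> on the right gives \<open>S t\<close> as \<open>P\<close> plus a correction, and
  composition with \<open>D t\<close> collapses the correction to \<open>S t E t\<close>.\<close>

lemma S_D: "t > 0 \<Longrightarrow> S t *v (D t *v v) = P *v (D t *v v) + S t *v (E t *v v)"
proof -
  assume t: "t > 0"
  have "S t ** Qi ** P = S t ** (Qt Q B t + E t ** Qi ** transpose (E t)) ** P"
    using Qinf_eq[of t] t by simp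
  also have "\<dots> = P + S t ** E t ** Qi ** transpose (E t) ** P"
    unfolding matrix_add_ldistrib bounded_bilinear.add_left[OF bounded_bilinear_matrix_mult]
    by (simp add: S_facts[OF t] matrix_mul_assoc)
  finally have "S t = P + S t ** E t ** Qi ** transpose (E t) ** P"
    by (simp add: matrix_mul_assoc[symmetric] P_facts)
  then have "S t ** D t = (P + S t ** E t ** Qi ** transpose (E t) ** P) ** D t" by simp
  also have "\<dots> = P ** D t + S t ** E t ** Qi ** (transpose (E t) ** P ** D t)"
    unfolding bounded_bilinear.add_left[OF bounded_bilinear_matrix_mult] by (simp add: matrix_mul_assoc)
  also have "transpose (E t) ** P ** D t = P" by (rule E_P_D)
  also have "S t ** E t ** Qi ** P = S t ** E t" by (simp add: matrix_mul_assoc[symmetric] P_facts)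
  finally have "S t ** D t = P ** D t + S t ** E t" .
  then have "(S t ** D t) *v v = (P ** D t + S t ** E t) *v v" by simp
  then show ?thesis
    unfolding matrix_vector_mult_add_rdistrib matrix_vector_mul_assoc[symmetric] .
qed

text \<open>The form \<open>S t - P\<close> is degenerate in the limit of large \<open>t\<close>.
  Substituting \<open>x - D t u = D t w\<close> turns it into a sum containing
  \<open>w \<bullet> P w\<close>, whose lower bound is uniform in \<open>t\<close>. The second
  identity completes the square differently: the kernel times \<open>e^(R u)\<close> is a Gaussian
  in \<open>x - E t u\<close>.\<close>

lemma KUO_exponent:
  assumes t: "t > 0"
  defines "w \<equiv> \<lambda>x u. D (- t) *v x - u"
  shows "((S t - P) *v (x - D t *v u)) \<bullet> (x - D t *v u) = w x u \<bullet> (P *v w x u) + (E t *v w x u) \<bullet> (S t *v (E t *v w x u))"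
    and "2 * R x + ((S t - P) *v (x - D t *v u)) \<bullet> (x - D t *v u) = 2 * R u + (x - E t *v u) \<bullet> (S t *v (x - E t *v u))"
    and "x - D t *v u = D t *v w x u"
proof -
  define v where "v = D (- t) *v x"
  define z where "z = w x u"
  have zv: "z = v - u" by (simp add: z_def w_def v_def)
  have x: "x = D t *v v"
    unfolding v_def matrix_vector_mul_assoc D_add[symmetric] by (simp add: D_0)
  show xz: "x - D t *v u = D t *v w x u"
    unfolding z_def[symmetric] zv matrix_vector_mult_diff_distrib x[symmetric] ..
  note SD = S_D[OF t]
  have PE: "(E t *v b) \<bullet> (P *v (D t *v a)) = b \<bullet> (P *v a)" for a b
  proof -
    have "(E t *v b) \<bullet> (P *v (D t *v a)) = (transpose (E t) *v (P *v (D t *v a))) \<bullet> b"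
      unfolding inner_commute[of "E t *v b"] by (rule inner_matrix_transpose)
    then show ?thesis unfolding E_P_D_vec by (simp add: inner_commute)
  qed
  have 1: "((S t - P) *v (x - D t *v u)) \<bullet> (x - D t *v u) = z \<bullet> (P *v z) + (E t *v z) \<bullet> (S t *v (E t *v z))"
  proof -
    have "((S t - P) *v (x - D t *v u)) \<bullet> (x - D t *v u) = (S t *v (E t *v z)) \<bullet> (D t *v z)"
      unfolding xz z_def[symmetric] matrix_vector_mult_diff_rdistrib SD by simp
    also have "\<dots> = (E t *v z) \<bullet> (S t *v (D t *v z))"
      unfolding inner_commute[of "S t *v (E t *v z)"] by (rule S_sym[OF t])
    also have "\<dots> = z \<bullet> (P *v z) + (E t *v z) \<bullet> (S t *v (E t *v z))"
      unfolding SD inner_add_right PE ..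
    finally show ?thesis .
  qed
  then show "((S t - P) *v (x - D t *v u)) \<bullet> (x - D t *v u) = w x u \<bullet> (P *v w x u) + (E t *v w x u) \<bullet> (S t *v (E t *v w x u))"
    unfolding z_def .
  have A: "S t *v (x - E t *v u) = P *v x + S t *v (E t *v z)"
    unfolding zv matrix_vector_mult_diff_distrib using SD[of v] x by (simp add: algebra_simps)
  have A': "x - E t *v u = x - E t *v v + E t *v z"
    unfolding zv matrix_vector_mult_diff_distrib by simp
  have "(x - E t *v u) \<bullet> (S t *v (x - E t *v u)) =
      (x - E t *v v + E t *v z) \<bullet> (P *v x + S t *v (E t *v z))"
    unfolding A by (simp only: A')
  also have "\<dots> = x \<bullet> (P *v x) - (E t *v v) \<bullet> (P *v x) + (E t *v z) \<bullet> (P *v x)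
      + x \<bullet> (S t *v (E t *v z)) - (E t *v v) \<bullet> (S t *v (E t *v z)) + (E t *v z) \<bullet> (S t *v (E t *v z))"
    by (simp add: inner_add_left inner_add_right inner_diff_left)
  also have "(E t *v v) \<bullet> (P *v x) = v \<bullet> (P *v v)" by (subst x) (rule PE)
  also have "(E t *v z) \<bullet> (P *v x) = z \<bullet> (P *v v)" by (subst x) (rule PE)
  also have "x \<bullet> (S t *v (E t *v z)) = z \<bullet> (P *v v) + (E t *v v) \<bullet> (S t *v (E t *v z))"
  proof -
    have "x \<bullet> (S t *v (E t *v z)) = (E t *v z) \<bullet> (S t *v x)" by (rule S_sym[OF t])
    also have "S t *v x = P *v (D t *v v) + S t *v (E t *v v)" by (subst x) (rule SD)
    also have "(E t *v z) \<bullet> (P *v (D t *v v) + S t *v (E t *v v)) = z \<bullet> (P *v v) + (E t *v z) \<bullet> (S t *v (E t *v v))"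
      unfolding inner_add_right PE ..
    also have "(E t *v z) \<bullet> (S t *v (E t *v v)) = (E t *v v) \<bullet> (S t *v (E t *v z))" by (rule S_sym[OF t])
    finally show ?thesis .
  qed
  finally have 2: "(x - E t *v u) \<bullet> (S t *v (x - E t *v u)) =
      2 * R x - v \<bullet> (P *v v) + 2 * (z \<bullet> (P *v v)) + (E t *v z) \<bullet> (S t *v (E t *v z))"
    by (simp add: R_eq)
  have "u = v - z" by (simp add: zv)
  then have "2 * R u = (v - z) \<bullet> (P *v (v - z))" by (simp add: R_eq)
  also have "\<dots> = v \<bullet> (P *v v) - 2 * (z \<bullet> (P *v v)) + z \<bullet> (P *v z)"
    using P_sym[of v z] by (simp add: matrix_vector_mult_diff_distrib inner_diff_left inner_diff_right)
  finally show "2 * R x + ((S t - P) *v (x - D t *v u)) \<bullet> (x - D t *v u) = 2 * R u + (x - E t *v u) \<bullet> (S t *v (x - E t *v u))"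
    using 1 2 by simp
qed

lemma KUO_nonneg: "t > 0 \<Longrightarrow> 0 \<le> KUO Q B t x u"
  using P_facts(4) S_facts(4)[of t] by (simp add: KUO_def)

lemma KUO_eq:
  assumes t: "t > 0"
  defines "a \<equiv> (2*pi) powr (- real CARD('n)) / sqrt (det Qi)"
  defines "w \<equiv> \<lambda>x u. D (- t) *v x - u"
  shows "KUO Q B t x u = a / sqrt (det (Qt Q B t)) * exp (t * trace B) * exp (- R x) *
      exp (- (w x u \<bullet> (P *v w x u) + (E t *v w x u) \<bullet> (S t *v (E t *v w x u))) / 2)"
    and "KUO Q B t x u * exp (R u) = a / sqrt (det (Qt Q B t)) * exp (t * trace B) *
      exp (- ((x - E t *v u) \<bullet> (S t *v (x - E t *v u))) / 2)"
proof -
  let ?q = "((S t - P) *v (x - D t *v u)) \<bullet> (x - D t *v u)"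
  have factor: "c * inverse (sqrt (d1 * d2)) * e1 * e2 * exp (- (1/2) * q) =
      c / sqrt d1 / sqrt d2 * e1 * e2 * exp (- q / 2)" for c d1 d2 e1 e2 q :: real
  proof -
    have "- (1/2) * q = - q / 2" by simp
    then show ?thesis by (simp only: real_sqrt_mult divide_inverse inverse_mult_distrib mult.assoc)
  qed
  have 0: "KUO Q B t x u = a / sqrt (det (Qt Q B t)) * exp (t * trace B) * exp (- R x) * exp (- ?q / 2)"
    unfolding KUO_def a_def by (rule factor)
  then show "KUO Q B t x u = a / sqrt (det (Qt Q B t)) * exp (t * trace B) * exp (- R x) *
      exp (- (w x u \<bullet> (P *v w x u) + (E t *v w x u) \<bullet> (S t *v (E t *v w x u))) / 2)"
    unfolding w_def KUO_exponent(1)[OF t] .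
  have "KUO Q B t x u * exp (R u) = a / sqrt (det (Qt Q B t)) * exp (t * trace B) * (exp (- R x) * exp (- ?q / 2) * exp (R u))"
    unfolding 0 by simp
  also have "exp (- R x) * exp (- ?q / 2) * exp (R u) = exp (- ((x - E t *v u) \<bullet> (S t *v (x - E t *v u))) / 2)"
  proof -
    have "- r + - q / 2 + r' = - p / 2" if "2 * r + q = 2 * r' + p" for r r' p q :: real
      using that by (simp add: field_simps)
    from this[OF KUO_exponent(2)[OF t, of x u]] show ?thesis unfolding exp_add[symmetric] by (rule arg_cong)
  qed
  finally show "KUO Q B t x u * exp (R u) = a / sqrt (det (Qt Q B t)) * exp (t * trace B) *
      exp (- ((x - E t *v u) \<bullet> (S t *v (x - E t *v u))) / 2)" .
qed

lemma E_norm_lower: "\<exists>K\<ge>1. \<forall>t x. \<bar>t\<bar> \<le> 1 \<longrightarrow> norm x \<le> K * norm (E t *v x)"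
proof -
  obtain K where K: "K \<ge> 1" "\<And>s. \<bar>s\<bar> \<le> 1 \<Longrightarrow> norm (E s) \<le> K" using E_near by blast
  have "norm x \<le> K * norm (E t *v x)" if "\<bar>t\<bar> \<le> 1" for t x
  proof -
    have "x = E (- t) *v (E t *v x)" unfolding matrix_vector_mul_assoc E_minus by simp
    then have "norm x \<le> norm (E (- t)) * norm (E t *v x)" by (metis norm_matrix_vector_le)
    also have "\<dots> \<le> K * norm (E t *v x)" using K(2)[of "- t"] that by (intro mult_right_mono) auto
    finally show ?thesis .
  qed
  then show ?thesis using K(1) by blast
qed

lemma gaussian_le_rational:
  fixes y s :: real
  assumes "c > 0" "y \<ge> 0" "s > 0" "2 * c * y\<^sup>2 / s\<^sup>2 \<le> q"
  shows "exp (- q / 2) \<le> exp ((real N)\<^sup>2 / (4 * c)) * s ^ N / (s + y) ^ N"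
proof -
  have "exp (- q / 2) \<le> exp (- (c * (y / s)\<^sup>2))"
  proof -
    have "q / 2 \<ge> c * (y / s)\<^sup>2"
      using divide_right_mono[OF assms(4), of 2] by (simp add: power_divide)
    then show ?thesis by simp
  qed
  also have "\<dots> \<le> exp ((real N)\<^sup>2 / (4 * c)) / (1 + y / s) ^ N"
    using assms by (intro exp_neg_square_le) auto
  also have "(1 + y / s) ^ N = (s + y) ^ N / s ^ N"
    using assms by (simp add: power_divide[symmetric] add_divide_distrib)
  finally show ?thesis by simp
qed

text \<open>The factor \<open>(det Qt)^(-1/2)\<close>, of order \<open>t^(-n/2)\<close> for small
  \<open>t\<close>, is absorbed by the numerator \<open>sqrt t ^ N\<close> of the rational bound.
  Taking \<open>N = n\<close> cancels it exactly; taking \<open>N = n + 1\<close> leaves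
  \<open>sqrt t\<close> over a power that is integrable in space.\<close>

lemma KUO_bounds:
  "\<exists>C\<ge>0. \<forall>t x u.
    (0 < t \<longrightarrow> t \<le> 1 \<longrightarrow> KUO Q B t x u \<le> C * exp (- R x) / (sqrt t + norm (x - D t *v u)) ^ CARD('n)) \<and>
    (0 < t \<longrightarrow> t \<le> 1 \<longrightarrow> KUO Q B t x u * exp (R u) \<le> C * sqrt t / (sqrt t + norm (x - E t *v u)) ^ (CARD('n) + 1)) \<and>
    (1 \<le> t \<longrightarrow> KUO Q B t x u \<le> C * exp (- R x) * exp (t * trace B) / (1 + norm (D (- t) *v x - u)) ^ (CARD('n) + 1)) \<and>
    (1 \<le> t \<longrightarrow> KUO Q B t x u * exp (R u) \<le> C * exp (t * trace B) / (1 + norm (x - E t *v u)) ^ (CARD('n) + 1))"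
proof -
  let ?n = "CARD('n)"
  obtain m b where mb: "m > 0" "b > 0"
      "\<And>t x. 0 < t \<Longrightarrow> t \<le> 1 \<Longrightarrow> (norm x)\<^sup>2 / (b * t) \<le> x \<bullet> (S t *v x)"
      "\<And>t. 0 < t \<Longrightarrow> t \<le> 1 \<Longrightarrow> (m * t) ^ ?n \<le> det (Qt Q B t)"
      "\<And>t x. 1 \<le> t \<Longrightarrow> (norm x)\<^sup>2 / b \<le> x \<bullet> (S t *v x)"
      "\<And>t. 1 \<le> t \<Longrightarrow> m ^ ?n \<le> det (Qt Q B t)"
    using S_bounds by blast
  obtain bP where bP: "bP > 0" "\<And>x. (norm x)\<^sup>2 / bP \<le> x \<bullet> (P *v x)" using P_facts(5) by blast
  obtain K where K: "K \<ge> 1" "\<And>t x. \<bar>t\<bar> \<le> 1 \<Longrightarrow> norm x \<le> K * norm (E t *v x)"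
    using E_norm_lower by blast
  obtain L where L: "L \<ge> 1" "\<And>s x. \<bar>s\<bar> \<le> 1 \<Longrightarrow> norm (D s *v x) \<le> L * norm x" using D_near by blast
  define a where "a = (2*pi) powr (- real ?n) / sqrt (det Qi)"
  have a: "a \<ge> 0" using P_facts(4) by (simp add: a_def)
  define am where "am = a / sqrt (m ^ ?n)"
  have am: "am \<ge> 0" using a mb by (simp add: am_def)
  define e where "e = exp \<bar>trace B\<bar>"
  have e: "exp (t * trace B) \<le> e" if "0 < t" "t \<le> 1" for t
  proof -
    have "t * trace B \<le> t * \<bar>trace B\<bar>" using that by (intro mult_left_mono) auto
    also have "\<dots> \<le> 1 * \<bar>trace B\<bar>" using that by (intro mult_right_mono) auto
    finally show ?thesis by (simp add: e_def)
  qed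
  \<comment> \<open>Gaussian rates: \<open>c1\<close> combines the lower bound
    \<open>1 / (b t)\<close> of \<open>S t\<close> with \<open>|D t w| \<le> L K |E t w|\<close>,
    \<open>c2\<close> uses \<open>S t\<close> alone, and \<open>c3\<close> uses only the
    \<open>P\<close> part of the exponent.\<close>
  define c1 c2 c3 where "c1 = 1 / (2 * b * (K * L)\<^sup>2)" and "c2 = 1 / (2 * b)" and "c3 = 1 / (2 * bP)"
  have c: "c1 > 0" "c2 > 0" "c3 > 0" using mb bP K L by (auto simp: c1_def c2_def c3_def)
  define A where "A = (\<lambda>c. exp ((real ?n)\<^sup>2 / (4 * c)) + exp ((real (?n + 1))\<^sup>2 / (4 * c)))"
  have A: "exp ((real ?n)\<^sup>2 / (4 * c)) \<le> A c" "exp ((real (?n + 1))\<^sup>2 / (4 * c)) \<le> A c" for c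
    by (auto simp: A_def)
  have A0: "A c \<ge> 0" for c by (auto simp: A_def)
  define C where "C = am * e * (A c1 + A c2) + am * (A c2 + A c3)"
  have e0: "e > 0" by (simp add: e_def)
  have s1: "a / sqrt (det (Qt Q B t)) \<le> am / sqrt t ^ ?n" if "0 < t" "t \<le> 1" for t
  proof -
    have "0 < (m * t) ^ ?n" using mb that by simp
    then have "a / sqrt (det (Qt Q B t)) \<le> a / sqrt ((m * t) ^ ?n)"
      using mb(4)[OF that] a by (intro divide_left_mono) auto
    also have "\<dots> = am / sqrt t ^ ?n"
      by (simp add: am_def power_mult_distrib real_sqrt_mult real_sqrt_power)
    finally show ?thesis .
  qed
  have s2: "a / sqrt (det (Qt Q B t)) \<le> am" if "1 \<le> t" for t
  proof -
    have "0 < m ^ ?n" using mb by simp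
    then show ?thesis unfolding am_def using mb(6)[OF that] a by (intro divide_left_mono) auto
  qed
  have Snn: "0 \<le> y \<bullet> (S t *v y)" if "t > 0" for t y
  proof (cases "t \<le> 1")
    case True
    then show ?thesis using mb(2) mb(3)[OF that True, of y] that by (meson divide_nonneg_nonneg less_imp_le mult_nonneg_nonneg order_trans zero_le_power2)
  next
    case False
    then show ?thesis using mb(2) mb(5)[of t y] by (meson divide_nonneg_nonneg less_imp_le linear order_trans zero_le_power2)
  qed
  have Pnn: "0 \<le> y \<bullet> (P *v y)" for y
    using bP(1) bP(2)[of y] by (meson divide_nonneg_nonneg less_imp_le order_trans zero_le_power2)
  have C0: "am * e * A c1 \<le> C" "am * e * A c2 \<le> C" "am * A c2 \<le> C" "am * A c3 \<le> C" "0 \<le> C"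
    using am e0 A0 by (auto simp: C_def distrib_left intro!: add_nonneg_nonneg)
  have r1: "KUO Q B t x u \<le> C * exp (- R x) / (sqrt t + norm (x - D t *v u)) ^ ?n" if t: "0 < t" "t \<le> 1" for t x u
  proof -
    define w where "w = D (- t) *v x - u"
    define y where "y = norm (x - D t *v u)"
    define q where "q = w \<bullet> (P *v w) + (E t *v w) \<bullet> (S t *v (E t *v w))"
    have pos: "0 < sqrt t + y" using t by (simp add: y_def add_pos_nonneg)
    have "y \<le> L * norm w" unfolding y_def KUO_exponent(3)[OF t(1)] w_def using L(2)[of t] t by auto
    also have "\<dots> \<le> L * (K * norm (E t *v w))" using K(2)[of t w] t L(1) by (intro mult_left_mono) auto
    finally have "y\<^sup>2 \<le> (K * L)\<^sup>2 * (norm (E t *v w))\<^sup>2"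
      using power_mono[of y "L * (K * norm (E t *v w))" 2] by (simp add: y_def power_mult_distrib mult_ac)
    then have "y\<^sup>2 / (K * L)\<^sup>2 \<le> (norm (E t *v w))\<^sup>2"
      using K(1) L(1) by (simp add: divide_le_eq mult.commute)
    then have "y\<^sup>2 / (K * L)\<^sup>2 / (b * t) \<le> (norm (E t *v w))\<^sup>2 / (b * t)"
      using mb t by (intro divide_right_mono) auto
    then have "2 * c1 * y\<^sup>2 / (sqrt t)\<^sup>2 \<le> q"
      using mb(3)[OF t, of "E t *v w"] Pnn[of w] t by (simp add: c1_def q_def field_simps)
    then have "exp (- q / 2) \<le> exp ((real ?n)\<^sup>2 / (4 * c1)) * sqrt t ^ ?n / (sqrt t + y) ^ ?n"
      using c t by (intro gaussian_le_rational) (auto simp: y_def)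
    also have "\<dots> \<le> A c1 * sqrt t ^ ?n / (sqrt t + y) ^ ?n"
      using A(1)[of c1] pos t by (intro divide_right_mono mult_right_mono) auto
    finally have eq: "exp (- q / 2) \<le> A c1 * sqrt t ^ ?n / (sqrt t + y) ^ ?n" .
    have "KUO Q B t x u = a / sqrt (det (Qt Q B t)) * exp (t * trace B) * exp (- R x) * exp (- q / 2)"
      unfolding KUO_eq(1)[OF t(1)] q_def w_def a_def ..
    also have "\<dots> \<le> am / sqrt t ^ ?n * e * exp (- R x) * (A c1 * sqrt t ^ ?n / (sqrt t + y) ^ ?n)"
      using s1[OF t] e[OF t] eq am e0 t by (intro mult_mono) auto
    also have "\<dots> = (am * e * A c1) * (exp (- R x) / (sqrt t + y) ^ ?n)"
      using t by simp
    also have "\<dots> \<le> C * (exp (- R x) / (sqrt t + y) ^ ?n)"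
      using C0(1) pos by (intro mult_right_mono) auto
    finally show ?thesis by (simp add: y_def)
  qed
  have r2: "KUO Q B t x u * exp (R u) \<le> C * sqrt t / (sqrt t + norm (x - E t *v u)) ^ (?n + 1)"
    if t: "0 < t" "t \<le> 1" for t x u
  proof -
    define y where "y = norm (x - E t *v u)"
    define q where "q = (x - E t *v u) \<bullet> (S t *v (x - E t *v u))"
    have pos: "0 < sqrt t + y" using t by (simp add: y_def add_pos_nonneg)
    have "2 * c2 * y\<^sup>2 / (sqrt t)\<^sup>2 \<le> q"
      using mb(3)[OF t, of "x - E t *v u"] t by (simp add: c2_def q_def y_def field_simps)
    then have "exp (- q / 2) \<le> exp ((real (?n + 1))\<^sup>2 / (4 * c2)) * sqrt t ^ (?n + 1) / (sqrt t + y) ^ (?n + 1)"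
      using c t by (intro gaussian_le_rational) (auto simp: y_def)
    also have "\<dots> \<le> A c2 * sqrt t ^ (?n + 1) / (sqrt t + y) ^ (?n + 1)"
      using A(2)[of c2] pos t by (intro divide_right_mono mult_right_mono) auto
    finally have eq: "exp (- q / 2) \<le> A c2 * sqrt t ^ (?n + 1) / (sqrt t + y) ^ (?n + 1)" .
    have "KUO Q B t x u * exp (R u) = a / sqrt (det (Qt Q B t)) * exp (t * trace B) * exp (- q / 2)"
      unfolding KUO_eq(2)[OF t(1)] q_def a_def ..
    also have "\<dots> \<le> am / sqrt t ^ ?n * e * (A c2 * sqrt t ^ (?n + 1) / (sqrt t + y) ^ (?n + 1))"
      using s1[OF t] e[OF t] eq am e0 t by (intro mult_mono) auto
    also have "\<dots> = (am * e * A c2) * (sqrt t / (sqrt t + y) ^ (?n + 1))"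
      using t by simp
    also have "\<dots> \<le> C * (sqrt t / (sqrt t + y) ^ (?n + 1))"
      using C0(2) pos t by (intro mult_right_mono) auto
    finally show ?thesis by (simp add: y_def)
  qed
  have r3: "KUO Q B t x u \<le> C * exp (- R x) * exp (t * trace B) / (1 + norm (D (- t) *v x - u)) ^ (?n + 1)"
    if t: "1 \<le> t" for t x u
  proof -
    have t0: "t > 0" using t by simp
    define w where "w = D (- t) *v x - u"
    define y where "y = norm w"
    define q where "q = w \<bullet> (P *v w) + (E t *v w) \<bullet> (S t *v (E t *v w))"
    have pos: "0 < 1 + y" by (simp add: y_def add_pos_nonneg)
    have "2 * c3 * y\<^sup>2 / 1\<^sup>2 \<le> q"
      using bP(2)[of w] Snn[OF t0, of "E t *v w"] by (simp add: c3_def q_def y_def)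
    then have "exp (- q / 2) \<le> exp ((real (?n + 1))\<^sup>2 / (4 * c3)) * 1 ^ (?n + 1) / (1 + y) ^ (?n + 1)"
      using c by (intro gaussian_le_rational) (auto simp: y_def)
    also have "\<dots> \<le> A c3 * 1 ^ (?n + 1) / (1 + y) ^ (?n + 1)"
      using A(2)[of c3] pos by (intro divide_right_mono mult_right_mono) auto
    finally have eq: "exp (- q / 2) \<le> A c3 / (1 + y) ^ (?n + 1)" by simp
    have "KUO Q B t x u = a / sqrt (det (Qt Q B t)) * exp (t * trace B) * exp (- R x) * exp (- q / 2)"
      unfolding KUO_eq(1)[OF t0] q_def w_def a_def ..
    also have "\<dots> \<le> am * exp (t * trace B) * exp (- R x) * (A c3 / (1 + y) ^ (?n + 1))"
      using s2[OF t] eq am by (intro mult_mono) auto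
    also have "\<dots> = (am * A c3) * (exp (- R x) * exp (t * trace B) / (1 + y) ^ (?n + 1))"
      by simp
    also have "\<dots> \<le> C * (exp (- R x) * exp (t * trace B) / (1 + y) ^ (?n + 1))"
      using C0(4) pos by (intro mult_right_mono) auto
    finally show ?thesis by (simp add: y_def w_def)
  qed
  have r4: "KUO Q B t x u * exp (R u) \<le> C * exp (t * trace B) / (1 + norm (x - E t *v u)) ^ (?n + 1)"
    if t: "1 \<le> t" for t x u
  proof -
    have t0: "t > 0" using t by simp
    define y where "y = norm (x - E t *v u)"
    define q where "q = (x - E t *v u) \<bullet> (S t *v (x - E t *v u))"
    have pos: "0 < 1 + y" by (simp add: y_def add_pos_nonneg)
    have "2 * c2 * y\<^sup>2 / 1\<^sup>2 \<le> q"
      using mb(5)[OF t, of "x - E t *v u"] by (simp add: c2_def q_def y_def)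
    then have "exp (- q / 2) \<le> exp ((real (?n + 1))\<^sup>2 / (4 * c2)) * 1 ^ (?n + 1) / (1 + y) ^ (?n + 1)"
      using c by (intro gaussian_le_rational) (auto simp: y_def)
    also have "\<dots> \<le> A c2 * 1 ^ (?n + 1) / (1 + y) ^ (?n + 1)"
      using A(2)[of c2] pos by (intro divide_right_mono mult_right_mono) auto
    finally have eq: "exp (- q / 2) \<le> A c2 / (1 + y) ^ (?n + 1)" by simp
    have "KUO Q B t x u * exp (R u) = a / sqrt (det (Qt Q B t)) * exp (t * trace B) * exp (- q / 2)"
      unfolding KUO_eq(2)[OF t0] q_def a_def ..
    also have "\<dots> \<le> am * exp (t * trace B) * (A c2 / (1 + y) ^ (?n + 1))"
      using s2[OF t] eq am by (intro mult_mono) auto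
    also have "\<dots> = (am * A c2) * (exp (t * trace B) / (1 + y) ^ (?n + 1))"
      by simp
    also have "\<dots> \<le> C * (exp (t * trace B) / (1 + y) ^ (?n + 1))"
      using C0(3) pos by (intro mult_right_mono) auto
    finally show ?thesis by (simp add: y_def)
  qed
  show ?thesis using r1 r2 r3 r4 C0(5) by (intro exI[of _ C]) simp
qed

end

section \<open>The maximal operator of an abstract kernel\<close>

text \<open>With the least admissible \<open>j\<close>, either \<open>j = 0\<close> or
  \<open>d\<close> exceeds \<open>2^(j-1) s\<close>; in both cases \<open>s + d\<close> is at least
  half of \<open>2^j s\<close>. The extra power in the denominator produces the summable factor
  \<open>2^(-j)\<close>.\<close>

lemma dyadic_rational_bound:
  fixes s d :: real
  assumes s: "s > 0" and d: "d \<ge> 0"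
  shows "\<exists>j. d \<le> 2 ^ j * s \<and> s / (s + d) ^ (n + 1) \<le> 2 ^ (n + 1) * (1 / 2) ^ j / (2 ^ j * s) ^ n"
proof -
  have ex: "\<exists>j. d \<le> 2 ^ j * s"
  proof -
    obtain j where "d / s < 2 ^ j" using real_arch_pow[of 2 "d / s"] by auto
    then show ?thesis using s by (intro exI[of _ j]) (simp add: divide_less_eq)
  qed
  define j where "j = (LEAST j. d \<le> 2 ^ j * s)"
  have j: "d \<le> 2 ^ j * s" unfolding j_def by (rule LeastI_ex[OF ex])
  have low: "2 ^ j * s / 2 \<le> s + d"
  proof (cases j)
    case 0
    then show ?thesis using s d by simp
  next
    case (Suc i)
    then have "\<not> d \<le> 2 ^ i * s" using not_less_Least[of i "\<lambda>j. d \<le> 2 ^ j * s"] by (simp add: j_def)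
    then show ?thesis using s by (simp add: Suc)
  qed
  have "s / (s + d) ^ (n + 1) \<le> s / (2 ^ j * s / 2) ^ (n + 1)"
    using s d low by (intro divide_left_mono power_mono mult_pos_pos zero_less_power) auto
  also have "\<dots> = 2 ^ (n + 1) * (1 / 2) ^ j / (2 ^ j * s) ^ n"
    using s by (simp add: power_divide field_simps)
  finally show ?thesis using j by blast
qed

text \<open>The kernel is dominated by a sum of normalised indicators of dyadic balls with weights
  \<open>2^(-j)\<close>, so the bound depends neither on the scale \<open>s\<close> nor on the
  centre \<open>p\<close>.\<close>

lemma rational_kernel_integral:
  fixes p :: "real^'n"
  assumes s: "s > 0"
  shows "(\<integral>\<^sup>+y. ennreal (s / (s + norm (y - p)) ^ (CARD('n) + 1)) \<partial>lborel)
    \<le> ennreal (2 ^ (CARD('n) + 2) * unit_ball_vol (real CARD('n)))"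
proof -
  let ?n = "CARD('n)"
  define b where "b = (\<lambda>j. 2 ^ (?n + 1) * (1 / 2) ^ j / (2 ^ j * s) ^ ?n)"
  have b: "b j \<ge> 0" for j using s by (simp add: b_def)
  have pt: "ennreal (s / (s + norm (y - p)) ^ (?n + 1)) \<le> (\<Sum>j. ennreal (b j) * indicator (cball p (2 ^ j * s)) y)" for y
  proof -
    define h where "h = (\<lambda>j. ennreal (b j) * indicator (cball p (2 ^ j * s)) y :: ennreal)"
    obtain j where j: "norm (y - p) \<le> 2 ^ j * s" "s / (s + norm (y - p)) ^ (?n + 1) \<le> b j"
      using dyadic_rational_bound[OF s, of "norm (y - p)" ?n] by (auto simp: b_def)
    have "ennreal (s / (s + norm (y - p)) ^ (?n + 1)) \<le> h j"
      using j by (simp add: h_def indicator_def dist_norm norm_minus_commute ennreal_leI)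
    also have "\<dots> = (\<Sum>i\<in>{j}. h i)" by simp
    also have "\<dots> \<le> (\<Sum>j. h j)" by (rule sum_le_suminf) auto
    finally show ?thesis by (simp only: h_def)
  qed
  have "(\<integral>\<^sup>+y. ennreal (s / (s + norm (y - p)) ^ (?n + 1)) \<partial>lborel)
      \<le> (\<integral>\<^sup>+y. (\<Sum>j. ennreal (b j) * indicator (cball p (2 ^ j * s)) y) \<partial>lborel)"
    by (intro nn_integral_mono pt)
  also have "\<dots> = (\<Sum>j. \<integral>\<^sup>+y. ennreal (b j) * indicator (cball p (2 ^ j * s)) y \<partial>lborel)"
    by (rule nn_integral_suminf) (intro borel_measurable_times_ennreal borel_measurable_const borel_measurable_indicator, simp)
  also have "\<dots> = (\<Sum>j. ennreal ((2 ^ (?n + 1) * unit_ball_vol (real ?n)) * (1 / 2) ^ j))"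
  proof (rule suminf_cong)
    fix j
    have "(\<integral>\<^sup>+y. ennreal (b j) * indicator (cball p (2 ^ j * s)) y \<partial>lborel) = ennreal (b j) * ennreal (unit_ball_vol (real ?n) * (2 ^ j * s) ^ ?n)"
      using s by (simp add: nn_integral_cmult_indicator emeasure_cball)
    also have "\<dots> = ennreal (b j * (unit_ball_vol (real ?n) * (2 ^ j * s) ^ ?n))"
      using b s by (simp add: ennreal_mult)
    also have "b j * (unit_ball_vol (real ?n) * (2 ^ j * s) ^ ?n) = (2 ^ (?n + 1) * unit_ball_vol (real ?n)) * (1 / 2) ^ j"
      using s by (simp add: b_def)
    finally show "(\<integral>\<^sup>+y. ennreal (b j) * indicator (cball p (2 ^ j * s)) y \<partial>lborel) = ennreal ((2 ^ (?n + 1) * unit_ball_vol (real ?n)) * (1 / 2) ^ j)" .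
  qed
  also have "\<dots> = ennreal (\<Sum>j. (2 ^ (?n + 1) * unit_ball_vol (real ?n)) * (1 / 2) ^ j)"
    by (intro suminf_ennreal2 summable_mult summable_geometric) auto
  also have "(\<Sum>j. (2 ^ (?n + 1) * unit_ball_vol (real ?n)) * (1 / 2) ^ j) = 2 ^ (?n + 2) * unit_ball_vol (real ?n)"
    by (subst suminf_mult) (auto simp: suminf_geometric summable_geometric)
  finally show ?thesis .
qed

lemma nn_integral_compose_linear:
  fixes T :: "real^'n^'n"
  assumes f: "f \<in> borel_measurable borel" and det: "det T \<noteq> 0"
  shows "(\<integral>\<^sup>+x. f (T *v x) \<partial>lborel) = ennreal (1 / \<bar>det T\<bar>) * (\<integral>\<^sup>+x. f x \<partial>lborel)"
  unfolding nn_integral_linear_image[OF f det] mult.assoc[symmetric]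
  using det by (simp add: ennreal_mult[symmetric])

text \<open>The upper bounds share one constant \<open>C\<close>; \<open>\<theta>\<close> is to be
  \<open>- trace B\<close>, and \<open>\<kappa>\<close> is the normalising factor of the measure.
  \<open>K1\<close> and \<open>K3\<close> involve the flow \<open>D\<close> and the weight at
  \<open>x\<close>, while \<open>K2\<close> and \<open>K4\<close> involve \<open>E\<close> and the
  weight at \<open>u\<close>.\<close>

locale ou_kernel =
  fixes D E :: "real \<Rightarrow> real^'n^'n" and R :: "real^'n \<Rightarrow> real"
    and k :: "real \<Rightarrow> real^'n \<Rightarrow> real^'n \<Rightarrow> real" and \<theta> C c \<kappa> :: real
  assumes C: "C \<ge> 1" and c: "c > 0" and \<kappa>: "\<kappa> > 0"
    and D_0: "D 0 = mat 1" and D_add: "D (s + t) = D s ** D t"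
    and det_D: "det (D s) = exp (\<theta> * s)" and det_E: "det (E s) = exp (- \<theta> * s)"
    and cont_D: "continuous_on UNIV D" and cont_R: "continuous_on UNIV R"
    and D_bound: "\<bar>s\<bar> \<le> 1 \<Longrightarrow> norm (D s *v x) \<le> C * norm x"
    and D_near: "\<bar>s\<bar> \<le> 1 \<Longrightarrow> norm (D s *v x - x) \<le> C * \<bar>s\<bar> * norm x"
    and D_decay: "0 \<le> s \<Longrightarrow> norm (D (- s) *v x) \<le> C * exp (- c * s) * norm x"
    and E_near: "0 \<le> s \<Longrightarrow> s \<le> 1 \<Longrightarrow> norm (E s *v x - x) \<le> C * s * norm x"
    and R_flow: "0 \<le> s \<Longrightarrow> s \<le> 1 \<Longrightarrow> R x + c * s * (norm x)\<^sup>2 \<le> R (D s *v x)"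
    and R_near: "\<bar>R u - R x\<bar> \<le> C * norm (u - x) * (norm u + norm x)"
    and k_nonneg: "0 < t \<Longrightarrow> 0 \<le> k t x u"
    and k_cont: "0 < t \<Longrightarrow> continuous_on UNIV (\<lambda>(x, u). k t x u)"
    and K1: "0 < t \<Longrightarrow> t \<le> 1 \<Longrightarrow> k t x u \<le> C * exp (- R x) / (sqrt t + norm (x - D t *v u)) ^ CARD('n)"
    and K2: "0 < t \<Longrightarrow> t \<le> 1 \<Longrightarrow> k t x u * exp (R u) \<le> C * sqrt t / (sqrt t + norm (x - E t *v u)) ^ (CARD('n) + 1)"
    and K3: "1 \<le> t \<Longrightarrow> k t x u \<le> C * exp (- R x) * exp (- \<theta> * t) / (1 + norm (D (- t) *v x - u)) ^ (CARD('n) + 1)"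
    and K4: "1 \<le> t \<Longrightarrow> k t x u * exp (R u) \<le> C * exp (- \<theta> * t) / (1 + norm (x - E t *v u)) ^ (CARD('n) + 1)"
begin

definition \<mu> :: "(real^'n) measure" where
  "\<mu> = density lborel (\<lambda>x. ennreal (\<kappa> * exp (R x)))"

text \<open>Applied to nonnegative \<open>f\<close>. The value \<open>\<infinity>\<close> is
  allowed, so the associated maximal function \<open>N\<close> makes sense for every such measurable
  \<open>f\<close> without integrability.\<close>

definition T :: "real \<Rightarrow> (real^'n \<Rightarrow> real) \<Rightarrow> real^'n \<Rightarrow> ennreal" where
  "T t f x = (\<integral>\<^sup>+u. ennreal (k t x u * f u) \<partial>\<mu>)"

definition N :: "(real^'n \<Rightarrow> real) \<Rightarrow> real^'n \<Rightarrow> ennreal" where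
  "N f x = (SUP t\<in>{0<..}. T t f x)"

lemma sets_\<mu> [measurable_cong]: "sets \<mu> = sets borel" by (simp add: \<mu>_def)

lemma measurable_R [measurable]: "R \<in> borel_measurable borel"
  by (rule borel_measurable_continuous_onI[OF cont_R])

lemma measurable_k [measurable (raw)]:
  assumes "t > 0" "f \<in> borel_measurable M" "g \<in> borel_measurable M"
  shows "(\<lambda>x. k t (f x) (g x)) \<in> borel_measurable M"
proof -
  have "(\<lambda>(x, u). k t x u) \<in> borel_measurable borel"
    by (rule borel_measurable_continuous_onI[OF k_cont[OF assms(1)]])
  from measurable_compose[OF borel_measurable_Pair[OF assms(2,3)] this] show ?thesis by simp
qed

lemma nn_integral_\<mu>:
  assumes "h \<in> borel_measurable borel"
  shows "(\<integral>\<^sup>+u. h u \<partial>\<mu>) = (\<integral>\<^sup>+u. ennreal (\<kappa> * exp (R u)) * h u \<partial>lborel)"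
  unfolding \<mu>_def using assms by (intro nn_integral_density) auto

text \<open>With the weight moved to \<open>u\<close> by \<open>K2\<close> or \<open>K4\<close>, the
  substitution \<open>v = E t u\<close> leaves a rational kernel at scale \<open>sqrt t\<close> or
  \<open>1\<close>. The Jacobian \<open>exp (\<theta> * t)\<close> is bounded for
  \<open>t \<le> 1\<close> and is cancelled by the factor \<open>exp (- \<theta> * t)\<close> of
  \<open>K4\<close> beyond.\<close>

lemma T_1_bound: "\<exists>A\<ge>0. \<forall>t>0. \<forall>x. T t (\<lambda>_. 1) x \<le> ennreal A"
proof -
  let ?n = "CARD('n)"
  define K where "K = 2 ^ (?n + 2) * unit_ball_vol (real CARD('n))"
  have K0: "K \<ge> 0" by (simp add: K_def)
  define A where "A = \<kappa> * C * exp \<bar>\<theta>\<bar> * K"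
  have A: "A \<ge> 0" using \<kappa> C K0 by (simp add: A_def)
  have gen: "T t (\<lambda>_. 1) x \<le> ennreal A"
    if t: "t > 0" and s: "s > 0" and B: "B \<ge> 0" "B * exp (\<theta> * t) \<le> C * exp \<bar>\<theta>\<bar>"
      and le: "\<And>u. k t x u * exp (R u) \<le> B * s / (s + norm (x - E t *v u)) ^ (?n + 1)" for t x s B
  proof -
    have "T t (\<lambda>_. 1) x = (\<integral>\<^sup>+u. ennreal (\<kappa> * exp (R u)) * ennreal (k t x u) \<partial>lborel)"
      unfolding T_def by (subst nn_integral_\<mu>) (use t in auto)
    also have "\<dots> \<le> (\<integral>\<^sup>+u. ennreal (\<kappa> * B) * ennreal (s / (s + norm (E t *v u - x)) ^ (?n + 1)) \<partial>lborel)"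
    proof (rule nn_integral_mono)
      fix u
      have "ennreal (\<kappa> * exp (R u)) * ennreal (k t x u) = ennreal (\<kappa> * (k t x u * exp (R u)))"
        using \<kappa> k_nonneg[OF t, of x u] by (subst ennreal_mult[symmetric]) (auto simp: mult_ac)
      also have "\<dots> \<le> ennreal (\<kappa> * (B * s / (s + norm (x - E t *v u)) ^ (?n + 1)))"
        using \<kappa> by (intro ennreal_leI mult_left_mono le) auto
      also have "\<dots> = ennreal (\<kappa> * B) * ennreal (s / (s + norm (E t *v u - x)) ^ (?n + 1))"
        using \<kappa> B s by (subst ennreal_mult[symmetric]) (auto simp: norm_minus_commute)
      finally show "ennreal (\<kappa> * exp (R u)) * ennreal (k t x u) \<le> ennreal (\<kappa> * B) * ennreal (s / (s + norm (E t *v u - x)) ^ (?n + 1))" .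
    qed
    also have "\<dots> = ennreal (\<kappa> * B) * (\<integral>\<^sup>+u. ennreal (s / (s + norm (E t *v u - x)) ^ (?n + 1)) \<partial>lborel)"
      by (rule nn_integral_cmult) auto
    also have "(\<integral>\<^sup>+u. ennreal (s / (s + norm (E t *v u - x)) ^ (?n + 1)) \<partial>lborel) =
        ennreal (1 / \<bar>det (E t)\<bar>) * (\<integral>\<^sup>+v. ennreal (s / (s + norm (v - x)) ^ (?n + 1)) \<partial>lborel)"
      by (rule nn_integral_compose_linear) (auto simp: det_E)
    also have "ennreal (1 / \<bar>det (E t)\<bar>) = ennreal (exp (\<theta> * t))"
      by (simp add: det_E exp_minus divide_inverse)
    also have "(\<integral>\<^sup>+v. ennreal (s / (s + norm (v - x)) ^ (?n + 1)) \<partial>lborel) \<le> ennreal K"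
      unfolding K_def by (rule rational_kernel_integral[OF s])
    also have "ennreal (\<kappa> * B) * (ennreal (exp (\<theta> * t)) * ennreal K) = ennreal (\<kappa> * (B * exp (\<theta> * t)) * K)"
      using \<kappa> B K0 by (simp add: ennreal_mult[symmetric] mult_ac)
    also have "\<dots> \<le> ennreal A"
      unfolding A_def using \<kappa> B K0 by (intro ennreal_leI mult_right_mono) (auto simp: mult.assoc intro!: mult_left_mono)
    finally show ?thesis by (simp add: mult_left_mono)
  qed
  have "T t (\<lambda>_. 1) x \<le> ennreal A" if t: "t > 0" for t x
  proof (cases "t \<le> 1")
    case True
    have "\<theta> * t \<le> \<bar>\<theta>\<bar> * t" using t by (intro mult_right_mono) auto
    also have "\<dots> \<le> \<bar>\<theta>\<bar> * 1" using True by (intro mult_left_mono) auto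
    finally have "C * exp (\<theta> * t) \<le> C * exp \<bar>\<theta>\<bar>" using C by simp
    with t C K2[OF t True] show ?thesis
      by (intro gen[of t "sqrt t" C]) simp_all
  next
    case False
    then have t1: "1 \<le> t" by simp
    have eq: "C * exp (- \<theta> * t) * exp (\<theta> * t) = C" by (simp add: exp_minus)
    have "C \<le> C * exp \<bar>\<theta>\<bar>" using C by simp
    have "0 \<le> C * exp (- \<theta> * t)" using C by simp
    moreover have "C * exp (- \<theta> * t) * exp (\<theta> * t) \<le> C * exp \<bar>\<theta>\<bar>" unfolding eq by fact
    moreover have "k t x u * exp (R u) \<le> C * exp (- \<theta> * t) * 1 / (1 + norm (x - E t *v u)) ^ (?n + 1)" for u
      using K4[OF t1] by simp
    ultimately show ?thesis using t by (intro gen[of t 1 "C * exp (- \<theta> * t)"]) simp_all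
  qed
  then show ?thesis using A by blast
qed

text \<open>Lower semicontinuity by Fatou, since the kernel is continuous and the integrand
  nonnegative.\<close>

lemma open_superlevel_T:
  assumes t: "t > 0" and f [measurable]: "f \<in> borel_measurable borel"
  shows "open {x. a < T t f x}"
proof -
  have "closed {x. T t f x \<le> a}"
    unfolding closed_sequential_limits
  proof (intro allI impI, elim conjE)
    fix X x assume X: "\<forall>n. X n \<in> {x. T t f x \<le> a}" and lim: "X \<longlonglongrightarrow> x"
    have "(\<lambda>n. k t (X n) u) \<longlonglongrightarrow> k t x u" for u
    proof -
      have "isCont (\<lambda>(x, u). k t x u) (x, u)"
        using k_cont[OF t] by (simp add: continuous_on_eq_continuous_at)
      moreover have "(\<lambda>n. (X n, u)) \<longlonglongrightarrow> (x, u)" by (intro tendsto_intros lim)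
      ultimately have "(\<lambda>n. (\<lambda>(x, u). k t x u) (X n, u)) \<longlonglongrightarrow> (\<lambda>(x, u). k t x u) (x, u)"
        by (rule isCont_tendsto_compose)
      then show ?thesis by simp
    qed
    then have "(\<lambda>n. ennreal (k t (X n) u * f u)) \<longlonglongrightarrow> ennreal (k t x u * f u)" for u
      by (intro tendsto_ennrealI tendsto_mult tendsto_const)
    then have "liminf (\<lambda>n. ennreal (k t (X n) u * f u)) = ennreal (k t x u * f u)" for u
      by (intro lim_imp_Liminf) auto
    then have "T t f x = (\<integral>\<^sup>+u. liminf (\<lambda>n. ennreal (k t (X n) u * f u)) \<partial>\<mu>)"
      unfolding T_def by simp
    also have "\<dots> \<le> liminf (\<lambda>n. T t f (X n))"
      unfolding T_def by (rule nn_integral_liminf) (use t in measurable)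
    also have "\<dots> \<le> liminf (\<lambda>n. a)" by (rule Liminf_mono) (use X in auto)
    also have "\<dots> = a" by (simp add: Liminf_const)
    finally show "x \<in> {x. T t f x \<le> a}" by simp
  qed
  moreover have "{x. a < T t f x} = - {x. T t f x \<le> a}" by auto
  ultimately show ?thesis by (simp add: open_closed)
qed

lemma open_superlevel_N:
  assumes "f \<in> borel_measurable borel"
  shows "open {x. a < N f x}"
proof -
  have "{x. a < N f x} = (\<Union>t\<in>{0<..}. {x. a < T t f x})" by (auto simp: N_def less_SUP_iff)
  then show ?thesis using open_superlevel_T[OF _ assms] by auto
qed

end

section \<open>The local part\<close>

text \<open>Countable sums are written as integrals over \<open>count_space\<close>, so exchanging
  them with the integral is again a Tonelli argument; disjointness bounds the overlap by
  \<open>1\<close>.\<close>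

lemma disjoint_countable_nn_integral_le:
  assumes "countable I" and disj: "pairwise (\<lambda>i j. disjnt (X i) (X j)) I"
    and X: "\<And>i. i \<in> I \<Longrightarrow> X i \<in> sets M" and f [measurable]: "f \<in> borel_measurable M"
  shows "(\<integral>\<^sup>+i. (\<integral>\<^sup>+u. f u * indicator (X i) u \<partial>M) \<partial>count_space I) \<le> (\<integral>\<^sup>+u. f u \<partial>M)"
proof -
  have "(\<integral>\<^sup>+i. (\<integral>\<^sup>+u. f u * indicator (X i) u \<partial>M) \<partial>count_space I)
      = (\<integral>\<^sup>+u. (\<integral>\<^sup>+i. f u * indicator (X i) u \<partial>count_space I) \<partial>M)"
    using X by (intro nn_integral_count_space_nn_integral[symmetric] assms(1)
        borel_measurable_times_ennreal borel_measurable_indicator f)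
  also have "\<dots> \<le> (\<integral>\<^sup>+u. f u \<partial>M)"
  proof (rule nn_integral_mono)
    fix u
    have "(\<integral>\<^sup>+i. indicator (X i) u \<partial>count_space I) = (\<integral>\<^sup>+i. indicator {i \<in> I. u \<in> X i} i \<partial>count_space I)"
      by (intro nn_integral_cong) (auto simp: indicator_def)
    also have "\<dots> = emeasure (count_space I) {i \<in> I. u \<in> X i}" by (rule nn_integral_indicator) simp
    also have "\<dots> \<le> 1"
    proof (cases "{i \<in> I. u \<in> X i} = {}")
      case False
      then obtain i where i: "i \<in> I" "u \<in> X i" by blast
      have "{i \<in> I. u \<in> X i} = {i}"
        using i disj by (auto simp: pairwise_def disjnt_iff)
      then show ?thesis using i by (simp add: emeasure_count_space_finite)
    next
      case True
      show ?thesis unfolding True by simp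
    qed
    finally have "f u * (\<integral>\<^sup>+i. indicator (X i) u \<partial>count_space I) \<le> f u * 1"
      by (intro mult_left_mono) auto
    then show "(\<integral>\<^sup>+i. f u * indicator (X i) u \<partial>count_space I) \<le> f u"
      by (simp add: nn_integral_cmult)
  qed
  finally show ?thesis .
qed

lemma emeasure_countable_UN_le:
  assumes "countable I" and X: "\<And>i. i \<in> I \<Longrightarrow> X i \<in> sets M"
  shows "emeasure M (\<Union>i\<in>I. X i) \<le> (\<integral>\<^sup>+i. emeasure M (X i) \<partial>count_space I)"
proof -
  have U: "(\<Union>i\<in>I. X i) \<in> sets M" using assms by (intro sets.countable_UN'')
  have "emeasure M (\<Union>i\<in>I. X i) = (\<integral>\<^sup>+u. indicator (\<Union>i\<in>I. X i) u \<partial>M)" using U by simp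
  also have "\<dots> \<le> (\<integral>\<^sup>+u. (\<integral>\<^sup>+i. indicator (X i) u \<partial>count_space I) \<partial>M)"
  proof (rule nn_integral_mono)
    fix u
    show "indicator (\<Union>i\<in>I. X i) u \<le> (\<integral>\<^sup>+i. indicator (X i) u \<partial>count_space I)"
    proof (cases "u \<in> (\<Union>i\<in>I. X i)")
      case True
      then obtain j where j: "j \<in> I" "u \<in> X j" by blast
      have "1 = (\<integral>\<^sup>+i. indicator {j} i \<partial>count_space I)"
        using j(1) by (simp add: emeasure_count_space_finite)
      also have "\<dots> \<le> (\<integral>\<^sup>+i. indicator (X i) u \<partial>count_space I)"
        using j by (intro nn_integral_mono) (auto simp: indicator_def)
      finally show ?thesis using True by simp
    qed simp
  qed
  also have "\<dots> = (\<integral>\<^sup>+i. (\<integral>\<^sup>+u. indicator (X i) u \<partial>M) \<partial>count_space I)"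
    using X by (intro nn_integral_count_space_nn_integral assms(1) borel_measurable_indicator)
  also have "\<dots> = (\<integral>\<^sup>+i. emeasure M (X i) \<partial>count_space I)"
    using X by (intro nn_integral_cong) simp
  finally show ?thesis .
qed

context ou_kernel
begin

text \<open>The factor \<open>5\<close> is the enlargement in Vitali's lemma. On the enlarged ball
  \<open>|u - a| \<le> 5 \<rho>\<close> and \<open>|u| + |a| \<le> 7 (1 + |a|)\<close>, so
  \<open>R\<close> exceeds \<open>R a\<close> by at most \<open>35 C\<close>.\<close>

lemma emeasure_\<mu>_cball_le:
  assumes \<rho>: "\<rho> > 0" "\<rho> * (1 + norm a) \<le> 1"
  shows "emeasure \<mu> (cball a (5 * \<rho>)) \<le> ennreal (\<kappa> * exp (35 * C) * unit_ball_vol (real CARD('n)) * 5 ^ CARD('n) * (exp (R a) * \<rho> ^ CARD('n)))"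
proof -
  have "\<rho> * 1 \<le> \<rho> * (1 + norm a)" using \<rho> by (intro mult_left_mono) auto
  then have \<rho>1: "\<rho> \<le> 1" using \<rho> by linarith
  have Ru: "R u \<le> R a + 35 * C" if "u \<in> cball a (5 * \<rho>)" for u
  proof -
    have d: "norm (u - a) \<le> 5 * \<rho>" using that by (simp add: dist_norm norm_minus_commute)
    have "norm u \<le> norm a + 5 * \<rho>" using norm_triangle_ineq[of a "u - a"] d by simp
    then have s: "norm u + norm a \<le> 7 * (1 + norm a)"
    proof -
      have "norm u \<le> norm a + 5" using \<open>norm u \<le> norm a + 5 * \<rho>\<close> \<rho>1 by simp
      moreover have "0 \<le> norm a" by simp
      ultimately show ?thesis by (simp add: distrib_left del: norm_ge_zero)
    qed
    have "C * norm (u - a) * (norm u + norm a) \<le> C * (5 * \<rho>) * (7 * (1 + norm a))"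
      using C d s \<rho> by (intro mult_mono) auto
    also have "\<dots> = 35 * C * (\<rho> * (1 + norm a))" by simp
    also have "\<dots> \<le> 35 * C * 1" using C \<rho> by (intro mult_left_mono) auto
    finally show ?thesis using R_near[of u a] by simp
  qed
  have "emeasure \<mu> (cball a (5 * \<rho>)) = (\<integral>\<^sup>+u. indicator (cball a (5 * \<rho>)) u \<partial>\<mu>)"
    by (subst nn_integral_indicator) (auto simp: sets_\<mu>)
  also have "\<dots> = (\<integral>\<^sup>+u. ennreal (\<kappa> * exp (R u)) * indicator (cball a (5 * \<rho>)) u \<partial>lborel)"
    by (rule nn_integral_\<mu>) (intro borel_measurable_indicator, simp)
  also have "\<dots> \<le> (\<integral>\<^sup>+u. ennreal (\<kappa> * (exp (R a) * exp (35 * C))) * indicator (cball a (5 * \<rho>)) u \<partial>lborel)"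
    using Ru \<kappa> by (intro nn_integral_mono) (auto simp: indicator_def exp_add[symmetric] intro!: ennreal_leI)
  also have "\<dots> = ennreal (\<kappa> * (exp (R a) * exp (35 * C))) * ennreal (unit_ball_vol (real CARD('n)) * (5 * \<rho>) ^ CARD('n))"
    using \<rho> by (simp add: nn_integral_cmult_indicator emeasure_cball)
  also have "\<dots> = ennreal (\<kappa> * exp (35 * C) * unit_ball_vol (real CARD('n)) * 5 ^ CARD('n) * (exp (R a) * \<rho> ^ CARD('n)))"
    using \<kappa> \<rho> by (subst ennreal_mult[symmetric]) (auto simp: power_mult_distrib mult_ac)
  finally show ?thesis .
qed

text \<open>A weak type bound for the maximal function over small balls, in a form suited to later
  use: outside an exceptional set all admissible balls centred at the point have controlled
  mass.\<close>

lemma local_maximal: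
  "\<exists>A>0. \<forall>f l. f \<in> borel_measurable borel \<longrightarrow> l > 0 \<longrightarrow>
     (\<exists>U\<in>sets borel. emeasure \<mu> U \<le> ennreal (A / l) * (\<integral>\<^sup>+u. ennreal (f u) \<partial>\<mu>) \<and>
        (\<forall>x \<rho>. x \<notin> U \<longrightarrow> 0 < \<rho> \<longrightarrow> \<rho> * (1 + norm x) \<le> 1 \<longrightarrow>
          (\<integral>\<^sup>+u. ennreal (f u) * indicator (cball x \<rho>) u \<partial>\<mu>) \<le> ennreal (l * (exp (R x) * \<rho> ^ CARD('n)))))"
proof -
  define A where "A = \<kappa> * exp (35 * C) * unit_ball_vol (real CARD('n)) * 5 ^ CARD('n)"
  have A: "A > 0" using \<kappa> by (simp add: A_def)
  have "\<exists>U\<in>sets borel. emeasure \<mu> U \<le> ennreal (A / l) * (\<integral>\<^sup>+u. ennreal (f u) \<partial>\<mu>) \<and>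
        (\<forall>x \<rho>. x \<notin> U \<longrightarrow> 0 < \<rho> \<longrightarrow> \<rho> * (1 + norm x) \<le> 1 \<longrightarrow>
          (\<integral>\<^sup>+u. ennreal (f u) * indicator (cball x \<rho>) u \<partial>\<mu>) \<le> ennreal (l * (exp (R x) * \<rho> ^ CARD('n))))"
    if f [measurable]: "f \<in> borel_measurable borel" and l: "l > 0" for f l
  proof -
    define J where "J = (\<lambda>i :: (real^'n) \<times> real. \<integral>\<^sup>+u. ennreal (f u) * indicator (cball (fst i) (snd i)) u \<partial>\<mu>)"
    \<comment> \<open>The balls of too large mass, as pairs of centre and radius. Vitali selects
      disjoint ones whose enlargements cover, and each enlargement has measure at most
      \<open>A / l\<close> times the mass of \<open>f\<close> on the original ball.\<close>
    define K where "K = {i :: (real^'n) \<times> real. 0 < snd i \<and> snd i * (1 + norm (fst i)) \<le> 1 \<and>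
      ennreal (l * (exp (R (fst i)) * snd i ^ CARD('n))) < J i}"
    have r: "0 < snd i \<and> snd i \<le> 1" if "i \<in> K" for i
    proof -
      have i: "0 < snd i" "snd i * (1 + norm (fst i)) \<le> 1" using that by (auto simp: K_def)
      then have "snd i * 1 \<le> snd i * (1 + norm (fst i))" by (intro mult_left_mono) auto
      then show ?thesis using i by linarith
    qed
    obtain I where I: "countable I" "I \<subseteq> K"
      "pairwise (\<lambda>i j. disjnt (cball (fst i) (snd i)) (cball (fst j) (snd j))) I"
      "(\<Union>i\<in>K. cball (fst i) (snd i)) \<subseteq> (\<Union>i\<in>I. cball (fst i) (5 * snd i))"
      by (rule Vitali_covering_lemma_cballs[where a = fst and r = snd and K = K and B = 1, OF order_refl r]) (assumption | rule that)+
    define U where "U = (\<Union>i\<in>I. cball (fst i) (5 * snd i))"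
    have U: "U \<in> sets borel" unfolding U_def by (intro sets.countable_UN'' I) auto
    have "emeasure \<mu> U \<le> (\<integral>\<^sup>+i. emeasure \<mu> (cball (fst i) (5 * snd i)) \<partial>count_space I)"
      unfolding U_def by (rule emeasure_countable_UN_le[OF I(1)]) (simp add: sets_\<mu>)
    also have "\<dots> \<le> (\<integral>\<^sup>+i. ennreal (A / l) * J i \<partial>count_space I)"
    proof (rule nn_integral_mono)
      fix i assume "i \<in> space (count_space I)"
      then have i: "i \<in> K" using I(2) by auto
      then have "0 < snd i" "snd i * (1 + norm (fst i)) \<le> 1" by (auto simp: K_def)
      from emeasure_\<mu>_cball_le[OF this]
      have "emeasure \<mu> (cball (fst i) (5 * snd i)) \<le> ennreal (A * (exp (R (fst i)) * snd i ^ CARD('n)))"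
        by (simp add: A_def)
      also have "\<dots> = ennreal (A / l) * ennreal (l * (exp (R (fst i)) * snd i ^ CARD('n)))"
        using A l r[OF i] by (subst ennreal_mult[symmetric]) auto
      also have "\<dots> \<le> ennreal (A / l) * J i"
        using i by (intro mult_left_mono) (auto simp: K_def)
      finally show "emeasure \<mu> (cball (fst i) (5 * snd i)) \<le> ennreal (A / l) * J i" .
    qed
    also have "\<dots> = ennreal (A / l) * (\<integral>\<^sup>+i. J i \<partial>count_space I)" by (rule nn_integral_cmult) simp
    also have "\<dots> \<le> ennreal (A / l) * (\<integral>\<^sup>+u. ennreal (f u) \<partial>\<mu>)"
      unfolding J_def by (intro mult_left_mono disjoint_countable_nn_integral_le I) (auto simp: sets_\<mu>)
    finally have "emeasure \<mu> U \<le> ennreal (A / l) * (\<integral>\<^sup>+u. ennreal (f u) \<partial>\<mu>)" .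
    moreover have "(\<integral>\<^sup>+u. ennreal (f u) * indicator (cball x \<rho>) u \<partial>\<mu>) \<le> ennreal (l * (exp (R x) * \<rho> ^ CARD('n)))"
      if "x \<notin> U" "0 < \<rho>" "\<rho> * (1 + norm x) \<le> 1" for x \<rho>
    proof (rule ccontr)
      assume "\<not> ?thesis"
      then have "(x, \<rho>) \<in> K" using that by (simp add: K_def J_def not_le)
      then have "x \<in> (\<Union>i\<in>K. cball (fst i) (snd i))" using that by force
      then have "x \<in> U" unfolding U_def by (rule subsetD[OF I(4)])
      then show False using that by simp
    qed
    ultimately show ?thesis using U by blast
  qed
  then show ?thesis using A by blast
qed

text \<open>In the local region the centre \<open>E t u\<close> of \<open>K2\<close> may be replaced
  by \<open>u\<close>, and the weight at \<open>u\<close> by the weight at \<open>x\<close>, at the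
  cost of constants.\<close>

lemma local_kernel_bound:
  assumes t: "0 < t" "t \<le> 1" and loc: "norm (x - u) * (1 + norm x) \<le> 1"
  shows "k t x u \<le> C * (1 + C) ^ (CARD('n) + 1) * exp (3 * C) * exp (- R x) * (sqrt t / (sqrt t + norm (x - u)) ^ (CARD('n) + 1))"
proof -
  let ?n = "CARD('n)"
  define s d y m where "s = sqrt t" and "d = norm (x - u)" and "y = norm (x - E t *v u)" and "m = 1 + norm x"
  have s: "s > 0" "s\<^sup>2 = t" using t by (auto simp: s_def)
  have m: "m \<ge> 1" by (simp add: m_def)
  have dm: "d * m \<le> 1" "d \<ge> 0" "y \<ge> 0" using loc by (auto simp: d_def m_def y_def)
  then have d1: "d \<le> 1" using mult_left_mono[OF m, of d] by simp
  have u: "norm u \<le> m" using norm_triangle_ineq[of x "u - x"] d1 by (simp add: d_def m_def norm_minus_commute)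
  \<comment> \<open>If \<open>s m \<le> 1\<close>, the displacement of \<open>u\<close> by
    \<open>E t\<close> is at most \<open>C s^2 m \<le> C s\<close>. Otherwise
    \<open>d \<le> 1 / m < s\<close>, so \<open>s\<close> alone dominates.\<close>
  have sd: "s + d \<le> (1 + C) * (s + y)"
  proof (cases "s * m \<le> 1")
    case True
    have "norm (E t *v u - u) \<le> C * t * norm u" using E_near[of t u] t by simp
    also have "\<dots> \<le> C * t * m" using C t u by (intro mult_left_mono) auto
    also have "\<dots> = C * s * (s * m)" unfolding s(2)[symmetric] by (simp add: power2_eq_square)
    also have "\<dots> \<le> C * s * 1" using C s True by (intro mult_left_mono) auto
    finally have "norm (E t *v u - u) \<le> C * s" by simp
    then have "d \<le> y + C * s"
      using norm_triangle_ineq[of "x - E t *v u" "E t *v u - u"] by (simp add: d_def y_def)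
    moreover have "y \<le> (1 + C) * y" using C dm mult_right_mono[of 1 "1 + C" y] by simp
    ultimately show ?thesis by (simp add: distrib_left distrib_right)
  next
    case False
    have "d * m < s * m" using dm False by simp
    then have "d < s" using m by simp
    then have "s + d \<le> 2 * s" by simp
    also have "\<dots> \<le> (1 + C) * (s + y)" using C s dm by (intro mult_mono) auto
    finally show ?thesis .
  qed
  have pos: "0 < s + d" "0 < s + y" using s dm by auto
  have "s / (s + y) ^ (?n + 1) = (1 + C) ^ (?n + 1) * (s / ((1 + C) * (s + y)) ^ (?n + 1))"
    using C by (simp add: power_mult_distrib del: power_Suc)
  also have "\<dots> \<le> (1 + C) ^ (?n + 1) * (s / (s + d) ^ (?n + 1))"
    using C s sd pos by (intro mult_left_mono divide_left_mono power_mono mult_pos_pos zero_less_power) auto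
  finally have 1: "s / (s + y) ^ (?n + 1) \<le> (1 + C) ^ (?n + 1) * (s / (s + d) ^ (?n + 1))" .
  have "C * norm (u - x) * (norm u + norm x) \<le> C * d * (2 * m)"
    using C u dm by (intro mult_mono) (auto simp: d_def m_def norm_minus_commute)
  also have "\<dots> \<le> 2 * C" using mult_left_mono[OF dm(1), of "2 * C"] C by (simp add: mult_ac)
  finally have "R x \<le> R u + 3 * C" using R_near[of u x] C by linarith
  then have 2: "exp (- R u) \<le> exp (3 * C) * exp (- R x)" by (simp add: exp_add[symmetric])
  have "k t x u = (k t x u * exp (R u)) * exp (- R u)" by (simp add: mult.assoc exp_add[symmetric])
  also have "\<dots> \<le> (C * s / (s + y) ^ (?n + 1)) * (exp (3 * C) * exp (- R x))"
    using K2[OF t, of x u] 2 C s pos unfolding s_def[symmetric] y_def[symmetric]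
    by (intro mult_mono) auto
  also have "\<dots> = C * (exp (3 * C) * exp (- R x)) * (s / (s + y) ^ (?n + 1))" by simp
  also have "\<dots> \<le> C * (exp (3 * C) * exp (- R x)) * ((1 + C) ^ (?n + 1) * (s / (s + d) ^ (?n + 1)))"
    using C 1 by (intro mult_left_mono) auto
  finally show ?thesis by (simp add: s_def d_def mult_ac)
qed

lemma local_part_bound:
  "\<exists>A>0. \<forall>f l x t. f \<in> borel_measurable borel \<longrightarrow> (\<forall>u. 0 \<le> f u) \<longrightarrow> l > 0 \<longrightarrow> 0 < t \<longrightarrow> t \<le> 1 \<longrightarrow>
     (\<forall>\<rho>. 0 < \<rho> \<longrightarrow> \<rho> * (1 + norm x) \<le> 1 \<longrightarrow>
        (\<integral>\<^sup>+u. ennreal (f u) * indicator (cball x \<rho>) u \<partial>\<mu>) \<le> ennreal (l * (exp (R x) * \<rho> ^ CARD('n)))) \<longrightarrow>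
     (\<integral>\<^sup>+u. ennreal (k t x u * f u) * indicator {u. norm (x - u) * (1 + norm x) \<le> 1} u \<partial>\<mu>) \<le> ennreal (A * l)"
proof -
  let ?n = "CARD('n)"
  define A1 where "A1 = C * (1 + C) ^ (?n + 1) * exp (3 * C)"
  have A1: "A1 > 0" using C by (simp add: A1_def)
  define A where "A = A1 * 2 ^ (?n + 2)"
  have A: "A > 0" using A1 by (simp add: A_def)
  have "(\<integral>\<^sup>+u. ennreal (k t x u * f u) * indicator {u. norm (x - u) * (1 + norm x) \<le> 1} u \<partial>\<mu>) \<le> ennreal (A * l)"
    if f [measurable]: "f \<in> borel_measurable borel" and f0: "\<And>u. 0 \<le> f u" and l: "l > 0" and t: "0 < t" "t \<le> 1"
      and hyp: "\<And>\<rho>. 0 < \<rho> \<Longrightarrow> \<rho> * (1 + norm x) \<le> 1 \<Longrightarrow>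
        (\<integral>\<^sup>+u. ennreal (f u) * indicator (cball x \<rho>) u \<partial>\<mu>) \<le> ennreal (l * (exp (R x) * \<rho> ^ ?n))"
    for f l x t
  proof -
    define s m where "s = sqrt t" and "m = 1 + norm x"
    have s: "s > 0" and m: "m > 0" using t by (auto simp: s_def m_def add_pos_nonneg)
    \<comment> \<open>Only radii up to \<open>1 / m\<close> are admissible in the hypothesis. The
      cap is harmless: all points considered lie within \<open>1 / m\<close> of \<open>x\<close>,
      and a smaller radius in the denominator only enlarges the coefficient
      \<open>b j\<close>.\<close>
    define r where "r = (\<lambda>j. min (2 ^ j * s) (1 / m))"
    have r: "r j > 0" "r j * m \<le> 1" for j using s m by (auto simp: r_def min_def field_simps)
    define b where "b = (\<lambda>j. A1 * exp (- R x) * (2 ^ (?n + 1) * (1 / 2) ^ j / r j ^ ?n))"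
    have b: "b j \<ge> 0" for j using A1 r(1)[of j] by (simp add: b_def)
    have pt: "ennreal (k t x u * f u) * indicator {u. norm (x - u) * (1 + norm x) \<le> 1} u
        \<le> (\<Sum>j. ennreal (b j) * (ennreal (f u) * indicator (cball x (r j)) u))" for u
    proof (cases "norm (x - u) * (1 + norm x) \<le> 1")
      case True
      define h where "h = (\<lambda>j. ennreal (b j) * (ennreal (f u) * indicator (cball x (r j)) u))"
      obtain j where j: "norm (x - u) \<le> 2 ^ j * s"
        "s / (s + norm (x - u)) ^ (?n + 1) \<le> 2 ^ (?n + 1) * (1 / 2) ^ j / (2 ^ j * s) ^ ?n"
        using dyadic_rational_bound[OF s, of "norm (x - u)" ?n] by auto
      have "k t x u \<le> A1 * exp (- R x) * (s / (s + norm (x - u)) ^ (?n + 1))"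
        using local_kernel_bound[OF t True] by (simp add: A1_def s_def)
      also have "\<dots> \<le> A1 * exp (- R x) * (2 ^ (?n + 1) * (1 / 2) ^ j / (2 ^ j * s) ^ ?n)"
        using j(2) A1 by (intro mult_left_mono) auto
      also have "\<dots> \<le> b j"
        unfolding b_def using A1 r(1)[of j] s
        by (intro mult_left_mono divide_left_mono power_mono mult_pos_pos zero_less_power) (auto simp: r_def)
      finally have kb: "k t x u \<le> b j" .
      have "norm (x - u) \<le> 1 / m" using True m by (simp add: m_def field_simps)
      then have "u \<in> cball x (r j)" using j(1) by (simp add: r_def dist_norm)
      then have "ennreal (k t x u * f u) * indicator {u. norm (x - u) * (1 + norm x) \<le> 1} u \<le> h j"
        using True kb b f0 by (simp add: h_def ennreal_mult[symmetric] mult_right_mono ennreal_leI)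
      also have "\<dots> = (\<Sum>i\<in>{j}. h i)" by simp
      also have "\<dots> \<le> (\<Sum>j. h j)" by (rule sum_le_suminf) auto
      finally show ?thesis by (simp only: h_def)
    qed simp
    have "(\<integral>\<^sup>+u. ennreal (k t x u * f u) * indicator {u. norm (x - u) * (1 + norm x) \<le> 1} u \<partial>\<mu>)
        \<le> (\<integral>\<^sup>+u. (\<Sum>j. ennreal (b j) * (ennreal (f u) * indicator (cball x (r j)) u)) \<partial>\<mu>)"
      by (intro nn_integral_mono pt)
    also have "\<dots> = (\<Sum>j. \<integral>\<^sup>+u. ennreal (b j) * (ennreal (f u) * indicator (cball x (r j)) u) \<partial>\<mu>)"
      by (rule nn_integral_suminf)
        (intro borel_measurable_times_ennreal borel_measurable_const borel_measurable_indicator, auto simp: sets_\<mu>)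
    also have "\<dots> = (\<Sum>j. ennreal (b j) * (\<integral>\<^sup>+u. ennreal (f u) * indicator (cball x (r j)) u \<partial>\<mu>))"
      by (intro suminf_cong nn_integral_cmult borel_measurable_times_ennreal borel_measurable_indicator) (auto simp: sets_\<mu>)
    also have "\<dots> \<le> (\<Sum>j. ennreal ((A1 * 2 ^ (?n + 1) * l) * (1 / 2) ^ j))"
    proof (rule suminf_le)
      fix j
      have "ennreal (b j) * (\<integral>\<^sup>+u. ennreal (f u) * indicator (cball x (r j)) u \<partial>\<mu>)
          \<le> ennreal (b j) * ennreal (l * (exp (R x) * r j ^ ?n))"
        using hyp[OF r(1)[of j]] r(2)[of j] by (intro mult_left_mono) (auto simp: m_def)
      also have "\<dots> = ennreal (b j * (l * (exp (R x) * r j ^ ?n)))"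
        using b l r(1)[of j] by (simp add: ennreal_mult)
      also have "b j * (l * (exp (R x) * r j ^ ?n)) = (A1 * 2 ^ (?n + 1) * l) * (1 / 2) ^ j"
      proof -
        have "b j * (l * (exp (R x) * r j ^ ?n)) =
            ((A1 * 2 ^ (?n + 1) * l) * (1 / 2) ^ j) * (exp (- R x) * exp (R x)) * (r j ^ ?n * inverse (r j ^ ?n))"
          unfolding b_def by (simp only: divide_inverse mult_ac)
        also have "exp (- R x) * exp (R x) = 1" by (simp add: exp_add[symmetric])
        also have "r j ^ ?n * inverse (r j ^ ?n) = 1" using r(1)[of j] by simp
        finally show ?thesis by simp
      qed
      finally show "ennreal (b j) * (\<integral>\<^sup>+u. ennreal (f u) * indicator (cball x (r j)) u \<partial>\<mu>) \<le> ennreal ((A1 * 2 ^ (?n + 1) * l) * (1 / 2) ^ j)" .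
    qed auto
    also have "\<dots> = ennreal (\<Sum>j. (A1 * 2 ^ (?n + 1) * l) * (1 / 2) ^ j)"
      using A1 l by (intro suminf_ennreal2 summable_mult summable_geometric) auto
    also have "(\<Sum>j. (A1 * 2 ^ (?n + 1) * l) * (1 / 2) ^ j) = A * l"
      by (subst suminf_mult) (auto simp: suminf_geometric summable_geometric A_def)
    finally show ?thesis .
  qed
  then show ?thesis using A by blast
qed

end

section \<open>The global part\<close>

lemma nn_integral_exp_tail:
  fixes b a :: real
  assumes b: "b > 0"
  shows "(\<integral>\<^sup>+x. ennreal (exp (- b * (x - a))) * indicator {a..} x \<partial>lborel) = ennreal (1 / b)"
proof -
  have "(\<integral>\<^sup>+x. ennreal (exp (- b * (x - a))) * indicator {a..} x \<partial>lborel) = ennreal (0 - (- (1 / b) * exp (- b * (a - a))))"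
  proof (rule nn_integral_FTC_atLeast[where F = "\<lambda>x. - (1 / b) * exp (- b * (x - a))" and T = 0])
    show "((\<lambda>x. - (1 / b) * exp (- b * (x - a))) \<longlongrightarrow> 0) at_top"
    proof -
      have "LIM x at_top. x - a :> at_top"
        using filterlim_tendsto_add_at_top[of "\<lambda>_. - a" "- a" at_top "\<lambda>x. x"]
        by (simp add: filterlim_ident)
      then have "LIM x at_top. b * (x - a) :> at_top"
        using b by (intro filterlim_tendsto_pos_mult_at_top[of "\<lambda>_. b" b]) auto
      then have "LIM x at_top. - (b * (x - a)) :> at_bot" by (simp add: filterlim_uminus_at_bot)
      then have "((\<lambda>x. exp (- (b * (x - a)))) \<longlongrightarrow> 0) at_top"
        by (rule filterlim_compose[OF exp_at_bot])
      then show ?thesis by (intro tendsto_mult_right_zero) simp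
    qed
    fix x :: real
    show "((\<lambda>x. - (1 / b) * exp (- b * (x - a))) has_real_derivative exp (- b * (x - a))) (at x)"
      using b by (auto intro!: derivative_eq_intros simp: field_simps)
  qed auto
  then show ?thesis by simp
qed

lemma ennreal_le_nn_integral_window:
  fixes f :: "real \<Rightarrow> real"
  assumes "\<eta> \<ge> 0" "v \<ge> 0" and le: "\<And>x. a \<le> x \<Longrightarrow> x \<le> a + \<eta> \<Longrightarrow> v \<le> f x"
    and sub: "{a..a + \<eta>} \<subseteq> I"
  shows "ennreal (\<eta> * v) \<le> (\<integral>\<^sup>+x. ennreal (f x) * indicator I x \<partial>lborel)"
proof -
  have "ennreal (\<eta> * v) = (\<integral>\<^sup>+x. ennreal v * indicator {a..a + \<eta>} x \<partial>lborel)"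
    using assms(1,2) by (simp add: nn_integral_cmult_indicator ennreal_mult mult.commute)
  also have "\<dots> \<le> (\<integral>\<^sup>+x. ennreal (f x) * indicator I x \<partial>lborel)"
    using le sub by (intro nn_integral_mono) (auto simp: indicator_def intro: ennreal_leI)
  finally show ?thesis .
qed

context ou_kernel
begin

section \<open>Time-independent majorants of the kernel along orbits\<close>

lemma D_inv: "D (- s) *v (D s *v x) = x" "D s *v (D (- s) *v x) = x"
  unfolding matrix_vector_mul_assoc D_add[symmetric] by (simp_all add: D_0)

lemma D_comp: "D s *v (D t *v x) = D (s + t) *v x"
  by (simp add: matrix_vector_mul_assoc D_add)

lemma D_lower: "\<bar>s\<bar> \<le> 1 \<Longrightarrow> norm x \<le> C * norm (D s *v x)"
  using D_bound[of "- s" "D s *v x"] by (simp add: D_inv)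

lemma measurable_D [measurable (raw)]:
  assumes "f \<in> borel_measurable M" "g \<in> borel_measurable M"
  shows "(\<lambda>x. D (f x) *v g x) \<in> borel_measurable M"
proof -
  have "continuous_on UNIV (\<lambda>p. D (fst p) *v snd p)"
    by (intro bounded_bilinear.continuous_on[OF bounded_bilinear_matrix_vector_mult]
        continuous_on_compose2[OF cont_D] continuous_on_fst continuous_on_snd continuous_on_id) auto
  from measurable_compose[OF borel_measurable_Pair[OF assms] borel_measurable_continuous_onI[OF this]]
  show ?thesis by simp
qed

text \<open>Substitute for the supremum over \<open>\<tau>\<close> of
  \<open>(1 / M + |z - D \<tau> u|)^(-n)\<close> with \<open>M = 1 + |z|\<close>. The factor
  \<open>M\<close> and the extra power compensate the window length. The interval reaches
  \<open>3\<close>, since \<open>t + \<sigma>\<close> may be \<open>2\<close> and a window has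
  length at most \<open>1\<close>. The first summand covers points \<open>D \<tau> u\<close> farther
  than \<open>M\<close> from \<open>z\<close>.\<close>

definition g1 :: "real^'n \<Rightarrow> real^'n \<Rightarrow> ennreal" where
  "g1 z u = ennreal (1 / (1 + norm z) ^ CARD('n)) +
     (\<integral>\<^sup>+\<tau>. ennreal ((1 + norm z) / (1 / (1 + norm z) + norm (z - D \<tau> *v u)) ^ (CARD('n) + 1)) * indicator {0..3} \<tau> \<partial>lborel)"

text \<open>The analogue for large times; the factor \<open>1 + |D (- \<tau>) z|\<close> is the
  reciprocal of the window length.\<close>

definition g2 :: "real^'n \<Rightarrow> real^'n \<Rightarrow> ennreal" where
  "g2 z u = (\<integral>\<^sup>+\<tau>. ennreal ((1 + norm (D (- \<tau>) *v z)) * exp (- \<theta> * \<tau>) / (1 + norm (D (- \<tau>) *v z - u)) ^ (CARD('n) + 1)) * indicator {1..} \<tau> \<partial>lborel)"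

lemma measurable_g1 [measurable (raw)]:
  assumes [measurable]: "f \<in> borel_measurable M" "h \<in> borel_measurable M"
  shows "(\<lambda>x. g1 (f x) (h x)) \<in> borel_measurable M"
  unfolding g1_def by measurable

lemma measurable_g2 [measurable (raw)]:
  assumes [measurable]: "f \<in> borel_measurable M" "h \<in> borel_measurable M"
  shows "(\<lambda>x. g2 (f x) (h x)) \<in> borel_measurable M"
  unfolding g2_def by measurable

text \<open>A supremum over the time parameter is dominated by an integral over a short time window,
  because the polynomial kernel is essentially constant there.\<close>

lemma g1_lower:
  assumes \<tau>: "0 \<le> \<tau>" "\<tau> \<le> 2"
  shows "ennreal (1 / (1 / (1 + norm z) + norm (z - D \<tau> *v u)) ^ CARD('n)) \<le> ennreal (2 * (1 + C) ^ (CARD('n) + 1)) * g1 z u"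
proof -
  let ?n = "CARD('n)"
  define M d where "M = 1 + norm z" and "d = norm (z - D \<tau> *v u)"
  have M: "M \<ge> 1" by (simp add: M_def)
  have d: "d \<ge> 0" by (simp add: d_def)
  define I where "I = (\<integral>\<^sup>+\<tau>. ennreal (M / (1 / M + norm (z - D \<tau> *v u)) ^ (?n + 1)) * indicator {0..3} \<tau> \<partial>lborel)"
  have g1: "g1 z u = ennreal (1 / M ^ ?n) + I" by (simp add: g1_def M_def I_def)
  have A: "1 \<le> 2 * (1 + C) ^ (?n + 1)"
  proof -
    have "1 \<le> (1 + C) ^ (?n + 1)" using C by (intro one_le_power) auto
    then show ?thesis by simp
  qed
  show ?thesis
  proof (cases "d \<le> M")
    case True
    \<comment> \<open>Here \<open>|D \<tau> u| \<le> 2 M\<close>, so during a time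
      \<open>\<eta>\<close> this point moves by at most \<open>C \<eta> 2 M = C (1 / M + d)\<close>,
      comparable to the quantity being estimated.\<close>
    define \<eta> where "\<eta> = (1 / M + d) / (2 * M)"
    have pos: "0 < 1 / M + d" using M d by (simp add: add_pos_nonneg)
    have "1 / M + d \<le> 2 * M"
    proof -
      have "1 / M \<le> M" using M mult_mono[of 1 M 1 M] by (simp add: divide_le_eq)
      then show ?thesis using True by simp
    qed
    then have \<eta>: "0 < \<eta>" "\<eta> \<le> 1" using pos M by (auto simp: \<eta>_def divide_le_eq)
    define v where "v = M / ((1 + C) * (1 / M + d)) ^ (?n + 1)"
    have "v \<le> M / (1 / M + norm (z - D \<tau>' *v u)) ^ (?n + 1)" if \<tau>': "\<tau> \<le> \<tau>'" "\<tau>' \<le> \<tau> + \<eta>" for \<tau>'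
    proof -
      have "norm (D \<tau> *v u) \<le> norm z + d"
        using norm_triangle_ineq4[of z "z - D \<tau> *v u"] by (simp add: d_def)
      also have "\<dots> \<le> 2 * M" using True by (simp add: M_def)
      finally have nu: "norm (D \<tau> *v u) \<le> 2 * M" .
      have "D \<tau>' *v u = D (\<tau>' - \<tau>) *v (D \<tau> *v u)" by (simp add: D_comp)
      then have "norm (D \<tau>' *v u - D \<tau> *v u) \<le> C * \<bar>\<tau>' - \<tau>\<bar> * norm (D \<tau> *v u)"
        using D_near[of "\<tau>' - \<tau>" "D \<tau> *v u"] \<tau>' \<eta> by simp
      also have "\<dots> \<le> C * \<eta> * (2 * M)"
        using C \<tau>' nu M \<eta> by (intro mult_mono mult_left_mono) auto
      also have "\<dots> = C * (1 / M + d)" using M by (simp add: \<eta>_def)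
      finally have "norm (z - D \<tau>' *v u) \<le> d + C * (1 / M + d)"
        using norm_triangle_ineq[of "z - D \<tau> *v u" "D \<tau> *v u - D \<tau>' *v u"]
        by (simp add: d_def norm_minus_commute)
      moreover have "(1 + C) * (1 / M + d) = 1 / M + (d + C * (1 / M + d))"
        by (simp only: distrib_right mult_1 add.assoc)
      ultimately have "1 / M + norm (z - D \<tau>' *v u) \<le> (1 + C) * (1 / M + d)"
        by (simp only: add_le_cancel_left)
      moreover have "0 < 1 / M + norm (z - D \<tau>' *v u)" using M by (intro add_pos_nonneg) auto
      ultimately show ?thesis unfolding v_def using M C pos
        by (intro divide_left_mono power_mono mult_pos_pos zero_less_power) auto
    qed
    then have W: "ennreal (\<eta> * v) \<le> I" unfolding I_def
      using \<eta> M C pos \<tau> by (intro ennreal_le_nn_integral_window[where a = \<tau>]) (auto simp: v_def)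
    have eq: "1 / (1 / M + d) ^ ?n = 2 * (1 + C) ^ (?n + 1) * (\<eta> * v)"
    proof -
      have "\<eta> * v = (1 / M + d) * (1 / ((1 + C) ^ (?n + 1) * ((1 / M + d) * (1 / M + d) ^ ?n))) / 2"
        using M by (simp add: \<eta>_def v_def power_mult_distrib)
      then show ?thesis using pos C by simp
    qed
    have "0 \<le> \<eta> * v" using \<eta> M C pos by (simp add: v_def)
    then have "ennreal (1 / (1 / M + d) ^ ?n) = ennreal (2 * (1 + C) ^ (?n + 1)) * ennreal (\<eta> * v)"
      unfolding eq using C by (intro ennreal_mult) auto
    also have "\<dots> \<le> ennreal (2 * (1 + C) ^ (?n + 1)) * I" by (intro mult_left_mono W) auto
    also have "\<dots> \<le> ennreal (2 * (1 + C) ^ (?n + 1)) * g1 z u" unfolding g1 by (intro mult_left_mono) auto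
    finally show ?thesis by (simp add: M_def d_def)
  next
    case False
    have "1 / (1 / M + d) ^ ?n \<le> 1 / M ^ ?n"
      using False M by (intro divide_left_mono power_mono mult_pos_pos zero_less_power add_pos_nonneg) (auto simp: add_increasing)
    then have "ennreal (1 / (1 / M + d) ^ ?n) \<le> ennreal (1 / M ^ ?n)" by (rule ennreal_leI)
    also have "\<dots> \<le> 1 * g1 z u" unfolding g1 by simp
    also have "\<dots> \<le> ennreal (2 * (1 + C) ^ (?n + 1)) * g1 z u"
      using ennreal_leI[OF A] by (intro mult_right_mono) auto
    finally show ?thesis by (simp add: M_def d_def)
  qed
qed

text \<open>During a time \<open>1 / (1 + |w|)\<close> the point \<open>w = D (- \<tau>) z\<close>
  moves by at most \<open>C\<close>, and every factor of the integrand changes by a bounded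
  ratio.\<close>

lemma g2_lower:
  assumes \<tau>: "1 \<le> \<tau>"
  shows "ennreal (exp (- \<theta> * \<tau>) / (1 + norm (D (- \<tau>) *v z - u)) ^ (CARD('n) + 1)) \<le> ennreal (exp \<bar>\<theta>\<bar> * (1 + C) ^ (CARD('n) + 2)) * g2 z u"
proof -
  let ?n = "CARD('n)"
  define w where "w = D (- \<tau>) *v z"
  define \<eta> where "\<eta> = 1 / (1 + norm w)"
  have wpos: "0 < 1 + norm w" "0 < 1 + norm (w - u)" by (auto intro: add_pos_nonneg)
  have \<eta>: "0 < \<eta>" "\<eta> \<le> 1" using wpos by (auto simp: \<eta>_def)
  have C1: "0 < 1 + C" using C by simp
  define v where "v = (1 + norm w) / (1 + C) * (exp (- \<bar>\<theta>\<bar>) * exp (- \<theta> * \<tau>)) / ((1 + C) * (1 + norm (w - u))) ^ (?n + 1)"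
  have "v \<le> (1 + norm (D (- \<tau>') *v z)) * exp (- \<theta> * \<tau>') / (1 + norm (D (- \<tau>') *v z - u)) ^ (?n + 1)"
    if \<tau>': "\<tau> \<le> \<tau>'" "\<tau>' \<le> \<tau> + \<eta>" for \<tau>'
  proof -
    define w' where "w' = D (- \<tau>') *v z"
    have "w' = D (- (\<tau>' - \<tau>)) *v w" by (simp add: w_def w'_def D_comp)
    then have "norm (w' - w) \<le> C * \<bar>- (\<tau>' - \<tau>)\<bar> * norm w"
      using D_near[of "- (\<tau>' - \<tau>)" w] \<tau>' \<eta> by simp
    also have "\<dots> \<le> C * \<eta> * norm w" using C \<tau>' by (intro mult_right_mono mult_left_mono) auto
    also have "\<dots> \<le> C" using C wpos by (simp add: \<eta>_def divide_le_eq)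
    finally have ww: "norm (w' - w) \<le> C" .
    have "norm w \<le> norm w' + C" using norm_triangle_ineq4[of w' "w' - w"] ww by simp
    moreover have "0 \<le> C * norm w'" using C by simp
    ultimately have "norm w \<le> C + (norm w' + C * norm w')" by linarith
    then have 1: "(1 + norm w) / (1 + C) \<le> 1 + norm w'"
      using C1 by (simp add: divide_le_eq distrib_left distrib_right mult.commute)
    have "norm (w' - u) \<le> norm (w - u) + C" using norm_triangle_ineq[of "w' - w" "w - u"] ww by simp
    moreover have "0 \<le> C * norm (w - u)" using C by simp
    ultimately have 2: "1 + norm (w' - u) \<le> (1 + C) * (1 + norm (w - u))"
      by (simp add: distrib_left distrib_right)
    have "\<theta> * (\<tau>' - \<tau>) \<le> \<bar>\<theta>\<bar> * (\<tau>' - \<tau>)" using \<tau>' by (intro mult_right_mono) auto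
    also have "\<dots> \<le> \<bar>\<theta>\<bar> * 1" using \<tau>' \<eta> by (intro mult_left_mono) auto
    finally have 3: "exp (- \<bar>\<theta>\<bar>) * exp (- \<theta> * \<tau>) \<le> exp (- \<theta> * \<tau>')"
      by (simp add: exp_add[symmetric] algebra_simps)
    have "0 < 1 + norm (w' - u)" by (intro add_pos_nonneg) auto
    then show ?thesis
      unfolding v_def w'_def[symmetric] using 1 2 3 C1 wpos
      by (intro frac_le mult_mono power_mono zero_less_power) (auto intro: mult_nonneg_nonneg)
  qed
  then have "ennreal (\<eta> * v) \<le> g2 z u" unfolding g2_def
    using \<eta> wpos C1 \<tau> by (intro ennreal_le_nn_integral_window[where a = \<tau>]) (auto simp: v_def)
  moreover have "exp (- \<theta> * \<tau>) / (1 + norm (w - u)) ^ (?n + 1) = exp \<bar>\<theta>\<bar> * (1 + C) ^ (?n + 2) * (\<eta> * v)"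
  proof -
    have "exp \<bar>\<theta>\<bar> * exp (- \<bar>\<theta>\<bar>) = 1" by (simp add: exp_add[symmetric])
    moreover have "(1 + C) ^ (?n + 2) = (1 + C) * (1 + C) ^ (?n + 1)" by simp
    moreover have "e * (c1 * q) * (1 / W * (W / c1 * (e' * x) / (q * r))) = (e * e') * (x / r)"
      if "c1 \<noteq> 0" "q \<noteq> 0" "W \<noteq> 0" for e e' c1 q W x r :: real
      using that by simp
    ultimately show ?thesis
      unfolding \<eta>_def v_def power_mult_distrib using C1 wpos by simp
  qed
  moreover have "0 \<le> \<eta> * v" using \<eta> wpos C1 by (simp add: v_def)
  ultimately show ?thesis
    using C1 by (simp add: ennreal_mult w_def mult_left_mono)
qed

text \<open>Since \<open>D \<sigma> (x - D t u) = z - D (t + \<sigma>) u\<close> for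
  \<open>z = D \<sigma> x\<close>, moving along the orbit only shifts the time variable, which
  \<open>g1\<close> has integrated out. Being outside the local region forces
  \<open>sqrt t + |x - D t u|\<close> to be at least of order \<open>1 / (1 + |x|)\<close>; this
  accounts for the scale \<open>1 / (1 + |z|)\<close> in \<open>g1\<close>.\<close>

lemma global_majorant_small:
  assumes t: "0 < t" "t \<le> 1" and \<sigma>: "0 \<le> \<sigma>" "\<sigma> \<le> 1"
    and glob: "norm (x - u) * (1 + norm x) > 1"
  shows "ennreal (exp (R x) * k t x u) \<le> ennreal (C * (8 * C ^ 3) ^ CARD('n) * (2 * (1 + C) ^ (CARD('n) + 1))) * g1 (D \<sigma> *v x) u"
proof -
  let ?n = "CARD('n)"
  define m y z where "m = 1 + norm x" and "y = norm (x - D t *v u)" and "z = D \<sigma> *v x"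
  have m: "m \<ge> 1" by (simp add: m_def)
  have y: "y \<ge> 0" by (simp add: y_def)
  have C2: "C\<^sup>2 \<ge> 1" using C by (rule one_le_power)
  \<comment> \<open>Chosen so that \<open>a (1 + 2 C^2) \<le> 1\<close>, as the contradiction below
    requires.\<close>
  define a where "a = 1 / (4 * C\<^sup>2)"
  have a: "0 < a" "a \<le> 1 / 4" using C2 by (auto simp: a_def divide_le_eq)
  \<comment> \<open>If \<open>u\<close> were carried so close to \<open>x\<close> in so short a
    time, then \<open>u\<close> itself would lie within \<open>1 / m\<close> of \<open>x\<close>,
    contrary to the global assumption.\<close>
  have alt: "y \<ge> a / m \<or> t \<ge> a / m\<^sup>2"
  proof (rule ccontr)
    assume "\<not> ?thesis"
    then have ym: "y < a / m" and tm: "t < a / m\<^sup>2" by auto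
    have "norm u \<le> C * norm (D t *v u)" using t by (intro D_lower) auto
    also have "\<dots> \<le> C * (norm x + y)"
      using C norm_triangle_ineq4[of x "x - D t *v u"] by (intro mult_left_mono) (auto simp: y_def)
    finally have u: "norm u \<le> C * (norm x + y)" .
    have "norm (x - u) \<le> y + norm (D t *v u - u)"
      using norm_triangle_ineq[of "x - D t *v u" "D t *v u - u"] by (simp add: y_def)
    also have "norm (D t *v u - u) \<le> C * t * norm u" using D_near[of t u] t by simp
    also have "C * t * norm u \<le> C * t * (C * (norm x + y))" using C t u by (intro mult_left_mono) auto
    also have "C * t * (C * (norm x + y)) = C\<^sup>2 * (t * norm x) + C\<^sup>2 * (t * y)"
      by (simp add: power2_eq_square algebra_simps)
    also have "\<dots> \<le> C\<^sup>2 * (t * m) + C\<^sup>2 * (1 * y)"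
      using C2 t y by (intro add_mono mult_left_mono mult_right_mono) (auto simp: m_def)
    finally have "norm (x - u) \<le> y + (C\<^sup>2 * (t * m) + C\<^sup>2 * y)" by simp
    also have "\<dots> \<le> a / m + (C\<^sup>2 * (a / m\<^sup>2 * m) + C\<^sup>2 * (a / m))"
      using ym tm C2 m by (intro add_mono mult_left_mono mult_right_mono) auto
    also have "\<dots> = a * (1 + 2 * C\<^sup>2) / m" using m by (simp add: power2_eq_square field_simps)
    also have "\<dots> \<le> 1 / m"
      using m C2 by (intro divide_right_mono) (auto simp: a_def divide_le_eq)
    finally have "norm (x - u) * m \<le> 1" using m by (simp add: field_simps)
    then show False using glob by (simp add: m_def)
  qed
  have low: "a / 2 * (1 / m + y) \<le> sqrt t + y"
  proof (cases "y \<ge> a / m")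
    case True
    have "a / 2 * (1 / m + y) = (a / m) / 2 + a / 2 * y" by (simp add: distrib_left)
    also have "\<dots> \<le> y / 2 + 1 / 2 * y" using True a y by (intro add_mono mult_right_mono) auto
    also have "\<dots> \<le> sqrt t + y" using t by simp
    finally show ?thesis .
  next
    case False
    then have tm: "t \<ge> a / m\<^sup>2" using alt by simp
    have "a * a \<le> a * 1" using a by (intro mult_left_mono) auto
    then have "(a / m)\<^sup>2 \<le> a / m\<^sup>2" by (simp add: power_divide power2_eq_square divide_right_mono)
    then have "(a / m)\<^sup>2 \<le> t" using tm by simp
    then have "a / m \<le> sqrt t" by (rule real_le_rsqrt)
    moreover have "0 < a / m" using a m by simp
    ultimately have "(a / m) / 2 + a / 2 * y \<le> sqrt t + 1 * y"
      using a y by (intro add_mono mult_right_mono) auto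
    moreover have "a / 2 * (1 / m + y) = (a / m) / 2 + a / 2 * y" by (simp add: distrib_left)
    ultimately show ?thesis by simp
  qed
  have mz: "m \<le> C * (1 + norm z)" using D_lower[of \<sigma> x] \<sigma> C by (simp add: m_def z_def distrib_left)
  have dz: "norm (z - D (t + \<sigma>) *v u) \<le> C * y"
  proof -
    have "z - D (t + \<sigma>) *v u = D \<sigma> *v (x - D t *v u)"
      by (simp add: z_def matrix_vector_mult_diff_distrib D_comp add.commute)
    then show ?thesis using D_bound[of \<sigma> "x - D t *v u"] \<sigma> by (simp add: y_def)
  qed
  \<comment> \<open>The denominator of \<open>g1\<close> at time \<open>t + \<sigma>\<close>; the
    factor \<open>8 C^3\<close> below is \<open>2 C / a\<close>.\<close>
  define q where "q = 1 / (1 + norm z) + norm (z - D (t + \<sigma>) *v u)"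
  have z1: "0 < 1 + norm z" by (intro add_pos_nonneg) auto
  have q: "0 < q" unfolding q_def using z1 by (intro add_pos_nonneg) auto
  have "q \<le> C * (1 / m + y)"
  proof -
    have "1 / (1 + norm z) \<le> C / m" using mz m z1 by (simp add: field_simps)
    then show ?thesis using dz by (simp add: q_def distrib_left)
  qed
  then have "a / (2 * C) * q \<le> a / (2 * C) * (C * (1 / m + y))" using a C by (intro mult_left_mono) auto
  also have "\<dots> = a / 2 * (1 / m + y)" using C by simp
  also have "\<dots> \<le> sqrt t + y" by (rule low)
  finally have "a / (2 * C) * q \<le> sqrt t + y" .
  moreover have "a / (2 * C) = 1 / (8 * C ^ 3)" by (simp add: a_def power2_eq_square power3_eq_cube)
  ultimately have lq: "1 / (8 * C ^ 3) * q \<le> sqrt t + y" by simp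
  have C3: "8 * C ^ 3 > 0" using C by simp
  have "exp (R x) * k t x u \<le> exp (R x) * (C * exp (- R x) / (sqrt t + y) ^ ?n)"
    unfolding y_def by (intro mult_left_mono K1 t) auto
  also have "\<dots> = C / (sqrt t + y) ^ ?n" by (simp add: exp_minus)
  also have "\<dots> \<le> C / (1 / (8 * C ^ 3) * q) ^ ?n"
    using C lq q t y C3 by (intro divide_left_mono power_mono mult_pos_pos zero_less_power) (auto intro: add_pos_nonneg)
  also have "\<dots> = C * (8 * C ^ 3) ^ ?n * (1 / q ^ ?n)" by (simp add: power_mult_distrib power_divide)
  finally have "ennreal (exp (R x) * k t x u) \<le> ennreal (C * (8 * C ^ 3) ^ ?n * (1 / q ^ ?n))" by (rule ennreal_leI)
  also have "\<dots> = ennreal (C * (8 * C ^ 3) ^ ?n) * ennreal (1 / q ^ ?n)"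
    using C q by (intro ennreal_mult) auto
  also have "\<dots> \<le> ennreal (C * (8 * C ^ 3) ^ ?n) * (ennreal (2 * (1 + C) ^ (?n + 1)) * g1 z u)"
    unfolding q_def using t \<sigma> by (intro mult_left_mono g1_lower) auto
  also have "\<dots> = ennreal (C * (8 * C ^ 3) ^ ?n * (2 * (1 + C) ^ (?n + 1))) * g1 z u"
  proof -
    have "ennreal (C * (8 * C ^ 3) ^ ?n * (2 * (1 + C) ^ (?n + 1))) = ennreal (C * (8 * C ^ 3) ^ ?n) * ennreal (2 * (1 + C) ^ (?n + 1))"
      using C by (intro ennreal_mult) auto
    then show ?thesis by (simp only: mult.assoc)
  qed
  finally show ?thesis by (simp add: z_def)
qed

text \<open>The time shift by \<open>\<sigma>\<close> costs only the bounded factor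
  \<open>exp \<bar>\<theta>\<bar>\<close>. No local region has to be removed here.\<close>

lemma global_majorant_large:
  assumes t: "1 \<le> t" and \<sigma>: "0 \<le> \<sigma>" "\<sigma> \<le> 1"
  shows "ennreal (exp (R x) * k t x u) \<le> ennreal (C * exp \<bar>\<theta>\<bar> * (exp \<bar>\<theta>\<bar> * (1 + C) ^ (CARD('n) + 2))) * g2 (D \<sigma> *v x) u"
proof -
  let ?n = "CARD('n)"
  define z where "z = D \<sigma> *v x"
  define w where "w = D (- (t + \<sigma>)) *v z"
  have w: "D (- t) *v x = w" by (simp add: w_def z_def D_comp)
  have wpos: "0 < 1 + norm (w - u)" by (intro add_pos_nonneg) auto
  have "\<theta> * \<sigma> \<le> \<bar>\<theta>\<bar> * \<sigma>" using \<sigma> by (intro mult_right_mono) auto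
  also have "\<dots> \<le> \<bar>\<theta>\<bar> * 1" using \<sigma> by (intro mult_left_mono) auto
  finally have e: "exp (- \<theta> * t) \<le> exp \<bar>\<theta>\<bar> * exp (- \<theta> * (t + \<sigma>))"
    by (simp add: exp_add[symmetric] algebra_simps)
  have "exp (R x) * k t x u \<le> exp (R x) * (C * exp (- R x) * exp (- \<theta> * t) / (1 + norm (D (- t) *v x - u)) ^ (?n + 1))"
    by (intro mult_left_mono K3 t) auto
  also have "\<dots> = C * exp (- \<theta> * t) / (1 + norm (w - u)) ^ (?n + 1)" unfolding w by (simp add: exp_minus)
  also have "\<dots> \<le> C * (exp \<bar>\<theta>\<bar> * exp (- \<theta> * (t + \<sigma>))) / (1 + norm (w - u)) ^ (?n + 1)"
    using C wpos e by (intro divide_right_mono mult_left_mono) auto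
  also have "\<dots> = (C * exp \<bar>\<theta>\<bar>) * (exp (- \<theta> * (t + \<sigma>)) / (1 + norm (w - u)) ^ (?n + 1))" by simp
  finally have "ennreal (exp (R x) * k t x u) \<le> ennreal ((C * exp \<bar>\<theta>\<bar>) * (exp (- \<theta> * (t + \<sigma>)) / (1 + norm (w - u)) ^ (?n + 1)))"
    by (rule ennreal_leI)
  also have "\<dots> = ennreal (C * exp \<bar>\<theta>\<bar>) * ennreal (exp (- \<theta> * (t + \<sigma>)) / (1 + norm (w - u)) ^ (?n + 1))"
    using C wpos by (intro ennreal_mult) auto
  also have "\<dots> \<le> ennreal (C * exp \<bar>\<theta>\<bar>) * (ennreal (exp \<bar>\<theta>\<bar> * (1 + C) ^ (?n + 2)) * g2 z u)"
    unfolding w_def using t \<sigma> by (intro mult_left_mono g2_lower) auto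
  also have "\<dots> = ennreal (C * exp \<bar>\<theta>\<bar> * (exp \<bar>\<theta>\<bar> * (1 + C) ^ (?n + 2))) * g2 z u"
  proof -
    have "ennreal (C * exp \<bar>\<theta>\<bar> * (exp \<bar>\<theta>\<bar> * (1 + C) ^ (?n + 2))) = ennreal (C * exp \<bar>\<theta>\<bar>) * ennreal (exp \<bar>\<theta>\<bar> * (1 + C) ^ (?n + 2))"
      using C by (intro ennreal_mult) auto
    then show ?thesis by (simp only: mult.assoc)
  qed
  finally show ?thesis by (simp add: z_def)
qed

end

text \<open>The scale depends on the integration variable. If \<open>z\<close> is far from
  \<open>p\<close> relative to \<open>1 + |z|\<close>, the kernel is at most a multiple of
  \<open>(1 + |z|)^(-n-1)\<close>; otherwise \<open>1 + |z|\<close> and \<open>1 + |p|\<close> are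
  comparable and the scale may be frozen at \<open>1 / (1 + |p|)\<close>.\<close>

lemma shifted_rational_kernel_integral:
  "\<exists>A\<ge>0. \<forall>p :: real^'n. (\<integral>\<^sup>+z. ennreal ((1 / (1 + norm z)) / (1 / (1 + norm z) + norm (z - p)) ^ (CARD('n) + 1)) \<partial>lborel) \<le> ennreal A"
proof -
  let ?n = "CARD('n)"
  define K where "K = 2 ^ (?n + 2) * unit_ball_vol (real ?n)"
  have K: "K \<ge> 0" by (simp add: K_def)
  have "(\<integral>\<^sup>+z. ennreal ((1 / (1 + norm z)) / (1 / (1 + norm z) + norm (z - p)) ^ (?n + 1)) \<partial>lborel) \<le> ennreal (2 ^ (?n + 2) * (2 * K))"
    for p :: "real^'n"
  proof -
    define s where "s = 1 / (1 + norm p)"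
    have p1: "1 + norm p > 0" by (intro add_pos_nonneg) auto
    have s: "s > 0" using p1 by (simp add: s_def)
    have pt: "(1 / (1 + norm z)) / (1 / (1 + norm z) + norm (z - p)) ^ (?n + 1)
        \<le> 2 ^ (?n + 2) * (1 / (1 + norm (z - 0)) ^ (?n + 1) + s / (s + norm (z - p)) ^ (?n + 1))" for z
    proof -
      define M d where "M = 1 + norm z" and "d = norm (z - p)"
      have M: "M \<ge> 1" and d: "d \<ge> 0" by (simp_all add: M_def d_def)
      have pos: "0 < 1 / M + d" "0 < s + d" using M d s by (auto intro: add_pos_nonneg)
      have nn: "0 \<le> 1 / M ^ (?n + 1)" "0 \<le> s / (s + d) ^ (?n + 1)" using M s pos by auto
      have "(1 / M) / (1 / M + d) ^ (?n + 1) \<le> 2 ^ (?n + 2) * (1 / M ^ (?n + 1) + s / (s + d) ^ (?n + 1))"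
      proof (cases "d \<ge> M / 2")
        case True
        have "(1 / M) / (1 / M + d) ^ (?n + 1) \<le> 1 / (M / 2) ^ (?n + 1)"
          using True M d pos by (intro frac_le power_mono zero_less_power) (auto simp: add_increasing)
        also have "\<dots> = 2 ^ (?n + 1) * (1 / M ^ (?n + 1))" by (simp add: power_divide)
        also have "\<dots> \<le> 2 ^ (?n + 2) * (1 / M ^ (?n + 1) + s / (s + d) ^ (?n + 1))"
          using nn M by (intro mult_mono power_increasing) auto
        finally show ?thesis .
      next
        case False
        have "norm z \<le> norm p + d" using norm_triangle_ineq[of "z - p" p] by (simp add: d_def)
        then have a: "M \<le> 2 * (1 + norm p)" using False by (simp add: M_def)
        have "norm p \<le> norm z + d" using norm_triangle_ineq4[of z "z - p"] by (simp add: d_def)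
        then have "1 + norm p \<le> M + d" by (simp add: M_def)
        then have b: "1 + norm p \<le> 2 * M" using False M by linarith
        have 1: "1 / M \<le> 2 * s" using b M p1 by (simp add: s_def field_simps)
        have 2: "s / 2 \<le> 1 / M" using a M p1 by (simp add: s_def field_simps)
        have "(1 / M) / (1 / M + d) ^ (?n + 1) \<le> (2 * s) / ((s + d) / 2) ^ (?n + 1)"
          using 1 2 M d s pos by (intro frac_le power_mono zero_less_power) (auto simp: add_divide_distrib)
        also have "\<dots> = 2 ^ (?n + 2) * (s / (s + d) ^ (?n + 1))" by (simp add: power_divide)
        also have "\<dots> \<le> 2 ^ (?n + 2) * (1 / M ^ (?n + 1) + s / (s + d) ^ (?n + 1))"
          using nn by (intro mult_left_mono) auto
        finally show ?thesis .
      qed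
      then show ?thesis by (simp add: M_def d_def)
    qed
    have "(\<integral>\<^sup>+z. ennreal ((1 / (1 + norm z)) / (1 / (1 + norm z) + norm (z - p)) ^ (?n + 1)) \<partial>lborel)
        \<le> (\<integral>\<^sup>+z. ennreal (2 ^ (?n + 2)) * (ennreal (1 / (1 + norm (z - 0)) ^ (?n + 1)) + ennreal (s / (s + norm (z - p)) ^ (?n + 1))) \<partial>lborel)"
    proof (rule nn_integral_mono)
      fix z :: "real^'n"
      have "ennreal ((1 / (1 + norm z)) / (1 / (1 + norm z) + norm (z - p)) ^ (?n + 1))
          \<le> ennreal (2 ^ (?n + 2) * (1 / (1 + norm (z - 0)) ^ (?n + 1) + s / (s + norm (z - p)) ^ (?n + 1)))"
        by (rule ennreal_leI[OF pt])
      also have "\<dots> = ennreal (2 ^ (?n + 2)) * ennreal (1 / (1 + norm (z - 0)) ^ (?n + 1) + s / (s + norm (z - p)) ^ (?n + 1))"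
        using s by (intro ennreal_mult) auto
      also have "ennreal (1 / (1 + norm (z - 0)) ^ (?n + 1) + s / (s + norm (z - p)) ^ (?n + 1)) =
          ennreal (1 / (1 + norm (z - 0)) ^ (?n + 1)) + ennreal (s / (s + norm (z - p)) ^ (?n + 1))"
        using s by (intro ennreal_plus) auto
      finally show "ennreal ((1 / (1 + norm z)) / (1 / (1 + norm z) + norm (z - p)) ^ (?n + 1))
          \<le> ennreal (2 ^ (?n + 2)) * (ennreal (1 / (1 + norm (z - 0)) ^ (?n + 1)) + ennreal (s / (s + norm (z - p)) ^ (?n + 1)))" .
    qed
    also have "\<dots> = ennreal (2 ^ (?n + 2)) * ((\<integral>\<^sup>+z. ennreal (1 / (1 + norm (z - 0)) ^ (?n + 1)) \<partial>(lborel :: (real^'n) measure)) +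
        (\<integral>\<^sup>+z. ennreal (s / (s + norm (z - p)) ^ (?n + 1)) \<partial>lborel))"
      by (subst nn_integral_cmult, measurable, subst nn_integral_add) auto
    also have "\<dots> \<le> ennreal (2 ^ (?n + 2)) * (ennreal K + ennreal K)"
      using rational_kernel_integral[OF s, of p] rational_kernel_integral[of 1 "0 :: real^'n"]
      unfolding K_def by (intro mult_left_mono add_mono) simp_all
    also have "\<dots> = ennreal (2 ^ (?n + 2) * (2 * K))"
    proof -
      have "ennreal K + ennreal K = ennreal (2 * K)" using K by (simp add: ennreal_plus[symmetric] del: ennreal_plus)
      moreover have "ennreal (2 ^ (?n + 2) * (2 * K)) = ennreal (2 ^ (?n + 2)) * ennreal (2 * K)"
        using K by (intro ennreal_mult) auto
      ultimately show ?thesis by (simp only:)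
    qed
    finally show ?thesis .
  qed
  then show ?thesis using K by (intro exI[of _ "2 ^ (?n + 2) * (2 * K)"]) auto
qed

section \<open>Integrals of the majorants, and of the density along orbits\<close>

context ou_kernel
begin

text \<open>The weight turns the factor \<open>1 + |z|\<close> of \<open>g1\<close> into its
  reciprocal, which is exactly the scale in the denominator; what remains is the previous integral
  for each of the times in an interval of length \<open>3\<close>.\<close>

lemma g1_integral: "\<exists>A\<ge>0. \<forall>u. (\<integral>\<^sup>+z. ennreal (1 / (1 + norm z)\<^sup>2) * g1 z u \<partial>lborel) \<le> ennreal A"
proof -
  let ?n = "CARD('n)"
  define K where "K = 2 ^ (?n + 2) * unit_ball_vol (real ?n)"
  have K: "K \<ge> 0" by (simp add: K_def)
  obtain J where J: "J \<ge> 0" "\<And>p :: real^'n. (\<integral>\<^sup>+z. ennreal ((1 / (1 + norm z)) / (1 / (1 + norm z) + norm (z - p)) ^ (?n + 1)) \<partial>lborel) \<le> ennreal J"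
    using shifted_rational_kernel_integral by blast
  have "(\<integral>\<^sup>+z. ennreal (1 / (1 + norm z)\<^sup>2) * g1 z u \<partial>lborel) \<le> ennreal (K + J * 3)" for u
  proof -
    define G where "G = (\<lambda>(z :: real^'n) \<tau>. ennreal ((1 + norm z) / (1 / (1 + norm z) + norm (z - D \<tau> *v u)) ^ (?n + 1)) * indicator {0..3 :: real} \<tau>)"
    have [measurable]: "(\<lambda>(z, \<tau>). G z \<tau>) \<in> borel_measurable (lborel \<Otimes>\<^sub>M lborel)"
      unfolding G_def by measurable
    have "(\<integral>\<^sup>+z. ennreal (1 / (1 + norm z)\<^sup>2) * g1 z u \<partial>lborel) =
        (\<integral>\<^sup>+z. ennreal (1 / (1 + norm z)\<^sup>2) * ennreal (1 / (1 + norm z) ^ ?n) + ennreal (1 / (1 + norm z)\<^sup>2) * (\<integral>\<^sup>+\<tau>. G z \<tau> \<partial>lborel) \<partial>lborel)"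
      by (simp only: g1_def G_def distrib_left)
    also have "\<dots> = (\<integral>\<^sup>+z. ennreal (1 / (1 + norm z)\<^sup>2) * ennreal (1 / (1 + norm z) ^ ?n) \<partial>(lborel :: (real^'n) measure)) +
        (\<integral>\<^sup>+z. ennreal (1 / (1 + norm z)\<^sup>2) * (\<integral>\<^sup>+\<tau>. G z \<tau> \<partial>lborel) \<partial>lborel)"
      by (rule nn_integral_add) measurable
    also have "(\<integral>\<^sup>+z. ennreal (1 / (1 + norm z)\<^sup>2) * ennreal (1 / (1 + norm z) ^ ?n) \<partial>(lborel :: (real^'n) measure)) \<le> ennreal K"
    proof -
      have "(\<integral>\<^sup>+z. ennreal (1 / (1 + norm z)\<^sup>2) * ennreal (1 / (1 + norm z) ^ ?n) \<partial>(lborel :: (real^'n) measure))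
          \<le> (\<integral>\<^sup>+z. ennreal (1 / (1 + norm (z - 0)) ^ (?n + 1)) \<partial>(lborel :: (real^'n) measure))"
      proof (rule nn_integral_mono)
        fix z :: "real^'n"
        define M where "M = 1 + norm z"
        have M: "M \<ge> 1" by (simp add: M_def)
        have "1 / M\<^sup>2 * (1 / M ^ ?n) = 1 / M ^ (?n + 2)" by (simp add: power2_eq_square)
        also have "\<dots> \<le> 1 / M ^ (?n + 1)" using M by (intro divide_left_mono power_increasing) auto
        finally have "ennreal (1 / M\<^sup>2 * (1 / M ^ ?n)) \<le> ennreal (1 / M ^ (?n + 1))" by (rule ennreal_leI)
        moreover have "ennreal (1 / M\<^sup>2 * (1 / M ^ ?n)) = ennreal (1 / M\<^sup>2) * ennreal (1 / M ^ ?n)"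
          using M by (intro ennreal_mult) auto
        ultimately have "ennreal (1 / M\<^sup>2) * ennreal (1 / M ^ ?n) \<le> ennreal (1 / M ^ (?n + 1))" by (simp only:)
        then show "ennreal (1 / (1 + norm z)\<^sup>2) * ennreal (1 / (1 + norm z) ^ ?n) \<le> ennreal (1 / (1 + norm (z - 0)) ^ (?n + 1))"
          by (simp only: M_def diff_zero)
      qed
      also have "\<dots> \<le> ennreal K" using rational_kernel_integral[of 1 "0 :: real^'n"] by (simp add: K_def)
      finally show ?thesis .
    qed
    also have "(\<integral>\<^sup>+z. ennreal (1 / (1 + norm z)\<^sup>2) * (\<integral>\<^sup>+\<tau>. G z \<tau> \<partial>lborel) \<partial>lborel) \<le> ennreal (J * 3)"
    proof -
      have "(\<integral>\<^sup>+z. ennreal (1 / (1 + norm z)\<^sup>2) * (\<integral>\<^sup>+\<tau>. G z \<tau> \<partial>lborel) \<partial>lborel) =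
          (\<integral>\<^sup>+z. (\<integral>\<^sup>+\<tau>. ennreal (1 / (1 + norm z)\<^sup>2) * G z \<tau> \<partial>lborel) \<partial>lborel)"
        by (intro nn_integral_cong nn_integral_cmult[symmetric]) measurable
      also have "\<dots> = (\<integral>\<^sup>+\<tau>. (\<integral>\<^sup>+z. ennreal (1 / (1 + norm z)\<^sup>2) * G z \<tau> \<partial>lborel) \<partial>lborel)"
        by (rule lborel_pair.Fubini') measurable
      also have "\<dots> \<le> (\<integral>\<^sup>+\<tau>. ennreal J * indicator {0..3 :: real} \<tau> \<partial>lborel)"
      proof (rule nn_integral_mono)
        fix \<tau> :: real
        have "ennreal (1 / (1 + norm z)\<^sup>2) * G z \<tau> = ennreal ((1 / (1 + norm z)) / (1 / (1 + norm z) + norm (z - D \<tau> *v u)) ^ (?n + 1)) * indicator {0..3} \<tau>" for z :: "real^'n"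
        proof -
          define M q where "M = 1 + norm z" and "q = (1 / (1 + norm z) + norm (z - D \<tau> *v u)) ^ (?n + 1)"
          have M: "M > 0" unfolding M_def by (intro add_pos_nonneg) auto
          have q: "q \<ge> 0" unfolding q_def by simp
          have "ennreal (1 / M\<^sup>2) * ennreal (M / q) = ennreal (1 / M\<^sup>2 * (M / q))"
            using M q by (intro ennreal_mult[symmetric]) auto
          also have "1 / M\<^sup>2 * (M / q) = (1 / M) / q" using M by (simp add: power2_eq_square)
          finally show ?thesis by (simp add: G_def M_def q_def mult.assoc[symmetric])
        qed
        then have "(\<integral>\<^sup>+z. ennreal (1 / (1 + norm z)\<^sup>2) * G z \<tau> \<partial>lborel) =
            (\<integral>\<^sup>+z. ennreal ((1 / (1 + norm z)) / (1 / (1 + norm z) + norm (z - D \<tau> *v u)) ^ (?n + 1)) \<partial>lborel) * indicator {0..3} \<tau>"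
          by (simp add: nn_integral_multc)
        also have "\<dots> \<le> ennreal J * indicator {0..3} \<tau>" by (intro mult_right_mono J) auto
        finally show "(\<integral>\<^sup>+z. ennreal (1 / (1 + norm z)\<^sup>2) * G z \<tau> \<partial>lborel) \<le> ennreal J * indicator {0..3} \<tau>" .
      qed
      also have "\<dots> = ennreal (J * 3)" using J by (simp add: nn_integral_cmult_indicator ennreal_mult)
      finally show ?thesis .
    qed
    also have "ennreal K + ennreal (J * 3) = ennreal (K + J * 3)" using K J by simp
    finally show ?thesis by (simp add: add_mono)
  qed
  then show ?thesis using K J by (intro exI[of _ "K + J * 3"]) auto
qed

text \<open>The flow expands: \<open>|w| \<le> C e^(-c \<tau>) |D \<tau> w|\<close>. Unless
  \<open>w\<close> lies in the tiny ball of radius \<open>e^(-c \<tau> / 2)\<close>, the denominator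
  is therefore large enough to give decay. In that ball the quotient is merely bounded, but the ball
  has small volume.\<close>

lemma flow_weight_bound:
  assumes \<tau>: "\<tau> \<ge> 0"
  shows "(1 + norm w) / (1 + norm (D \<tau> *v w))\<^sup>2 \<le> C\<^sup>2 * (exp (- (c / 2) * \<tau>) + indicator (cball 0 (exp (- (c / 2) * \<tau>))) w)"
proof -
  define y where "y = norm (D \<tau> *v w)"
  define e where "e = exp (- (c / 2) * \<tau>)"
  have e: "0 < e" by (simp add: e_def)
  have ee: "exp (- c * \<tau>) = e * e" by (simp add: e_def exp_add[symmetric])
  have e1: "e \<le> 1" using c \<tau> by (simp add: e_def)
  have w: "norm w \<le> C * (e * e) * y"
    using D_decay[OF \<tau>, of "D \<tau> *v w"] by (simp add: D_inv ee[symmetric] y_def)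
  have y: "y \<ge> 0" by (simp add: y_def)
  have "C * (e * e) * y \<le> C * (1 * 1) * y" using C e e1 y by (intro mult_right_mono mult_left_mono mult_mono) auto
  then have "norm w \<le> C * y" using w by simp
  then have 1: "1 + norm w \<le> C * (1 + y)" using C by (simp add: distrib_left)
  have "(1 + norm w) / (1 + y)\<^sup>2 \<le> C * (1 + y) / (1 + y)\<^sup>2" using 1 by (intro divide_right_mono) auto
  also have "\<dots> = C / (1 + y)" using y by (simp add: power2_eq_square)
  finally have 2: "(1 + norm w) / (1 + y)\<^sup>2 \<le> C / (1 + y)" .
  have CC: "C \<le> C\<^sup>2" using C by (simp add: power2_eq_square)
  show ?thesis
  proof (cases "norm w \<le> e")
    case True
    have "C / (1 + y) \<le> C / 1" using C y by (intro divide_left_mono) auto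
    also have "\<dots> \<le> C\<^sup>2 * (e + 1)"
    proof -
      have "C\<^sup>2 * 1 \<le> C\<^sup>2 * (e + 1)" using e by (intro mult_left_mono) auto
      then show ?thesis using CC by linarith
    qed
    finally show ?thesis using 2 True by (simp add: y_def e_def)
  next
    case False
    then have "e < C * (e * e) * y" using w by simp
    then have "1 < C * e * y" using e by (simp add: field_simps)
    moreover have "0 < C * e" using C e by simp
    moreover have "(1 + y) * (C * e) = C * e + C * e * y" by (simp add: algebra_simps)
    ultimately have "1 + y \<ge> 1 / (C * e)" by (subst divide_le_eq) simp
    then have "C / (1 + y) \<le> C / (1 / (C * e))" using C e y by (intro divide_left_mono) auto
    also have "\<dots> = C\<^sup>2 * e" using C e by (simp add: power2_eq_square)
    finally show ?thesis using 2 False by (simp add: y_def e_def)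
  qed
qed

text \<open>After the substitution \<open>w = D (- \<tau>) z\<close> the Jacobian cancels
  \<open>exp (- \<theta> * \<tau>)\<close>. The remaining space integral decays like
  \<open>e^(-c \<tau> / 2)\<close>, which makes the infinite range of \<open>\<tau>\<close>
  harmless.\<close>

lemma g2_integral: "\<exists>A\<ge>0. \<forall>u. (\<integral>\<^sup>+z. ennreal (1 / (1 + norm z)\<^sup>2) * g2 z u \<partial>lborel) \<le> ennreal A"
proof -
  let ?n = "CARD('n)"
  define K where "K = 2 ^ (?n + 2) * unit_ball_vol (real ?n)"
  have K: "K \<ge> 0" by (simp add: K_def)
  define V where "V = C\<^sup>2 * (K + unit_ball_vol (real ?n))"
  have V: "V \<ge> 0" using K by (simp add: V_def)
  have "(\<integral>\<^sup>+z. ennreal (1 / (1 + norm z)\<^sup>2) * g2 z u \<partial>lborel) \<le> ennreal (V * (2 / c))" for u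
  proof -
    define G where "G = (\<lambda>(z :: real^'n) \<tau>. ennreal ((1 + norm (D (- \<tau>) *v z)) * exp (- \<theta> * \<tau>) / (1 + norm (D (- \<tau>) *v z - u)) ^ (?n + 1)) * indicator {1 :: real..} \<tau>)"
    have [measurable]: "(\<lambda>(z, \<tau>). G z \<tau>) \<in> borel_measurable (lborel \<Otimes>\<^sub>M lborel)"
      unfolding G_def by measurable
    define H where "H = (\<lambda>\<tau> w. ennreal ((1 + norm w) / (1 + norm (D \<tau> *v w))\<^sup>2 / (1 + norm (w - u)) ^ (?n + 1)))"
    have HI: "(\<integral>\<^sup>+w. H \<tau> w \<partial>lborel) \<le> ennreal (V * exp (- (c / 2) * \<tau>))" if \<tau>: "\<tau> \<ge> 0" for \<tau>
    proof -
      define e where "e = exp (- (c / 2) * \<tau>)"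
      have e: "0 < e" "e \<le> 1" using c \<tau> by (auto simp: e_def)
      have "(\<integral>\<^sup>+w. H \<tau> w \<partial>lborel) \<le> (\<integral>\<^sup>+w. ennreal (C\<^sup>2 * e) * ennreal (1 / (1 + norm (w - u)) ^ (?n + 1)) + ennreal (C\<^sup>2) * indicator (cball 0 e) w \<partial>lborel)"
      proof (rule nn_integral_mono)
        fix w
        define q where "q = (1 + norm (w - u)) ^ (?n + 1)"
        have q: "q \<ge> 1" unfolding q_def by (intro one_le_power) auto
        have "(1 + norm w) / (1 + norm (D \<tau> *v w))\<^sup>2 / q \<le> C\<^sup>2 * (e + indicator (cball 0 e) w) / q"
          using flow_weight_bound[OF \<tau>, of w] q unfolding e_def by (intro divide_right_mono) auto
        also have "\<dots> = C\<^sup>2 * e * (1 / q) + C\<^sup>2 * indicator (cball 0 e) w / q" by (simp add: distrib_left add_divide_distrib)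
        also have "C\<^sup>2 * indicator (cball 0 e) w / q \<le> C\<^sup>2 * indicator (cball 0 e) w / 1"
          using q by (intro divide_left_mono) auto
        finally have "H \<tau> w \<le> ennreal (C\<^sup>2 * e * (1 / q) + C\<^sup>2 * indicator (cball 0 e) w)"
          unfolding H_def q_def[symmetric] by (intro ennreal_leI) simp
        also have "\<dots> = ennreal (C\<^sup>2 * e * (1 / q)) + ennreal (C\<^sup>2 * indicator (cball 0 e) w)"
          using q e by (intro ennreal_plus) auto
        also have "ennreal (C\<^sup>2 * e * (1 / q)) = ennreal (C\<^sup>2 * e) * ennreal (1 / q)"
          using q e by (intro ennreal_mult) auto
        also have "ennreal (C\<^sup>2 * indicator (cball 0 e) w) = ennreal (C\<^sup>2) * indicator (cball 0 e) w"
          by (simp add: indicator_def)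
        finally show "H \<tau> w \<le> ennreal (C\<^sup>2 * e) * ennreal (1 / (1 + norm (w - u)) ^ (?n + 1)) + ennreal (C\<^sup>2) * indicator (cball 0 e) w"
          by (simp only: q_def)
      qed
      also have "\<dots> = (\<integral>\<^sup>+w. ennreal (C\<^sup>2 * e) * ennreal (1 / (1 + norm (w - u)) ^ (?n + 1)) \<partial>lborel) + (\<integral>\<^sup>+w. ennreal (C\<^sup>2) * indicator (cball (0 :: real^'n) e) w \<partial>lborel)"
        by (rule nn_integral_add) (auto intro!: borel_measurable_times_ennreal borel_measurable_indicator)
      also have "(\<integral>\<^sup>+w. ennreal (C\<^sup>2 * e) * ennreal (1 / (1 + norm (w - u)) ^ (?n + 1)) \<partial>lborel) \<le> ennreal (C\<^sup>2 * e) * ennreal K"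
      proof -
        have "(\<integral>\<^sup>+w. ennreal (C\<^sup>2 * e) * ennreal (1 / (1 + norm (w - u)) ^ (?n + 1)) \<partial>lborel) = ennreal (C\<^sup>2 * e) * (\<integral>\<^sup>+w. ennreal (1 / (1 + norm (w - u)) ^ (?n + 1)) \<partial>lborel)"
          by (rule nn_integral_cmult) measurable
        also have "\<dots> \<le> ennreal (C\<^sup>2 * e) * ennreal K"
          using rational_kernel_integral[of 1 u] by (intro mult_left_mono) (auto simp: K_def)
        finally show ?thesis .
      qed
      also have "(\<integral>\<^sup>+w. ennreal (C\<^sup>2) * indicator (cball (0 :: real^'n) e) w \<partial>lborel) = ennreal (C\<^sup>2) * ennreal (unit_ball_vol (real ?n) * e ^ ?n)"
        using e by (simp add: nn_integral_cmult_indicator emeasure_cball)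
      also have "\<dots> \<le> ennreal (C\<^sup>2) * ennreal (unit_ball_vol (real ?n) * e)"
      proof -
        \<comment> \<open>The dimension is at least \<open>1\<close>, so the volume of the ball
          decays at least like \<open>e\<close>.\<close>
        have "e ^ ?n \<le> e ^ 1" using e by (intro power_decreasing) (auto simp: Suc_leI)
        then show ?thesis by (intro mult_left_mono ennreal_leI) auto
      qed
      also have "ennreal (C\<^sup>2 * e) * ennreal K + ennreal (C\<^sup>2) * ennreal (unit_ball_vol (real ?n) * e) = ennreal (V * e)"
        using e K by (simp add: ennreal_mult[symmetric] ennreal_plus[symmetric] V_def algebra_simps del: ennreal_plus)
      finally show ?thesis by (simp add: e_def add_mono)
    qed
    have "(\<integral>\<^sup>+z. ennreal (1 / (1 + norm z)\<^sup>2) * g2 z u \<partial>lborel) =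
        (\<integral>\<^sup>+z. (\<integral>\<^sup>+\<tau>. ennreal (1 / (1 + norm z)\<^sup>2) * G z \<tau> \<partial>lborel) \<partial>lborel)"
      unfolding g2_def G_def[symmetric]
      by (intro nn_integral_cong, subst nn_integral_cmult) (auto simp: G_def)
    also have "\<dots> = (\<integral>\<^sup>+\<tau>. (\<integral>\<^sup>+z. ennreal (1 / (1 + norm z)\<^sup>2) * G z \<tau> \<partial>lborel) \<partial>lborel)"
      by (rule lborel_pair.Fubini') measurable
    also have "\<dots> \<le> (\<integral>\<^sup>+\<tau>. ennreal V * (ennreal (exp (- (c / 2) * (\<tau> - 0))) * indicator {0..} \<tau>) \<partial>lborel)"
    proof (rule nn_integral_mono)
      fix \<tau> :: real
      show "(\<integral>\<^sup>+z. ennreal (1 / (1 + norm z)\<^sup>2) * G z \<tau> \<partial>lborel) \<le> ennreal V * (ennreal (exp (- (c / 2) * (\<tau> - 0))) * indicator {0..} \<tau>)"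
      proof (cases "\<tau> \<ge> 1")
        case True
        have [measurable]: "H \<tau> \<in> borel_measurable borel" unfolding H_def by measurable
        have "ennreal (1 / (1 + norm z)\<^sup>2) * G z \<tau> = ennreal (exp (- \<theta> * \<tau>)) * H \<tau> (D (- \<tau>) *v z)" for z
        proof -
          define w where "w = D (- \<tau>) *v z"
          have z: "D \<tau> *v w = z" by (simp add: w_def D_inv)
          define q where "q = (1 + norm (w - u)) ^ (?n + 1)"
          have q: "q \<ge> 0" unfolding q_def by simp
          have "ennreal (1 / (1 + norm z)\<^sup>2) * G z \<tau> = ennreal (1 / (1 + norm z)\<^sup>2) * ennreal ((1 + norm w) * exp (- \<theta> * \<tau>) / q)"
            using True by (simp add: G_def w_def q_def)
          also have "\<dots> = ennreal (1 / (1 + norm z)\<^sup>2 * ((1 + norm w) * exp (- \<theta> * \<tau>) / q))"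
            using q by (intro ennreal_mult[symmetric]) auto
          also have "1 / (1 + norm z)\<^sup>2 * ((1 + norm w) * exp (- \<theta> * \<tau>) / q) = exp (- \<theta> * \<tau>) * ((1 + norm w) / (1 + norm z)\<^sup>2 / q)"
            by simp
          also have "ennreal \<dots> = ennreal (exp (- \<theta> * \<tau>)) * ennreal ((1 + norm w) / (1 + norm z)\<^sup>2 / q)"
            using q by (intro ennreal_mult) auto
          finally show ?thesis by (simp only: H_def w_def[symmetric] z q_def)
        qed
        then have "(\<integral>\<^sup>+z. ennreal (1 / (1 + norm z)\<^sup>2) * G z \<tau> \<partial>lborel) = (\<integral>\<^sup>+z. ennreal (exp (- \<theta> * \<tau>)) * H \<tau> (D (- \<tau>) *v z) \<partial>lborel)"
          by (simp only:)
        also have "\<dots> = ennreal (exp (- \<theta> * \<tau>)) * (\<integral>\<^sup>+z. H \<tau> (D (- \<tau>) *v z) \<partial>lborel)"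
          by (rule nn_integral_cmult) measurable
        also have "(\<integral>\<^sup>+z. H \<tau> (D (- \<tau>) *v z) \<partial>lborel) = ennreal (1 / \<bar>det (D (- \<tau>))\<bar>) * (\<integral>\<^sup>+w. H \<tau> w \<partial>lborel)"
          by (rule nn_integral_compose_linear) (auto simp: det_D)
        also have "ennreal (exp (- \<theta> * \<tau>)) * (ennreal (1 / \<bar>det (D (- \<tau>))\<bar>) * (\<integral>\<^sup>+w. H \<tau> w \<partial>lborel)) = (\<integral>\<^sup>+w. H \<tau> w \<partial>lborel)"
          by (simp add: det_D mult.assoc[symmetric] ennreal_mult[symmetric])
        also have "\<dots> \<le> ennreal (V * exp (- (c / 2) * \<tau>))" using True by (intro HI) auto
        also have "\<dots> = ennreal V * (ennreal (exp (- (c / 2) * (\<tau> - 0))) * indicator {0..} \<tau>)"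
          using True V by (simp add: ennreal_mult)
        finally show ?thesis .
      next
        case False
        then show ?thesis by (simp add: G_def)
      qed
    qed
    also have "\<dots> = ennreal V * (\<integral>\<^sup>+\<tau>. ennreal (exp (- (c / 2) * (\<tau> - 0))) * indicator {0..} \<tau> \<partial>lborel)"
      by (rule nn_integral_cmult) measurable
    also have "(\<integral>\<^sup>+\<tau>. ennreal (exp (- (c / 2) * (\<tau> - 0))) * indicator {0..} \<tau> \<partial>lborel) = ennreal (1 / (c / 2))"
      using c by (intro nn_integral_exp_tail) simp
    also have "ennreal V * ennreal (1 / (c / 2)) = ennreal (V * (1 / (c / 2)))" using V c by (intro ennreal_mult[symmetric]) auto
    also have "V * (1 / (c / 2)) = V * (2 / c)" by simp
    finally show ?thesis .
  qed
  then show ?thesis using V c by (intro exI[of _ "V * (2 / c)"]) auto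
qed

text \<open>Backwards along the orbit \<open>R\<close> decreases at rate at least of order
  \<open>|z|^2\<close>. From the first admissible time on, where the density is at most
  \<open>H\<close>, the integrand is below a decaying exponential, so the integral is at most
  \<open>H\<close> over that rate.\<close>

lemma flow_integral:
  "\<exists>A>0. \<forall>z H. (\<integral>\<^sup>+\<sigma>. indicator {0..1} \<sigma> * (ennreal (exp (R (D (- \<sigma>) *v z))) *
       indicator {\<sigma>. ennreal (exp (R (D (- \<sigma>) *v z))) \<le> H} \<sigma>) \<partial>lborel) \<le> ennreal (A / (1 + norm z)\<^sup>2) * H"
proof -
  \<comment> \<open>The summand \<open>4\<close> serves \<open>|z| < 1\<close>, where
    \<open>(1 + |z|)^2 \<le> 4\<close>; the other serves \<open>|z| \<ge> 1\<close>, where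
    \<open>(1 + |z|)^2 \<le> 4 |z|^2\<close> is compared with the rate
    \<open>b = c |z|^2 / C^2\<close>.\<close>
  define A where "A = 4 + 4 * C\<^sup>2 / c"
  have A: "A > 0" using c by (simp add: A_def add_pos_nonneg)
  have "(\<integral>\<^sup>+\<sigma>. indicator {0..1} \<sigma> * (ennreal (exp (R (D (- \<sigma>) *v z))) *
       indicator {\<sigma>. ennreal (exp (R (D (- \<sigma>) *v z))) \<le> H} \<sigma>) \<partial>lborel) \<le> ennreal (A / (1 + norm z)\<^sup>2) * H" for z H
  proof (cases H)
    case top
    have "0 < A / (1 + norm z)\<^sup>2" using A by (intro divide_pos_pos zero_less_power add_pos_nonneg) auto
    then have "ennreal (A / (1 + norm z)\<^sup>2) \<noteq> 0" by (simp only: ennreal_eq_0_iff not_le)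
    then have "ennreal (A / (1 + norm z)\<^sup>2) * H = top" unfolding top by (simp only: ennreal_mult_eq_top_iff simp_thms)
    then show ?thesis by simp
  next
    case (real h)
    define \<phi> where "\<phi> = (\<lambda>\<sigma>. R (D (- \<sigma>) *v z))"
    define S where "S = {\<sigma>. 0 \<le> \<sigma> \<and> \<sigma> \<le> 1 \<and> exp (\<phi> \<sigma>) \<le> h}"
    define b where "b = c * (norm z / C)\<^sup>2"
    have eq: "indicator {0..1} \<sigma> * (ennreal (exp (R (D (- \<sigma>) *v z))) * indicator {\<sigma>. ennreal (exp (R (D (- \<sigma>) *v z))) \<le> H} \<sigma>) =
        ennreal (exp (\<phi> \<sigma>)) * indicator S \<sigma>" for \<sigma>
      using real by (auto simp: S_def \<phi>_def indicator_def)
    have cont: "continuous_on UNIV \<phi>"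
    proof -
      have "continuous_on UNIV (\<lambda>\<sigma>. D (- \<sigma>) *v z)"
        by (intro bounded_bilinear.continuous_on[OF bounded_bilinear_matrix_vector_mult]
            continuous_on_compose2[OF cont_D] continuous_on_minus continuous_on_id continuous_on_const) auto
      then show ?thesis unfolding \<phi>_def by (intro continuous_on_compose2[OF cont_R]) auto
    qed
    show ?thesis
    proof (cases "S = {}")
      case True
      then show ?thesis unfolding eq by simp
    next
      case False
      have "closed S"
        unfolding S_def using cont by (intro closed_Collect_conj closed_Collect_le continuous_intros) auto
      moreover have "bdd_below S" by (rule bdd_belowI[of _ 0]) (simp add: S_def)
      ultimately have \<sigma>0: "Inf S \<in> S" using False by (intro closed_contains_Inf)
      \<comment> \<open>The first time at which the density is at most \<open>h\<close>; it belongs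
        to \<open>S\<close> because \<open>S\<close> is closed.\<close>
      define a where "a = Inf S"
      have a: "0 \<le> a" "a \<le> 1" "exp (\<phi> a) \<le> h" using \<sigma>0 by (auto simp: S_def a_def)
      have decay: "exp (\<phi> \<sigma>) \<le> h * exp (- b * (\<sigma> - a))" and ge: "a \<le> \<sigma>" if \<sigma>: "\<sigma> \<in> S" for \<sigma>
      proof -
        show "a \<le> \<sigma>" unfolding a_def using \<sigma> \<open>bdd_below S\<close> by (rule cInf_lower)
        then have d: "0 \<le> \<sigma> - a" "\<sigma> - a \<le> 1" using \<sigma> a by (auto simp: S_def)
        have "norm z / C \<le> norm (D (- \<sigma>) *v z)"
          using D_lower[of "- \<sigma>" z] \<sigma> C by (simp add: S_def divide_le_eq mult.commute)
        then have "(norm z / C)\<^sup>2 \<le> (norm (D (- \<sigma>) *v z))\<^sup>2" using C by (intro power_mono) auto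
        then have "c * (\<sigma> - a) * (norm z / C)\<^sup>2 \<le> c * (\<sigma> - a) * (norm (D (- \<sigma>) *v z))\<^sup>2"
          using c d by (intro mult_left_mono) auto
        moreover have "\<phi> \<sigma> + c * (\<sigma> - a) * (norm (D (- \<sigma>) *v z))\<^sup>2 \<le> \<phi> a"
          using R_flow[OF d, of "D (- \<sigma>) *v z"] by (simp add: \<phi>_def D_comp)
        moreover have "c * (\<sigma> - a) * (norm z / C)\<^sup>2 = b * (\<sigma> - a)" by (simp add: b_def)
        ultimately have "\<phi> \<sigma> \<le> \<phi> a + - b * (\<sigma> - a)" by simp
        then have "exp (\<phi> \<sigma>) \<le> exp (\<phi> a) * exp (- b * (\<sigma> - a))" by (simp only: exp_add[symmetric] exp_le_cancel_iff)
        also have "\<dots> \<le> h * exp (- b * (\<sigma> - a))" using a by (intro mult_right_mono) auto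
        finally show "exp (\<phi> \<sigma>) \<le> h * exp (- b * (\<sigma> - a))" .
      qed
      have h: "h \<ge> 0" using real by simp
      define I where "I = (\<integral>\<^sup>+\<sigma>. ennreal (exp (\<phi> \<sigma>)) * indicator S \<sigma> \<partial>lborel)"
      have n1: "(1 + norm z)\<^sup>2 > 0" by (intro zero_less_power add_pos_nonneg) auto
      have "I \<le> ennreal (A / (1 + norm z)\<^sup>2 * h)"
      proof (cases "norm z \<ge> 1")
        case True
        then have b: "b > 0" unfolding b_def using c C
          by (intro mult_pos_pos zero_less_power divide_pos_pos) auto
        have "I \<le> (\<integral>\<^sup>+\<sigma>. ennreal h * (ennreal (exp (- b * (\<sigma> - a))) * indicator {a..} \<sigma>) \<partial>lborel)"
          unfolding I_def using decay ge h by (intro nn_integral_mono)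
            (auto simp: indicator_def ennreal_mult[symmetric] intro!: ennreal_leI)
        also have "\<dots> = ennreal h * ennreal (1 / b)"
          by (subst nn_integral_cmult, measurable) (simp only: nn_integral_exp_tail[OF b])
        also have "\<dots> = ennreal (1 / b * h)" using h b by (simp add: ennreal_mult[symmetric])
        also have "\<dots> \<le> ennreal (A / (1 + norm z)\<^sup>2 * h)"
        proof -
          have "(1 + norm z)\<^sup>2 \<le> (2 * norm z)\<^sup>2" using True by (intro power_mono) auto
          then have "(1 + norm z)\<^sup>2 * C\<^sup>2 \<le> (2 * norm z)\<^sup>2 * C\<^sup>2" by (rule mult_right_mono) simp
          also have "\<dots> = (4 * C\<^sup>2 / c) * (c * (norm z)\<^sup>2)"
            using c by (simp add: power_mult_distrib)
          also have "\<dots> \<le> A * (c * (norm z)\<^sup>2)" using c by (intro mult_right_mono) (auto simp: A_def)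
          finally have "1 / b \<le> A / (1 + norm z)\<^sup>2"
            using b n1 C c True by (simp add: b_def power_divide field_simps)
          then show ?thesis using h by (intro ennreal_leI mult_right_mono)
        qed
        finally show ?thesis .
      next
        case False
        have "I \<le> (\<integral>\<^sup>+\<sigma>. ennreal h * indicator {0..1 :: real} \<sigma> \<partial>lborel)"
          unfolding I_def by (intro nn_integral_mono) (auto simp: indicator_def S_def intro!: ennreal_leI)
        also have "\<dots> = ennreal h" by (simp add: nn_integral_cmult_indicator)
        also have "\<dots> \<le> ennreal (A / (1 + norm z)\<^sup>2 * h)"
        proof -
          have "(1 + norm z)\<^sup>2 \<le> 2\<^sup>2" using False by (intro power_mono) auto
          also have "\<dots> \<le> A" using c by (simp add: A_def)
          finally have "1 \<le> A / (1 + norm z)\<^sup>2" using n1 by (simp add: le_divide_eq)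
          then show ?thesis using h mult_right_mono[of 1 "A / (1 + norm z)\<^sup>2" h] by (intro ennreal_leI) simp
        qed
        finally show ?thesis .
      qed
      also have "\<dots> = ennreal (A / (1 + norm z)\<^sup>2) * H"
      proof -
        have "H = ennreal h" using real by simp
        then show ?thesis using A n1 h by (simp only:) (intro ennreal_mult, auto)
      qed
      finally show ?thesis unfolding eq I_def .
    qed
  qed
  then show ?thesis using A by blast
qed

lemma weak_type:
  "\<exists>A>0. \<forall>f \<alpha>. f \<in> borel_measurable borel \<longrightarrow> (\<forall>u. 0 \<le> f u) \<longrightarrow> 0 < \<alpha> \<longrightarrow>
     emeasure \<mu> {x. ennreal \<alpha> < N f x} \<le> ennreal (A / \<alpha>) * (\<integral>\<^sup>+u. ennreal (f u) \<partial>\<mu>)"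
proof -
  obtain A1 where A1: "A1 > 0" "\<And>f l. f \<in> borel_measurable borel \<Longrightarrow> l > 0 \<Longrightarrow>
     \<exists>U\<in>sets borel. emeasure \<mu> U \<le> ennreal (A1 / l) * (\<integral>\<^sup>+u. ennreal (f u) \<partial>\<mu>) \<and>
        (\<forall>x \<rho>. x \<notin> U \<longrightarrow> 0 < \<rho> \<longrightarrow> \<rho> * (1 + norm x) \<le> 1 \<longrightarrow>
          (\<integral>\<^sup>+u. ennreal (f u) * indicator (cball x \<rho>) u \<partial>\<mu>) \<le> ennreal (l * (exp (R x) * \<rho> ^ CARD('n))))"
    using local_maximal by blast
  obtain A2 where A2: "A2 > 0" "\<And>f l x t. f \<in> borel_measurable borel \<Longrightarrow> (\<And>u. 0 \<le> f u) \<Longrightarrow> l > 0 \<Longrightarrow> 0 < t \<Longrightarrow> t \<le> 1 \<Longrightarrow>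
     (\<forall>\<rho>. 0 < \<rho> \<longrightarrow> \<rho> * (1 + norm x) \<le> 1 \<longrightarrow>
        (\<integral>\<^sup>+u. ennreal (f u) * indicator (cball x \<rho>) u \<partial>\<mu>) \<le> ennreal (l * (exp (R x) * \<rho> ^ CARD('n)))) \<Longrightarrow>
     (\<integral>\<^sup>+u. ennreal (k t x u * f u) * indicator {u. norm (x - u) * (1 + norm x) \<le> 1} u \<partial>\<mu>) \<le> ennreal (A2 * l)"
    using local_part_bound by blast
  obtain A3 where A3: "A3 > 0" "\<And>z H. (\<integral>\<^sup>+\<sigma>. indicator {0..1} \<sigma> * (ennreal (exp (R (D (- \<sigma>) *v z))) *
       indicator {\<sigma>. ennreal (exp (R (D (- \<sigma>) *v z))) \<le> H} \<sigma>) \<partial>lborel) \<le> ennreal (A3 / (1 + norm z)\<^sup>2) * H"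
    using flow_integral by blast
  obtain J1 where J1: "J1 \<ge> 0" "\<And>u. (\<integral>\<^sup>+z. ennreal (1 / (1 + norm z)\<^sup>2) * g1 z u \<partial>lborel) \<le> ennreal J1"
    using g1_integral by blast
  obtain J2 where J2: "J2 \<ge> 0" "\<And>u. (\<integral>\<^sup>+z. ennreal (1 / (1 + norm z)\<^sup>2) * g2 z u \<partial>lborel) \<le> ennreal J2"
    using g2_integral by blast
  define B1 where "B1 = C * (8 * C ^ 3) ^ CARD('n) * (2 * (1 + C) ^ (CARD('n) + 1))"
  define B2 where "B2 = C * exp \<bar>\<theta>\<bar> * (exp \<bar>\<theta>\<bar> * (1 + C) ^ (CARD('n) + 2))"
  have B: "B1 \<ge> 0" "B2 \<ge> 0" using C by (auto simp: B1_def B2_def)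
  define g where "g = (\<lambda>(z :: real^'n) (u :: real^'n). ennreal B1 * g1 z u + ennreal B2 * g2 z u)"
  have measurable_g [measurable (raw)]: "(\<lambda>x. g (f x) (h x)) \<in> borel_measurable M"
    if [measurable]: "f \<in> borel_measurable M" "h \<in> borel_measurable M" for f h and M :: "'z measure"
    unfolding g_def by measurable
  define J where "J = B1 * J1 + B2 * J2"
  have J0: "J \<ge> 0" using B J1 J2 by (simp add: J_def)
  have J: "(\<integral>\<^sup>+z. ennreal (1 / (1 + norm z)\<^sup>2) * g z u \<partial>lborel) \<le> ennreal J" for u
  proof -
    have "(\<integral>\<^sup>+z. ennreal (1 / (1 + norm z)\<^sup>2) * g z u \<partial>lborel) =
        (\<integral>\<^sup>+z. ennreal B1 * (ennreal (1 / (1 + norm z)\<^sup>2) * g1 z u) + ennreal B2 * (ennreal (1 / (1 + norm z)\<^sup>2) * g2 z u) \<partial>lborel)"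
      by (intro nn_integral_cong) (simp only: g_def distrib_left mult_ac)
    also have "\<dots> = (\<integral>\<^sup>+z. ennreal B1 * (ennreal (1 / (1 + norm z)\<^sup>2) * g1 z u) \<partial>lborel) + (\<integral>\<^sup>+z. ennreal B2 * (ennreal (1 / (1 + norm z)\<^sup>2) * g2 z u) \<partial>lborel)"
      by (rule nn_integral_add) measurable
    also have "\<dots> = ennreal B1 * (\<integral>\<^sup>+z. ennreal (1 / (1 + norm z)\<^sup>2) * g1 z u \<partial>lborel) + ennreal B2 * (\<integral>\<^sup>+z. ennreal (1 / (1 + norm z)\<^sup>2) * g2 z u \<partial>lborel)"
      by (intro arg_cong2[where f = "(+)"] nn_integral_cmult) measurable
    also have "\<dots> \<le> ennreal B1 * ennreal J1 + ennreal B2 * ennreal J2"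
      by (intro add_mono mult_left_mono J1 J2) auto
    also have "\<dots> = ennreal J"
      using B J1 J2 by (simp add: J_def ennreal_mult[symmetric] ennreal_plus[symmetric] del: ennreal_plus)
    finally show ?thesis .
  qed
  define A where "A = 2 * A1 * A2 + \<kappa> * exp \<bar>\<theta>\<bar> * A3 * 2 * J + 1"
  have A: "A > 0" using A1 A2 A3 J0 \<kappa> by (simp add: A_def add_nonneg_pos)
  have "emeasure \<mu> {x. ennreal \<alpha> < N f x} \<le> ennreal (A / \<alpha>) * (\<integral>\<^sup>+u. ennreal (f u) \<partial>\<mu>)"
    if f [measurable]: "f \<in> borel_measurable borel" and f0: "\<And>u. 0 \<le> f u" and \<alpha>: "0 < \<alpha>" for f \<alpha>
  proof -
    define I where "I = (\<integral>\<^sup>+u. ennreal (f u) \<partial>\<mu>)"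
    \<comment> \<open>Makes the local part contribute at most \<open>\<alpha> / 2\<close> outside
      \<open>U\<close>, so that at least \<open>\<alpha> / 2\<close> is left to the global
      part.\<close>
    define l where "l = \<alpha> / (2 * A2)"
    have l: "l > 0" using \<alpha> A2 by (simp add: l_def)
    obtain U where U [measurable]: "U \<in> sets borel" and U1: "emeasure \<mu> U \<le> ennreal (A1 / l) * I"
      and U2: "\<And>x \<rho>. x \<notin> U \<Longrightarrow> 0 < \<rho> \<Longrightarrow> \<rho> * (1 + norm x) \<le> 1 \<Longrightarrow>
          (\<integral>\<^sup>+u. ennreal (f u) * indicator (cball x \<rho>) u \<partial>\<mu>) \<le> ennreal (l * (exp (R x) * \<rho> ^ CARD('n)))"
      using A1(2)[OF f l] by (auto simp: I_def)
    define S where "S = {x. ennreal \<alpha> < N f x}"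
    have S [measurable]: "S \<in> sets borel" unfolding S_def by (intro borel_open open_superlevel_N f)
    define W where "W = S - U"
    have W [measurable]: "W \<in> sets borel" unfolding W_def by measurable
    define H where "H = (\<lambda>z :: real^'n. ennreal (2 / \<alpha>) * (\<integral>\<^sup>+u. ennreal (\<kappa> * exp (R u)) * (g z u * ennreal (f u)) \<partial>lborel))"
    have H_meas [measurable]: "H \<in> borel_measurable borel" unfolding H_def by measurable
    \<comment> \<open>The time realising \<open>T t f x > \<alpha>\<close> depends on
      \<open>x\<close>, but the bounds by \<open>g1\<close> and \<open>g2\<close> do not contain it.
      The same function \<open>H\<close> hence works for every point of \<open>W\<close> and every
      shift \<open>\<sigma>\<close>.\<close>
    have key: "ennreal (exp (R x)) \<le> H (D \<sigma> *v x)" if x: "x \<in> W" and \<sigma>: "0 \<le> \<sigma>" "\<sigma> \<le> 1" for x \<sigma>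
    proof -
      obtain t where t: "t > 0" and Tt: "ennreal \<alpha> < T t f x"
        using x by (auto simp: W_def S_def N_def less_SUP_iff)
      have "\<exists>L. L \<in> sets borel \<and> ennreal (\<alpha> / 2) \<le> (\<integral>\<^sup>+u. ennreal (k t x u * f u) * indicator L u \<partial>\<mu>) \<and>
          (\<forall>u\<in>L. ennreal (exp (R x) * k t x u) \<le> g (D \<sigma> *v x) u)"
      proof (cases "t \<le> 1")
        case True
        define L where "L = {u. norm (x - u) * (1 + norm x) > 1}"
        have L [measurable]: "L \<in> sets borel" unfolding L_def by measurable
        have Lc: "- L = {u. norm (x - u) * (1 + norm x) \<le> 1}" by (auto simp: L_def)
        have "(\<integral>\<^sup>+u. ennreal (k t x u * f u) * indicator (- L) u \<partial>\<mu>) \<le> ennreal (A2 * l)"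
          unfolding Lc using U2[of x] x by (intro A2(2) f f0 l t True) (auto simp: W_def)
        also have "A2 * l = \<alpha> / 2" using A2 by (simp add: l_def)
        finally have loc: "(\<integral>\<^sup>+u. ennreal (k t x u * f u) * indicator (- L) u \<partial>\<mu>) \<le> ennreal (\<alpha> / 2)" .
        have "T t f x = (\<integral>\<^sup>+u. ennreal (k t x u * f u) * indicator L u + ennreal (k t x u * f u) * indicator (- L) u \<partial>\<mu>)"
          unfolding T_def by (intro nn_integral_cong) (auto simp: indicator_def)
        also have "\<dots> = (\<integral>\<^sup>+u. ennreal (k t x u * f u) * indicator L u \<partial>\<mu>) + (\<integral>\<^sup>+u. ennreal (k t x u * f u) * indicator (- L) u \<partial>\<mu>)"
          using t by (intro nn_integral_add) measurable
        finally have split: "T t f x = (\<integral>\<^sup>+u. ennreal (k t x u * f u) * indicator L u \<partial>\<mu>) + (\<integral>\<^sup>+u. ennreal (k t x u * f u) * indicator (- L) u \<partial>\<mu>)" .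
        have "ennreal (\<alpha> / 2) \<le> (\<integral>\<^sup>+u. ennreal (k t x u * f u) * indicator L u \<partial>\<mu>)"
        proof (rule ccontr)
          assume "\<not> ?thesis"
          then have "T t f x \<le> ennreal (\<alpha> / 2) + ennreal (\<alpha> / 2)"
            unfolding split using loc by (intro add_mono) auto
          also have "\<dots> = ennreal \<alpha>" using \<alpha> by (simp add: ennreal_plus[symmetric] del: ennreal_plus)
          finally show False using Tt by simp
        qed
        moreover have "ennreal (exp (R x) * k t x u) \<le> g (D \<sigma> *v x) u" if "u \<in> L" for u
        proof -
          have "ennreal (exp (R x) * k t x u) \<le> ennreal B1 * g1 (D \<sigma> *v x) u"
            unfolding B1_def using that by (intro global_majorant_small t True \<sigma>) (simp add: L_def)
          also have "\<dots> \<le> g (D \<sigma> *v x) u" by (simp add: g_def)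
          finally show ?thesis .
        qed
        ultimately show ?thesis using L by blast
      next
        case False
        have "ennreal (\<alpha> / 2) \<le> ennreal \<alpha>" using \<alpha> by (intro ennreal_leI) simp
        also have "\<dots> \<le> T t f x" using Tt by simp
        also have "\<dots> = (\<integral>\<^sup>+u. ennreal (k t x u * f u) * indicator UNIV u \<partial>\<mu>)" by (simp add: T_def)
        finally have 1: "ennreal (\<alpha> / 2) \<le> (\<integral>\<^sup>+u. ennreal (k t x u * f u) * indicator UNIV u \<partial>\<mu>)" .
        have 2: "ennreal (exp (R x) * k t x u) \<le> g (D \<sigma> *v x) u" for u
        proof -
          have "ennreal (exp (R x) * k t x u) \<le> ennreal B2 * g2 (D \<sigma> *v x) u"
            unfolding B2_def using False by (intro global_majorant_large \<sigma>) simp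
          also have "\<dots> \<le> g (D \<sigma> *v x) u" by (simp add: g_def)
          finally show ?thesis .
        qed
        show ?thesis by (rule exI[of _ UNIV]) (use 1 2 in auto)
      qed
      then obtain L where L [measurable]: "L \<in> sets borel"
        and L1: "ennreal (\<alpha> / 2) \<le> (\<integral>\<^sup>+u. ennreal (k t x u * f u) * indicator L u \<partial>\<mu>)"
        and L2: "\<And>u. u \<in> L \<Longrightarrow> ennreal (exp (R x) * k t x u) \<le> g (D \<sigma> *v x) u" by blast
      have "ennreal (exp (R x)) = ennreal (2 / \<alpha>) * (ennreal (exp (R x)) * ennreal (\<alpha> / 2))"
        using \<alpha> by (simp add: ennreal_mult[symmetric])
      also have "\<dots> \<le> ennreal (2 / \<alpha>) * (ennreal (exp (R x)) * (\<integral>\<^sup>+u. ennreal (k t x u * f u) * indicator L u \<partial>\<mu>))"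
        by (intro mult_left_mono L1) auto
      also have "ennreal (exp (R x)) * (\<integral>\<^sup>+u. ennreal (k t x u * f u) * indicator L u \<partial>\<mu>) =
          (\<integral>\<^sup>+u. ennreal (exp (R x)) * (ennreal (k t x u * f u) * indicator L u) \<partial>\<mu>)"
        using t by (intro nn_integral_cmult[symmetric]) measurable
      also have "\<dots> \<le> (\<integral>\<^sup>+u. g (D \<sigma> *v x) u * ennreal (f u) \<partial>\<mu>)"
      proof (rule nn_integral_mono)
        fix u :: "real^'n"
        show "ennreal (exp (R x)) * (ennreal (k t x u * f u) * indicator L u) \<le> g (D \<sigma> *v x) u * ennreal (f u)"
        proof (cases "u \<in> L")
          case True
          have "ennreal (exp (R x)) * (ennreal (k t x u * f u) * indicator L u) = ennreal (exp (R x) * k t x u) * ennreal (f u)"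
            using True k_nonneg[OF t, of x u] f0[of u] by (simp add: ennreal_mult[symmetric] mult.assoc)
          also have "\<dots> \<le> g (D \<sigma> *v x) u * ennreal (f u)" by (intro mult_right_mono L2 True) auto
          finally show ?thesis .
        qed simp
      qed
      also have "\<dots> = (\<integral>\<^sup>+u. ennreal (\<kappa> * exp (R u)) * (g (D \<sigma> *v x) u * ennreal (f u)) \<partial>lborel)"
        by (rule nn_integral_\<mu>) measurable
      finally show ?thesis by (simp add: H_def mult_left_mono)
    qed
    define \<Phi> where "\<Phi> = (\<lambda>\<sigma> z. ennreal (exp (R (D (- \<sigma>) *v z))) * indicator {\<sigma>. ennreal (exp (R (D (- \<sigma>) *v z))) \<le> H z} \<sigma>)"
    have \<Phi>_alt: "\<Phi> = (\<lambda>\<sigma> z. if ennreal (exp (R (D (- \<sigma>) *v z))) \<le> H z then ennreal (exp (R (D (- \<sigma>) *v z))) else 0)"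
      by (auto simp: \<Phi>_def fun_eq_iff indicator_def)
    have [measurable]: "(\<lambda>(\<sigma>, z). \<Phi> \<sigma> z) \<in> borel_measurable (lborel \<Otimes>\<^sub>M lborel)" unfolding \<Phi>_alt by measurable
    have [measurable]: "\<Phi> \<sigma> \<in> borel_measurable borel" for \<sigma> unfolding \<Phi>_alt by measurable
    define X where "X = (\<integral>\<^sup>+x. ennreal (exp (R x)) * indicator W x \<partial>lborel)"
    \<comment> \<open>For fixed \<open>\<sigma>\<close> the variable \<open>z = D \<sigma> x\<close>
      replaces \<open>x\<close>; the Jacobian is bounded because \<open>\<sigma>\<close> is at most
      \<open>1\<close>.\<close>
    have step: "X \<le> ennreal (exp \<bar>\<theta>\<bar>) * (\<integral>\<^sup>+z. \<Phi> \<sigma> z \<partial>lborel)" if \<sigma>: "0 \<le> \<sigma>" "\<sigma> \<le> 1" for \<sigma>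
    proof -
      have "X \<le> (\<integral>\<^sup>+x. \<Phi> \<sigma> (D \<sigma> *v x) \<partial>lborel)"
        unfolding X_def using key[OF _ \<sigma>] by (intro nn_integral_mono) (auto simp: \<Phi>_def D_inv indicator_def)
      also have "\<dots> = ennreal (1 / \<bar>det (D \<sigma>)\<bar>) * (\<integral>\<^sup>+z. \<Phi> \<sigma> z \<partial>lborel)"
        by (rule nn_integral_compose_linear) (auto simp: det_D)
      also have "\<dots> \<le> ennreal (exp \<bar>\<theta>\<bar>) * (\<integral>\<^sup>+z. \<Phi> \<sigma> z \<partial>lborel)"
      proof (intro mult_right_mono ennreal_leI)
        have "- \<theta> * \<sigma> \<le> \<bar>\<theta>\<bar> * \<sigma>" using \<sigma> by (intro mult_right_mono) auto
        also have "\<dots> \<le> \<bar>\<theta>\<bar> * 1" using \<sigma> by (intro mult_left_mono) auto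
        finally have "exp (- \<theta> * \<sigma>) \<le> exp \<bar>\<theta>\<bar>" by simp
        then show "1 / \<bar>det (D \<sigma>)\<bar> \<le> exp \<bar>\<theta>\<bar>" by (simp add: det_D exp_minus divide_inverse)
      qed auto
      finally show ?thesis .
    qed
    \<comment> \<open>\<open>X\<close> does not depend on \<open>\<sigma>\<close>, so it may be
      averaged over the unit interval; after the exchange of integrals the inner one runs along an
      orbit with \<open>z\<close> fixed.\<close>
    have "X = (\<integral>\<^sup>+\<sigma>. X * indicator {0..1 :: real} \<sigma> \<partial>lborel)" by (simp add: nn_integral_cmult_indicator)
    also have "\<dots> \<le> (\<integral>\<^sup>+\<sigma>. ennreal (exp \<bar>\<theta>\<bar>) * (\<integral>\<^sup>+z. indicator {0..1} \<sigma> * \<Phi> \<sigma> z \<partial>lborel) \<partial>lborel)"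
      using step by (intro nn_integral_mono) (auto simp: indicator_def)
    also have "\<dots> = ennreal (exp \<bar>\<theta>\<bar>) * (\<integral>\<^sup>+\<sigma>. (\<integral>\<^sup>+z. indicator {0..1} \<sigma> * \<Phi> \<sigma> z \<partial>lborel) \<partial>lborel)"
      by (rule nn_integral_cmult) measurable
    also have "(\<integral>\<^sup>+\<sigma>. (\<integral>\<^sup>+z. indicator {0..1} \<sigma> * \<Phi> \<sigma> z \<partial>lborel) \<partial>lborel) = (\<integral>\<^sup>+z. (\<integral>\<^sup>+\<sigma>. indicator {0..1} \<sigma> * \<Phi> \<sigma> z \<partial>lborel) \<partial>lborel)"
      by (rule lborel_pair.Fubini') measurable
    also have "\<dots> \<le> (\<integral>\<^sup>+z. ennreal (A3 / (1 + norm z)\<^sup>2) * H z \<partial>lborel)"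
      unfolding \<Phi>_def by (intro nn_integral_mono A3)
    also have "\<dots> \<le> ennreal (A3 * (2 / \<alpha>)) * (ennreal J * I)"
    proof -
      have "(\<integral>\<^sup>+z. ennreal (A3 / (1 + norm z)\<^sup>2) * H z \<partial>lborel) =
          (\<integral>\<^sup>+z. ennreal (A3 * (2 / \<alpha>)) * (\<integral>\<^sup>+u. ennreal (1 / (1 + norm z)\<^sup>2) * (ennreal (\<kappa> * exp (R u)) * (g z u * ennreal (f u))) \<partial>lborel) \<partial>lborel)"
      proof (rule nn_integral_cong)
        fix z :: "real^'n"
        have "ennreal (A3 / (1 + norm z)\<^sup>2) = ennreal (A3 * (1 / (1 + norm z)\<^sup>2))" by simp
        also have "\<dots> = ennreal A3 * ennreal (1 / (1 + norm z)\<^sup>2)" using A3 by (intro ennreal_mult) auto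
        finally have "ennreal (A3 / (1 + norm z)\<^sup>2) * H z = (ennreal A3 * ennreal (2 / \<alpha>)) *
            (ennreal (1 / (1 + norm z)\<^sup>2) * (\<integral>\<^sup>+u. ennreal (\<kappa> * exp (R u)) * (g z u * ennreal (f u)) \<partial>lborel))"
          by (simp only: H_def mult_ac)
        also have "ennreal A3 * ennreal (2 / \<alpha>) = ennreal (A3 * (2 / \<alpha>))" using A3 \<alpha> by (intro ennreal_mult[symmetric]) auto
        also have "ennreal (1 / (1 + norm z)\<^sup>2) * (\<integral>\<^sup>+u. ennreal (\<kappa> * exp (R u)) * (g z u * ennreal (f u)) \<partial>lborel) =
            (\<integral>\<^sup>+u. ennreal (1 / (1 + norm z)\<^sup>2) * (ennreal (\<kappa> * exp (R u)) * (g z u * ennreal (f u))) \<partial>lborel)"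
          by (rule nn_integral_cmult[symmetric]) measurable
        finally show "ennreal (A3 / (1 + norm z)\<^sup>2) * H z = ennreal (A3 * (2 / \<alpha>)) *
            (\<integral>\<^sup>+u. ennreal (1 / (1 + norm z)\<^sup>2) * (ennreal (\<kappa> * exp (R u)) * (g z u * ennreal (f u))) \<partial>lborel)" .
      qed
      also have "\<dots> = ennreal (A3 * (2 / \<alpha>)) * (\<integral>\<^sup>+z. (\<integral>\<^sup>+u. ennreal (1 / (1 + norm z)\<^sup>2) * (ennreal (\<kappa> * exp (R u)) * (g z u * ennreal (f u))) \<partial>lborel) \<partial>lborel)"
        by (rule nn_integral_cmult) measurable
      also have "(\<integral>\<^sup>+z. (\<integral>\<^sup>+u. ennreal (1 / (1 + norm z)\<^sup>2) * (ennreal (\<kappa> * exp (R u)) * (g z u * ennreal (f u))) \<partial>lborel) \<partial>lborel) =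
          (\<integral>\<^sup>+u. (\<integral>\<^sup>+z. ennreal (1 / (1 + norm z)\<^sup>2) * (ennreal (\<kappa> * exp (R u)) * (g z u * ennreal (f u))) \<partial>lborel) \<partial>lborel)"
        by (rule lborel_pair.Fubini') measurable
      also have "\<dots> = (\<integral>\<^sup>+u. (ennreal (\<kappa> * exp (R u)) * ennreal (f u)) * (\<integral>\<^sup>+z. ennreal (1 / (1 + norm z)\<^sup>2) * g z u \<partial>lborel) \<partial>lborel)"
      proof (rule nn_integral_cong)
        fix u :: "real^'n"
        have "(\<integral>\<^sup>+z. ennreal (1 / (1 + norm z)\<^sup>2) * (ennreal (\<kappa> * exp (R u)) * (g z u * ennreal (f u))) \<partial>lborel) =
            (\<integral>\<^sup>+z. (ennreal (\<kappa> * exp (R u)) * ennreal (f u)) * (ennreal (1 / (1 + norm z)\<^sup>2) * g z u) \<partial>lborel)"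
          by (simp only: mult_ac)
        also have "\<dots> = (ennreal (\<kappa> * exp (R u)) * ennreal (f u)) * (\<integral>\<^sup>+z. ennreal (1 / (1 + norm z)\<^sup>2) * g z u \<partial>lborel)"
          by (rule nn_integral_cmult) measurable
        finally show "(\<integral>\<^sup>+z. ennreal (1 / (1 + norm z)\<^sup>2) * (ennreal (\<kappa> * exp (R u)) * (g z u * ennreal (f u))) \<partial>lborel) =
            (ennreal (\<kappa> * exp (R u)) * ennreal (f u)) * (\<integral>\<^sup>+z. ennreal (1 / (1 + norm z)\<^sup>2) * g z u \<partial>lborel)" .
      qed
      also have "\<dots> \<le> (\<integral>\<^sup>+u. (ennreal (\<kappa> * exp (R u)) * ennreal (f u)) * ennreal J \<partial>lborel)"
        by (intro nn_integral_mono mult_left_mono J) auto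
      also have "\<dots> = (\<integral>\<^sup>+u. ennreal (\<kappa> * exp (R u)) * ennreal (f u) \<partial>lborel) * ennreal J"
        by (rule nn_integral_multc) measurable
      also have "(\<integral>\<^sup>+u. ennreal (\<kappa> * exp (R u)) * ennreal (f u) \<partial>lborel) = I"
        unfolding I_def by (rule nn_integral_\<mu>[symmetric]) measurable
      also have "I * ennreal J = ennreal J * I" by (rule mult.commute)
      finally show ?thesis by (simp add: mult_left_mono)
    qed
    finally have X: "X \<le> ennreal (exp \<bar>\<theta>\<bar>) * (ennreal (A3 * (2 / \<alpha>)) * (ennreal J * I))"
      by (simp add: mult_left_mono)
    have "emeasure \<mu> W = (\<integral>\<^sup>+x. indicator W x \<partial>\<mu>)" by (subst nn_integral_indicator) (auto simp: sets_\<mu>)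
    also have "\<dots> = (\<integral>\<^sup>+x. ennreal (\<kappa> * exp (R x)) * indicator W x \<partial>lborel)" by (rule nn_integral_\<mu>) measurable
    also have "\<dots> = (\<integral>\<^sup>+x. ennreal \<kappa> * (ennreal (exp (R x)) * indicator W x) \<partial>lborel)"
      using \<kappa> by (simp add: ennreal_mult mult.assoc)
    also have "\<dots> = ennreal \<kappa> * X" unfolding X_def by (rule nn_integral_cmult) measurable
    also have "\<dots> \<le> ennreal \<kappa> * (ennreal (exp \<bar>\<theta>\<bar>) * (ennreal (A3 * (2 / \<alpha>)) * (ennreal J * I)))"
      by (intro mult_left_mono X) auto
    also have "\<dots> = ennreal (\<kappa> * (exp \<bar>\<theta>\<bar> * (A3 * (2 / \<alpha>) * J))) * I"
    proof -
      have "ennreal (\<kappa> * (exp \<bar>\<theta>\<bar> * (A3 * (2 / \<alpha>) * J))) = ennreal \<kappa> * ennreal (exp \<bar>\<theta>\<bar> * (A3 * (2 / \<alpha>) * J))"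
        using \<kappa> A3 J0 \<alpha> by (intro ennreal_mult) auto
      also have "ennreal (exp \<bar>\<theta>\<bar> * (A3 * (2 / \<alpha>) * J)) = ennreal (exp \<bar>\<theta>\<bar>) * ennreal (A3 * (2 / \<alpha>) * J)"
        using A3 J0 \<alpha> by (intro ennreal_mult) auto
      also have "ennreal (A3 * (2 / \<alpha>) * J) = ennreal (A3 * (2 / \<alpha>)) * ennreal J"
        using A3 J0 \<alpha> by (intro ennreal_mult) auto
      finally show ?thesis by (simp only: mult.assoc)
    qed
    finally have Wb: "emeasure \<mu> W \<le> ennreal (\<kappa> * (exp \<bar>\<theta>\<bar> * (A3 * (2 / \<alpha>) * J))) * I" .
    have "emeasure \<mu> S \<le> emeasure \<mu> (U \<union> W)" by (intro emeasure_mono) (auto simp: W_def sets_\<mu>)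
    also have "\<dots> \<le> emeasure \<mu> U + emeasure \<mu> W" by (intro emeasure_subadditive) (auto simp: sets_\<mu>)
    also have "\<dots> \<le> ennreal (A1 / l) * I + ennreal (\<kappa> * (exp \<bar>\<theta>\<bar> * (A3 * (2 / \<alpha>) * J))) * I"
      by (intro add_mono U1 Wb)
    also have "\<dots> = (ennreal (A1 / l) + ennreal (\<kappa> * (exp \<bar>\<theta>\<bar> * (A3 * (2 / \<alpha>) * J)))) * I" by (simp only: distrib_right)
    also have "\<dots> = ennreal (A1 / l + \<kappa> * (exp \<bar>\<theta>\<bar> * (A3 * (2 / \<alpha>) * J))) * I"
      using A1 l \<kappa> A3 \<alpha> J0 by (subst ennreal_plus) auto
    also have "\<dots> \<le> ennreal (A / \<alpha>) * I"
    proof (intro mult_right_mono ennreal_leI)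
      have "A1 / l + \<kappa> * (exp \<bar>\<theta>\<bar> * (A3 * (2 / \<alpha>) * J)) = (A - 1) / \<alpha>"
        using \<alpha> A2 by (simp add: l_def A_def field_simps)
      also have "\<dots> \<le> A / \<alpha>" using \<alpha> by (intro divide_right_mono) auto
      finally show "A1 / l + \<kappa> * (exp \<bar>\<theta>\<bar> * (A3 * (2 / \<alpha>) * J)) \<le> A / \<alpha>" .
    qed auto
    finally show ?thesis by (simp add: S_def I_def)
  qed
  then show ?thesis using A by blast
qed

end

section \<open>Interpolation and continuity\<close>

text \<open>Negative exponents above \<open>-1\<close> are included because the interpolation uses
  \<open>\<beta> powr (p - 2)\<close> with \<open>p\<close> possibly below \<open>2\<close>.\<close>

lemma nn_integral_powr_interval:
  assumes q: "q > -1" and b: "b \<ge> 0"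
  shows "(\<integral>\<^sup>+\<beta>. ennreal (\<beta> powr q) * indicator {0<..<b} \<beta> \<partial>lborel) = ennreal (b powr (q + 1) / (q + 1))"
proof -
  have "(\<integral>\<^sup>+\<beta>. ennreal (\<beta> powr q) * indicator {0<..<b} \<beta> \<partial>lborel) = (\<integral>\<^sup>+\<beta>. ennreal (\<beta> powr q) * indicator {0..b} \<beta> \<partial>lborel)"
  proof (rule nn_integral_cong_AE)
    have "AE \<beta> in lborel. \<beta> \<noteq> 0" "AE \<beta> in lborel. \<beta> \<noteq> b" by (rule AE_lborel_singleton)+
    then show "AE \<beta> in lborel. ennreal (\<beta> powr q) * indicator {0<..<b} \<beta> = ennreal (\<beta> powr q) * indicator {0..b} \<beta>"
      by eventually_elim (auto simp: indicator_def)
  qed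
  also have "\<dots> = ennreal (b powr (q + 1) / (q + 1))"
    by (rule nn_integral_has_integral_lebesgue'[OF _ has_integral_powr_from_0[OF q b]]) simp
  finally show ?thesis .
qed

lemma ennpow_mono: "x \<le> y \<Longrightarrow> 0 < p \<Longrightarrow> ennpow x p \<le> ennpow y p"
  by (auto simp: ennpow_def top_unique less_top[symmetric] intro!: ennreal_leI powr_mono2 enn2real_mono)

text \<open>It is enough to test finite \<open>b \<le> h\<close>: the interval below
  \<open>b\<close> already carries \<open>b powr p\<close>. Only this inequality between power and
  layer integral enters the interpolation.\<close>

lemma ennpow_le_layer_cake:
  assumes p: "p > 0"
  shows "ennpow h p \<le> (\<integral>\<^sup>+\<beta>. ennreal (p * \<beta> powr (p - 1)) * indicator {\<beta>. 0 < \<beta> \<and> ennreal \<beta> < h} \<beta> \<partial>lborel)" (is "_ \<le> ?I")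
proof -
  have fin: "ennreal (b powr p) \<le> ?I" if b: "b \<ge> 0" "ennreal b \<le> h" for b
  proof -
    have "ennreal (b powr p) = ennreal p * ennreal (b powr (p - 1 + 1) / (p - 1 + 1))"
      using p by (simp add: ennreal_mult[symmetric])
    also have "\<dots> = ennreal p * (\<integral>\<^sup>+\<beta>. ennreal (\<beta> powr (p - 1)) * indicator {0<..<b} \<beta> \<partial>lborel)"
      using p b by (subst nn_integral_powr_interval) auto
    also have "\<dots> = (\<integral>\<^sup>+\<beta>. ennreal p * (ennreal (\<beta> powr (p - 1)) * indicator {0<..<b} \<beta>) \<partial>lborel)"
      by (rule nn_integral_cmult[symmetric]) measurable
    also have "\<dots> \<le> ?I"
    proof (rule nn_integral_mono)
      fix \<beta> :: real
      show "ennreal p * (ennreal (\<beta> powr (p - 1)) * indicator {0<..<b} \<beta>) \<le> ennreal (p * \<beta> powr (p - 1)) * indicator {\<beta>. 0 < \<beta> \<and> ennreal \<beta> < h} \<beta>"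
      proof (cases "\<beta> \<in> {0<..<b}")
        case True
        then have "ennreal \<beta> < ennreal b" by (simp add: ennreal_less_iff)
        then show ?thesis using True b p by (simp add: ennreal_mult)
      qed simp
    qed
    finally show ?thesis .
  qed
  show ?thesis
  proof (cases h)
    case (real r)
    then show ?thesis using fin[of r] by (simp add: ennpow_def)
  next
    case top
    have "?I = top"
    proof (rule ccontr)
      assume "?I \<noteq> top"
      then obtain r where r: "r \<ge> 0" "?I = ennreal r" by (cases ?I) auto
      \<comment> \<open>A level whose \<open>p\<close>-th power is \<open>r + 1\<close> contradicts
        the assumed finite value \<open>r\<close>.\<close>
      have "ennreal (((r + 1) powr (1 / p)) powr p) \<le> ?I" using top by (intro fin) auto
      then have "(r + 1) powr 1 \<le> r" using r p by (simp add: powr_powr)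
      then show False using r by simp
    qed
    then show ?thesis by simp
  qed
qed

context ou_kernel
begin

section \<open>Sublinearity, the bound for bounded functions, and Marcinkiewicz
  interpolation\<close>

lemma T_mono_AE:
  assumes "t > 0" "AE u in \<mu>. f u \<le> h u"
  shows "T t f x \<le> T t h x"
  unfolding T_def using assms(2)
  by (intro nn_integral_mono_AE) (auto elim!: eventually_mono intro!: ennreal_leI mult_left_mono k_nonneg assms(1))

text \<open>Integrating the kernel against a constant is uniformly bounded in \<open>t\<close> and
  \<open>x\<close>, so the bound holds at every point even though the hypothesis on \<open>f\<close>
  is only almost everywhere.\<close>

lemma N_bounded: "\<exists>A\<ge>0. \<forall>f b. (AE u in \<mu>. f u \<le> b) \<longrightarrow> (\<forall>x. N f x \<le> ennreal A * ennreal b)"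
proof -
  obtain A where A: "A \<ge> 0" "\<And>t x. t > 0 \<Longrightarrow> T t (\<lambda>_. 1) x \<le> ennreal A" using T_1_bound by blast
  have "N f x \<le> ennreal A * ennreal b" if f: "AE u in \<mu>. f u \<le> b" for f b x
    unfolding N_def
  proof (rule SUP_least)
    fix t :: real assume "t \<in> {0<..}"
    then have t: "t > 0" by simp
    have "T t f x \<le> T t (\<lambda>_. b) x" by (rule T_mono_AE[OF t f])
    also have "\<dots> = (\<integral>\<^sup>+u. ennreal (k t x u * 1) * ennreal b \<partial>\<mu>)"
      unfolding T_def using k_nonneg[OF t] by (intro nn_integral_cong) (simp add: ennreal_mult')
    also have "\<dots> = T t (\<lambda>_. 1) x * ennreal b"
      unfolding T_def by (rule nn_integral_multc) (use t in measurable)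
    also have "\<dots> \<le> ennreal A * ennreal b" by (intro mult_right_mono A t) auto
    finally show "T t f x \<le> ennreal A * ennreal b" .
  qed
  then show ?thesis using A(1) by blast
qed

lemma N_subadditive:
  assumes [measurable]: "f1 \<in> borel_measurable borel" "f2 \<in> borel_measurable borel"
    and nn: "\<And>u. 0 \<le> f1 u" "\<And>u. 0 \<le> f2 u"
  shows "N (\<lambda>u. f1 u + f2 u) x \<le> N f1 x + N f2 x"
  unfolding N_def[of "\<lambda>u. f1 u + f2 u"]
proof (rule SUP_least)
  fix t :: real assume "t \<in> {0<..}"
  then have t: "t > 0" by simp
  have "T t (\<lambda>u. f1 u + f2 u) x = (\<integral>\<^sup>+u. ennreal (k t x u * f1 u) + ennreal (k t x u * f2 u) \<partial>\<mu>)"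
    unfolding T_def using k_nonneg[OF t] nn by (intro nn_integral_cong) (simp add: distrib_left ennreal_plus[symmetric] del: ennreal_plus)
  also have "\<dots> = T t f1 x + T t f2 x"
    unfolding T_def by (rule nn_integral_add) (use t in measurable)
  also have "\<dots> \<le> N f1 x + N f2 x"
    unfolding N_def using t by (intro add_mono SUP_upper) auto
  finally show "T t (\<lambda>u. f1 u + f2 u) x \<le> N f1 x + N f2 x" .
qed

lemma measurable_N [measurable]: "f \<in> borel_measurable borel \<Longrightarrow> N f \<in> borel_measurable borel"
  by (rule borel_measurableI_greater) (auto intro: borel_open open_superlevel_N)

text \<open>Marcinkiewicz's argument: at level \<open>\<beta>\<close> the part of \<open>f\<close>
  below \<open>a \<beta>\<close> cannot lift \<open>N\<close> above \<open>\<beta> / 2\<close>, so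
  the weak type bound is applied to the part above \<open>a \<beta>\<close> alone, and integration
  over \<open>\<beta>\<close> gives the power.\<close>

lemma strong_type:
  assumes p: "p > 1"
  shows "\<exists>A\<ge>0. \<forall>f. f \<in> borel_measurable borel \<longrightarrow> (\<forall>u. 0 \<le> f u) \<longrightarrow>
     (\<integral>\<^sup>+x. ennpow (N f x) p \<partial>\<mu>) \<le> ennreal A * (\<integral>\<^sup>+u. ennreal (f u powr p) \<partial>\<mu>)"
proof -
  obtain A where A: "A > 0" "\<And>f \<alpha>. f \<in> borel_measurable borel \<Longrightarrow> (\<And>u. 0 \<le> f u) \<Longrightarrow> 0 < \<alpha> \<Longrightarrow>
     emeasure \<mu> {x. ennreal \<alpha> < N f x} \<le> ennreal (A / \<alpha>) * (\<integral>\<^sup>+u. ennreal (f u) \<partial>\<mu>)"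
    using weak_type by blast
  obtain A0 where A0: "A0 \<ge> 0" "\<And>f b x. (AE u in \<mu>. f u \<le> b) \<Longrightarrow> N f x \<le> ennreal A0 * ennreal b"
    using N_bounded by blast
  \<comment> \<open>Ensures \<open>A0 a \<le> 1 / 2\<close>; adding \<open>1\<close> keeps the
    denominator positive when \<open>A0 = 0\<close>.\<close>
  define a where "a = 1 / (2 * (A0 + 1))"
  have a: "a > 0" "A0 * a \<le> 1 / 2" using A0 by (auto simp: a_def field_simps)
  \<comment> \<open>The constant left by integrating \<open>2 A p \<beta>^(p-2)\<close> over
    \<open>0 < \<beta> < f u / a\<close> and multiplying by \<open>f u\<close>.\<close>
  define B where "B = 2 * A * p / (p - 1) * (1 / a) powr (p - 1)"
  have B: "B \<ge> 0" using A p a by (simp add: B_def)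
  have "(\<integral>\<^sup>+x. ennpow (N f x) p \<partial>\<mu>) \<le> ennreal B * (\<integral>\<^sup>+u. ennreal (f u powr p) \<partial>\<mu>)"
    if f [measurable]: "f \<in> borel_measurable borel" and f0: "\<And>u. 0 \<le> f u" for f
  proof -
    define w where "w = (\<lambda>x. ennreal (\<kappa> * exp (R x)))"
    have [measurable]: "w \<in> borel_measurable borel" unfolding w_def by measurable
    have \<mu>w: "(\<integral>\<^sup>+x. h x \<partial>\<mu>) = (\<integral>\<^sup>+x. w x * h x \<partial>lborel)" if "h \<in> borel_measurable borel" for h
      unfolding w_def using that by (rule nn_integral_\<mu>)
    have level: "emeasure \<mu> {x. ennreal \<beta> < N f x} \<le> ennreal (2 * A / \<beta>) * (\<integral>\<^sup>+u. (if a * \<beta> < f u then ennreal (f u) else 0) \<partial>\<mu>)"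
      if \<beta>: "\<beta> > 0" for \<beta>
    proof -
      define f1 f2 where "f1 = (\<lambda>u. if a * \<beta> < f u then f u else 0)" and "f2 = (\<lambda>u. if a * \<beta> < f u then 0 else f u)"
      have [measurable]: "f1 \<in> borel_measurable borel" "f2 \<in> borel_measurable borel" unfolding f1_def f2_def by measurable
      have nn: "0 \<le> f1 u" "0 \<le> f2 u" for u using f0 by (auto simp: f1_def f2_def)
      have "{x. ennreal \<beta> < N f x} \<subseteq> {x. ennreal (\<beta> / 2) < N f1 x}"
      proof (rule subsetI, rule ccontr)
        fix x assume x: "x \<in> {x. ennreal \<beta> < N f x}" "x \<notin> {x. ennreal (\<beta> / 2) < N f1 x}"
        have "f = (\<lambda>u. f1 u + f2 u)" by (auto simp: f1_def f2_def)
        then have "N f x \<le> N f1 x + N f2 x" using N_subadditive[of f1 f2 x] nn by simp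
        also have "\<dots> \<le> ennreal (\<beta> / 2) + ennreal (\<beta> / 2)"
        proof (rule add_mono)
          show "N f1 x \<le> ennreal (\<beta> / 2)" using x by simp
          have "N f2 x \<le> ennreal A0 * ennreal (a * \<beta>)"
            using a \<beta> by (intro A0) (auto simp: f2_def)
          also have "\<dots> = ennreal (A0 * a * \<beta>)" using A0 a \<beta> by (simp add: ennreal_mult[symmetric] mult.assoc)
          also have "\<dots> \<le> ennreal (\<beta> / 2)"
            using mult_right_mono[OF a(2), of \<beta>] \<beta> by (intro ennreal_leI) simp
          finally show "N f2 x \<le> ennreal (\<beta> / 2)" .
        qed
        also have "\<dots> = ennreal \<beta>" using \<beta> by (simp add: ennreal_plus[symmetric] del: ennreal_plus)
        finally show False using x by simp
      qed
      then have "emeasure \<mu> {x. ennreal \<beta> < N f x} \<le> emeasure \<mu> {x. ennreal (\<beta> / 2) < N f1 x}"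
        by (intro emeasure_mono) (auto simp: sets_\<mu> intro!: borel_open open_superlevel_N)
      also have "\<dots> \<le> ennreal (A / (\<beta> / 2)) * (\<integral>\<^sup>+u. ennreal (f1 u) \<partial>\<mu>)"
        using \<beta> nn by (intro A) auto
      also have "A / (\<beta> / 2) = 2 * A / \<beta>" by simp
      also have "(\<integral>\<^sup>+u. ennreal (f1 u) \<partial>\<mu>) = (\<integral>\<^sup>+u. (if a * \<beta> < f u then ennreal (f u) else 0) \<partial>\<mu>)"
        by (intro nn_integral_cong) (auto simp: f1_def)
      finally show ?thesis .
    qed
    have "(\<integral>\<^sup>+x. ennpow (N f x) p \<partial>\<mu>) \<le> (\<integral>\<^sup>+x. (\<integral>\<^sup>+\<beta>. ennreal (p * \<beta> powr (p - 1)) * indicator {\<beta>. 0 < \<beta> \<and> ennreal \<beta> < N f x} \<beta> \<partial>lborel) \<partial>\<mu>)"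
      using p by (intro nn_integral_mono ennpow_le_layer_cake) auto
    also have "\<dots> = (\<integral>\<^sup>+x. (\<integral>\<^sup>+\<beta>. (if 0 < \<beta> \<and> ennreal \<beta> < N f x then ennreal (p * \<beta> powr (p - 1)) else 0) \<partial>lborel) \<partial>\<mu>)"
      by (intro nn_integral_cong) (auto simp: indicator_def)
    also have "\<dots> = (\<integral>\<^sup>+x. w x * (\<integral>\<^sup>+\<beta>. (if 0 < \<beta> \<and> ennreal \<beta> < N f x then ennreal (p * \<beta> powr (p - 1)) else 0) \<partial>lborel) \<partial>lborel)"
      by (rule \<mu>w) measurable
    also have "\<dots> = (\<integral>\<^sup>+x. (\<integral>\<^sup>+\<beta>. w x * (if 0 < \<beta> \<and> ennreal \<beta> < N f x then ennreal (p * \<beta> powr (p - 1)) else 0) \<partial>lborel) \<partial>lborel)"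
      by (intro nn_integral_cong nn_integral_cmult[symmetric]) measurable
    also have "\<dots> = (\<integral>\<^sup>+\<beta>. (\<integral>\<^sup>+x. w x * (if 0 < \<beta> \<and> ennreal \<beta> < N f x then ennreal (p * \<beta> powr (p - 1)) else 0) \<partial>lborel) \<partial>lborel)"
      by (rule lborel_pair.Fubini') measurable
    also have "\<dots> \<le> (\<integral>\<^sup>+\<beta>. (\<integral>\<^sup>+u. w u * (if 0 < \<beta> \<and> a * \<beta> < f u then ennreal (2 * A * p * \<beta> powr (p - 2)) * ennreal (f u) else 0) \<partial>lborel) \<partial>lborel)"
    proof (rule nn_integral_mono)
      fix \<beta> :: real
      show "(\<integral>\<^sup>+x. w x * (if 0 < \<beta> \<and> ennreal \<beta> < N f x then ennreal (p * \<beta> powr (p - 1)) else 0) \<partial>lborel)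
          \<le> (\<integral>\<^sup>+u. w u * (if 0 < \<beta> \<and> a * \<beta> < f u then ennreal (2 * A * p * \<beta> powr (p - 2)) * ennreal (f u) else 0) \<partial>lborel)"
      proof (cases "0 < \<beta>")
        case True
        have S [measurable]: "{x. ennreal \<beta> < N f x} \<in> sets borel" by (intro borel_open open_superlevel_N f)
        have "(\<integral>\<^sup>+x. w x * (if 0 < \<beta> \<and> ennreal \<beta> < N f x then ennreal (p * \<beta> powr (p - 1)) else 0) \<partial>lborel) =
            (\<integral>\<^sup>+x. (if 0 < \<beta> \<and> ennreal \<beta> < N f x then ennreal (p * \<beta> powr (p - 1)) else 0) \<partial>\<mu>)"
          by (rule \<mu>w[symmetric]) measurable
        also have "\<dots> = (\<integral>\<^sup>+x. ennreal (p * \<beta> powr (p - 1)) * indicator {x. ennreal \<beta> < N f x} x \<partial>\<mu>)"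
          using True by (intro nn_integral_cong) (auto simp: indicator_def)
        also have "\<dots> = ennreal (p * \<beta> powr (p - 1)) * emeasure \<mu> {x. ennreal \<beta> < N f x}"
          by (rule nn_integral_cmult_indicator) (simp add: sets_\<mu> S)
        also have "\<dots> \<le> ennreal (p * \<beta> powr (p - 1)) * (ennreal (2 * A / \<beta>) * (\<integral>\<^sup>+u. (if a * \<beta> < f u then ennreal (f u) else 0) \<partial>\<mu>))"
          by (intro mult_left_mono level True) auto
        also have "\<dots> = ennreal (p * \<beta> powr (p - 1) * (2 * A / \<beta>)) * (\<integral>\<^sup>+u. (if a * \<beta> < f u then ennreal (f u) else 0) \<partial>\<mu>)"
          using True A p by (simp add: mult.assoc[symmetric] ennreal_mult[symmetric])
        also have "p * \<beta> powr (p - 1) * (2 * A / \<beta>) = 2 * A * p * \<beta> powr (p - 2)"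
        proof -
          have "\<beta> powr (p - 1) = \<beta> powr (p - 2) * \<beta>"
            using True powr_add[of \<beta> "p - 2" 1] by simp
          then show ?thesis using True by simp
        qed
        also have "ennreal (2 * A * p * \<beta> powr (p - 2)) * (\<integral>\<^sup>+u. (if a * \<beta> < f u then ennreal (f u) else 0) \<partial>\<mu>) =
            (\<integral>\<^sup>+u. ennreal (2 * A * p * \<beta> powr (p - 2)) * (if a * \<beta> < f u then ennreal (f u) else 0) \<partial>\<mu>)"
          by (rule nn_integral_cmult[symmetric]) measurable
        also have "\<dots> = (\<integral>\<^sup>+u. (if 0 < \<beta> \<and> a * \<beta> < f u then ennreal (2 * A * p * \<beta> powr (p - 2)) * ennreal (f u) else 0) \<partial>\<mu>)"
          using True by (intro nn_integral_cong) auto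
        also have "\<dots> = (\<integral>\<^sup>+u. w u * (if 0 < \<beta> \<and> a * \<beta> < f u then ennreal (2 * A * p * \<beta> powr (p - 2)) * ennreal (f u) else 0) \<partial>lborel)"
          by (rule \<mu>w) measurable
        finally show ?thesis by simp
      qed simp
    qed
    also have "\<dots> = (\<integral>\<^sup>+u. (\<integral>\<^sup>+\<beta>. w u * (if 0 < \<beta> \<and> a * \<beta> < f u then ennreal (2 * A * p * \<beta> powr (p - 2)) * ennreal (f u) else 0) \<partial>lborel) \<partial>lborel)"
      by (rule lborel_pair.Fubini') measurable
    also have "\<dots> = (\<integral>\<^sup>+u. w u * (ennreal B * ennreal (f u powr p)) \<partial>lborel)"
    proof (rule nn_integral_cong)
      fix u
      have b: "f u / a \<ge> 0" using f0 a by simp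
      have "(\<integral>\<^sup>+\<beta>. w u * (if 0 < \<beta> \<and> a * \<beta> < f u then ennreal (2 * A * p * \<beta> powr (p - 2)) * ennreal (f u) else 0) \<partial>lborel) =
          (\<integral>\<^sup>+\<beta>. (w u * (ennreal (f u) * ennreal (2 * A * p))) * (ennreal (\<beta> powr (p - 2)) * indicator {0<..<f u / a} \<beta>) \<partial>lborel)"
      proof (rule nn_integral_cong)
        fix \<beta> :: real
        have "ennreal (2 * A * p * \<beta> powr (p - 2)) = ennreal (2 * A * p) * ennreal (\<beta> powr (p - 2))"
          using A p by (intro ennreal_mult) auto
        moreover have iff: "0 < \<beta> \<and> a * \<beta> < f u \<longleftrightarrow> \<beta> \<in> {0<..<f u / a}" using a by (auto simp: field_simps)
        ultimately show "w u * (if 0 < \<beta> \<and> a * \<beta> < f u then ennreal (2 * A * p * \<beta> powr (p - 2)) * ennreal (f u) else 0) =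
            (w u * (ennreal (f u) * ennreal (2 * A * p))) * (ennreal (\<beta> powr (p - 2)) * indicator {0<..<f u / a} \<beta>)"
          unfolding iff by (simp add: indicator_def mult_ac)
      qed
      also have "\<dots> = (w u * (ennreal (f u) * ennreal (2 * A * p))) * (\<integral>\<^sup>+\<beta>. ennreal (\<beta> powr (p - 2)) * indicator {0<..<f u / a} \<beta> \<partial>lborel)"
        by (rule nn_integral_cmult) measurable
      also have "(\<integral>\<^sup>+\<beta>. ennreal (\<beta> powr (p - 2)) * indicator {0<..<f u / a} \<beta> \<partial>lborel) = ennreal ((f u / a) powr (p - 2 + 1) / (p - 2 + 1))"
        using p b by (intro nn_integral_powr_interval) auto
      also have "(w u * (ennreal (f u) * ennreal (2 * A * p))) * ennreal ((f u / a) powr (p - 2 + 1) / (p - 2 + 1)) =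
          w u * ennreal (f u * (2 * A * p) * ((f u / a) powr (p - 1) / (p - 1)))"
        using f0[of u] A p by (simp add: ennreal_mult[symmetric] mult.assoc)
      also have "f u * (2 * A * p) * ((f u / a) powr (p - 1) / (p - 1)) = B * f u powr p"
      proof (cases "f u = 0")
        case False
        then have fu: "f u > 0" using f0[of u] by simp
        have "(f u / a) powr (p - 1) = f u powr (p - 1) * (1 / a) powr (p - 1)"
          using fu a powr_mult[of "f u" "1 / a" "p - 1"] by simp
        moreover have "f u powr p = f u * f u powr (p - 1)" using fu powr_add[of "f u" 1 "p - 1"] by simp
        ultimately show ?thesis by (simp add: B_def)
      qed (use p in simp)
      also have "ennreal (B * f u powr p) = ennreal B * ennreal (f u powr p)" using B by (intro ennreal_mult) auto
      finally show "(\<integral>\<^sup>+\<beta>. w u * (if 0 < \<beta> \<and> a * \<beta> < f u then ennreal (2 * A * p * \<beta> powr (p - 2)) * ennreal (f u) else 0) \<partial>lborel) =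
          w u * (ennreal B * ennreal (f u powr p))" .
    qed
    also have "\<dots> = (\<integral>\<^sup>+u. ennreal B * ennreal (f u powr p) \<partial>\<mu>)" by (rule \<mu>w[symmetric]) measurable
    also have "\<dots> = ennreal B * (\<integral>\<^sup>+u. ennreal (f u powr p) \<partial>\<mu>)" by (rule nn_integral_cmult) measurable
    finally show ?thesis .
  qed
  then show ?thesis using B by blast
qed

text \<open>For one fixed time both ranges of \<open>t\<close> take a common form: an integrable
  bound with the weight at \<open>u\<close>, and a bound uniform in \<open>u\<close>. They serve as
  dominating functions in the continuity argument.\<close>

lemma kernel_majorants:
  assumes t: "t > 0"
  shows "\<exists>s B. s > 0 \<and> B \<ge> 0 \<and> (\<forall>x u. k t x u * exp (R u) \<le> B * s / (s + norm (x - E t *v u)) ^ (CARD('n) + 1) \<and>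
    k t x u \<le> B * exp (- R x))"
proof -
  let ?n = "CARD('n)"
  show ?thesis
  proof (cases "t \<le> 1")
    case True
    have s: "sqrt t > 0" using t by simp
    define B where "B = max C (C / sqrt t ^ ?n)"
    have "k t x u * exp (R u) \<le> B * sqrt t / (sqrt t + norm (x - E t *v u)) ^ (?n + 1)" for x u
      using s by (intro order_trans[OF K2[OF t True]] divide_right_mono mult_right_mono) (auto simp: B_def)
    moreover have "k t x u \<le> B * exp (- R x)" for x u
    proof -
      have "k t x u \<le> C * exp (- R x) / (sqrt t + norm (x - D t *v u)) ^ ?n" by (rule K1[OF t True])
      also have "\<dots> \<le> C * exp (- R x) / sqrt t ^ ?n"
        using C s by (intro divide_left_mono power_mono mult_pos_pos zero_less_power) (auto intro: add_pos_nonneg)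
      also have "\<dots> = C / sqrt t ^ ?n * exp (- R x)" by simp
      also have "\<dots> \<le> B * exp (- R x)" by (intro mult_right_mono) (auto simp: B_def)
      finally show ?thesis .
    qed
    moreover have "B \<ge> 0" using C by (simp add: B_def le_max_iff_disj)
    ultimately show ?thesis using s by blast
  next
    case False
    then have t1: "1 \<le> t" by simp
    define B where "B = C * exp (- \<theta> * t)"
    have B: "B \<ge> 0" using C by (simp add: B_def)
    have "k t x u * exp (R u) \<le> B * 1 / (1 + norm (x - E t *v u)) ^ (?n + 1)" for x u
      using K4[OF t1] by (simp add: B_def)
    moreover have "k t x u \<le> B * exp (- R x)" for x u
    proof -
      have "k t x u \<le> C * exp (- R x) * exp (- \<theta> * t) / (1 + norm (D (- t) *v x - u)) ^ (?n + 1)" by (rule K3[OF t1])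
      also have "\<dots> \<le> C * exp (- R x) * exp (- \<theta> * t) / 1"
      proof -
        have "1 \<le> (1 + norm (D (- t) *v x - u)) ^ (?n + 1)" by (intro one_le_power) simp
        then show ?thesis using C by (intro divide_left_mono) auto
      qed
      finally show ?thesis by (simp add: B_def mult_ac)
    qed
    ultimately show ?thesis using B by (intro exI[of _ 1] exI[of _ B]) auto
  qed
qed

text \<open>Dominated convergence near each point; continuity at fixed times makes the supremum over
  uncountably many times measurable. The hypothesis \<open>\<bar>f u\<bar> \<le> A + h u\<close>
  covers all exponents at once: the constant is paired with the integrable majorant of the kernel,
  and \<open>h\<close> with its uniform bound.\<close>

lemma continuous_on_semigroup:
  assumes t: "t > 0" and f [measurable]: "f \<in> borel_measurable borel"
    and h: "integrable \<mu> h" and fh: "AE u in \<mu>. \<bar>f u\<bar> \<le> A + h u"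
  shows "continuous_on UNIV (\<lambda>x. \<integral>u. k t x u * f u \<partial>\<mu>)"
  unfolding continuous_on_eq_continuous_at[OF open_UNIV]
proof (intro ballI)
  let ?n = "CARD('n)"
  fix x0 :: "real^'n"
  obtain s B where s: "s > 0" and B: "B \<ge> 0"
    and k1: "\<And>x u. k t x u * exp (R u) \<le> B * s / (s + norm (x - E t *v u)) ^ (?n + 1)"
    and k2: "\<And>x u. k t x u \<le> B * exp (- R x)"
    using kernel_majorants[OF t] by blast
  \<comment> \<open>Moving \<open>x\<close> within distance \<open>1\<close> of \<open>x0\<close>
    changes the norm in the denominator by at most \<open>1\<close>, which the factor
    \<open>1 + 1 / s\<close> absorbs.\<close>
  define B1 where "B1 = B * (1 + 1 / s) ^ (?n + 1)"
  have B1: "B1 \<ge> 0" using B s by (simp add: B1_def)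
  define G where "G = (\<lambda>u. B1 * (s / (s + norm (E t *v u - x0)) ^ (?n + 1)) * exp (- R u))"
  have G0: "G u \<ge> 0" for u using B1 s by (simp add: G_def)
  have [measurable]: "G \<in> borel_measurable borel" unfolding G_def by measurable
  have kG: "k t x u \<le> G u" if x: "norm (x - x0) \<le> 1" for x u
  proof -
    define y y0 where "y = norm (x - E t *v u)" and "y0 = norm (E t *v u - x0)"
    have "y0 \<le> y + 1"
      using norm_triangle_ineq[of "E t *v u - x" "x - x0"] x by (simp add: y_def y0_def norm_minus_commute)
    moreover have "0 \<le> y / s" using s by (simp add: y_def)
    moreover have "(1 + 1 / s) * (s + y) = s + y + 1 + y / s" using s by (simp add: field_simps)
    ultimately have le: "s + y0 \<le> (1 + 1 / s) * (s + y)" by linarith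
    have y: "y \<ge> 0" "y0 \<ge> 0" by (simp_all add: y_def y0_def)
    have s1: "1 + 1 / s > 0" using s by (simp add: add_pos_pos)
    have "s / (s + y) ^ (?n + 1) = (1 + 1 / s) ^ (?n + 1) * (s / ((1 + 1 / s) * (s + y)) ^ (?n + 1))"
      using s1 by (simp add: power_mult_distrib del: power_Suc)
    also have "\<dots> \<le> (1 + 1 / s) ^ (?n + 1) * (s / (s + y0) ^ (?n + 1))"
      using s s1 y le by (intro mult_left_mono divide_left_mono power_mono mult_pos_pos zero_less_power) auto
    finally have "B * (s / (s + y) ^ (?n + 1)) \<le> B * ((1 + 1 / s) ^ (?n + 1) * (s / (s + y0) ^ (?n + 1)))"
      using B by (rule mult_left_mono)
    then have "k t x u * exp (R u) \<le> B1 * (s / (s + y0) ^ (?n + 1))"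
      using k1[of x u] by (simp add: B1_def y_def mult.assoc)
    then have "k t x u * exp (R u) * exp (- R u) \<le> B1 * (s / (s + y0) ^ (?n + 1)) * exp (- R u)" by (rule mult_right_mono) simp
    then show ?thesis by (simp add: G_def y0_def mult.assoc exp_add[symmetric])
  qed
  have Gint: "integrable \<mu> G"
  proof (rule integrableI_bounded)
    show "G \<in> borel_measurable \<mu>" by measurable
    have "(\<integral>\<^sup>+u. ennreal (norm (G u)) \<partial>\<mu>) = (\<integral>\<^sup>+u. ennreal (\<kappa> * exp (R u)) * ennreal (G u) \<partial>lborel)"
      using G0 by (simp add: nn_integral_\<mu>)
    also have "\<dots> = (\<integral>\<^sup>+u. ennreal (\<kappa> * B1) * ennreal (s / (s + norm (E t *v u - x0)) ^ (?n + 1)) \<partial>lborel)"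
    proof (rule nn_integral_cong)
      fix u
      define q where "q = s / (s + norm (E t *v u - x0)) ^ (?n + 1)"
      have q: "q \<ge> 0" using s by (simp add: q_def)
      have "ennreal (\<kappa> * exp (R u)) * ennreal (G u) = ennreal (\<kappa> * exp (R u) * G u)"
        using \<kappa> G0 by (intro ennreal_mult[symmetric]) auto
      also have "\<kappa> * exp (R u) * G u = \<kappa> * B1 * q" by (simp add: G_def q_def exp_minus)
      also have "ennreal (\<kappa> * B1 * q) = ennreal (\<kappa> * B1) * ennreal q" using \<kappa> B1 q by (intro ennreal_mult) auto
      finally show "ennreal (\<kappa> * exp (R u)) * ennreal (G u) = ennreal (\<kappa> * B1) * ennreal (s / (s + norm (E t *v u - x0)) ^ (?n + 1))"
        by (simp only: q_def)
    qed
    also have "\<dots> = ennreal (\<kappa> * B1) * (\<integral>\<^sup>+u. ennreal (s / (s + norm (E t *v u - x0)) ^ (?n + 1)) \<partial>lborel)"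
      by (rule nn_integral_cmult) measurable
    also have "(\<integral>\<^sup>+u. ennreal (s / (s + norm (E t *v u - x0)) ^ (?n + 1)) \<partial>lborel) =
        ennreal (1 / \<bar>det (E t)\<bar>) * (\<integral>\<^sup>+v. ennreal (s / (s + norm (v - x0)) ^ (?n + 1)) \<partial>lborel)"
      by (rule nn_integral_compose_linear) (auto simp: det_E)
    also have "ennreal (\<kappa> * B1) * \<dots> < \<infinity>"
    proof -
      have "(\<integral>\<^sup>+v. ennreal (s / (s + norm (v - x0)) ^ (?n + 1)) \<partial>lborel) < \<infinity>"
        by (rule order_le_less_trans[OF rational_kernel_integral[OF s]]) simp
      then show ?thesis by (simp add: ennreal_mult_less_top)
    qed
    finally show "(\<integral>\<^sup>+u. ennreal (norm (G u)) \<partial>\<mu>) < \<infinity>" .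
  qed
  \<comment> \<open>Bounds \<open>B * exp (- R x)\<close> over the unit ball around
    \<open>x0\<close>, by the local variation of \<open>R\<close>.\<close>
  define K where "K = B * exp (C * (2 * norm x0 + 1) - R x0)"
  have kK: "k t x u \<le> K" if x: "norm (x - x0) \<le> 1" for x u
  proof -
    have "norm x \<le> norm x0 + 1" using norm_triangle_ineq[of x0 "x - x0"] x by simp
    then have "C * norm (x - x0) * (norm x + norm x0) \<le> C * 1 * (2 * norm x0 + 1)"
      using C x by (intro mult_mono mult_left_mono) auto
    then have "- R x \<le> C * (2 * norm x0 + 1) - R x0" using R_near[of x x0] by linarith
    then show ?thesis using k2[of x u] B unfolding K_def
      by (meson exp_le_cancel_iff mult_left_mono order_trans)
  qed
  show "isCont (\<lambda>x. \<integral>u. k t x u * f u \<partial>\<mu>) x0"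
    unfolding continuous_at_sequentially o_def
  proof (intro allI impI)
    fix X assume X: "X \<longlonglongrightarrow> x0"
    then obtain N where N: "\<And>n. n \<ge> N \<Longrightarrow> norm (X n - x0) \<le> 1"
      using LIMSEQ_D[of X x0 1] by (meson less_imp_le zero_less_one)
    show "(\<lambda>n. \<integral>u. k t (X n) u * f u \<partial>\<mu>) \<longlonglongrightarrow> (\<integral>u. k t x0 u * f u \<partial>\<mu>)"
    proof (rule LIMSEQ_offset[where k = N], rule integral_dominated_convergence)
      show "(\<lambda>u. k t x0 u * f u) \<in> borel_measurable \<mu>" using t by measurable
      show "(\<lambda>u. k t (X (n + N)) u * f u) \<in> borel_measurable \<mu>" for n using t by measurable
      show "integrable \<mu> (\<lambda>u. \<bar>A\<bar> * G u + K * \<bar>h u\<bar>)"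
        by (intro Bochner_Integration.integrable_add integrable_mult_right integrable_abs Gint h)
      show "AE u in \<mu>. (\<lambda>n. k t (X (n + N)) u * f u) \<longlonglongrightarrow> k t x0 u * f u"
      proof (intro AE_I2 tendsto_mult tendsto_const)
        fix u
        have "isCont (\<lambda>(x, u). k t x u) (x0, u)"
          using k_cont[OF t] by (simp add: continuous_on_eq_continuous_at)
        moreover have "(\<lambda>n. (X (n + N), u)) \<longlonglongrightarrow> (x0, u)"
          by (intro tendsto_intros LIMSEQ_ignore_initial_segment X)
        ultimately have "(\<lambda>n. (\<lambda>(x, u). k t x u) (X (n + N), u)) \<longlonglongrightarrow> (\<lambda>(x, u). k t x u) (x0, u)"
          by (rule isCont_tendsto_compose)
        then show "(\<lambda>n. k t (X (n + N)) u) \<longlonglongrightarrow> k t x0 u" by simp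
      qed
      fix n
      show "AE u in \<mu>. norm (k t (X (n + N)) u * f u) \<le> \<bar>A\<bar> * G u + K * \<bar>h u\<bar>"
        using fh
      proof eventually_elim
        case (elim u)
        define \<xi> where "\<xi> = k t (X (n + N)) u"
        have \<xi>: "0 \<le> \<xi>" "\<xi> \<le> G u" "\<xi> \<le> K"
          using k_nonneg[OF t] kG[OF N] kK[OF N] by (auto simp: \<xi>_def)
        have "norm (\<xi> * f u) = \<xi> * \<bar>f u\<bar>" using \<xi> by (simp add: abs_mult)
        also have "\<dots> \<le> \<xi> * (\<bar>A\<bar> + \<bar>h u\<bar>)" using elim \<xi> by (intro mult_left_mono) auto
        also have "\<dots> = \<bar>A\<bar> * \<xi> + \<xi> * \<bar>h u\<bar>" by (simp add: algebra_simps)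
        also have "\<dots> \<le> \<bar>A\<bar> * G u + K * \<bar>h u\<bar>" using \<xi> by (intro add_mono mult_left_mono mult_right_mono) auto
        finally show ?case by (simp add: \<xi>_def)
      qed
    qed
  qed
qed

end

section \<open>The theorem\<close>

lemma (in stable_pair) ou_kernel_KUO:
  "\<exists>C c. ou_kernel (Dt Q B) E R (KUO Q B) (- trace B) C c ((2*pi) powr (real CARD('n) / 2) * sqrt (det Qi))"
proof -
  obtain C1 where C1: "C1 \<ge> 1" "\<And>s x. \<bar>s\<bar> \<le> 1 \<Longrightarrow> norm (D s *v x) \<le> C1 * norm x"
    "\<And>s x. \<bar>s\<bar> \<le> 1 \<Longrightarrow> norm (D s *v x - x) \<le> C1 * \<bar>s\<bar> * norm x"
    using D_near by blast
  obtain C2 c2 where C2: "C2 \<ge> 1" "c2 > 0" "\<And>s x. s \<ge> 0 \<Longrightarrow> norm (D (- s) *v x) \<le> C2 * exp (- c2 * s) * norm x"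
    using D_decay by blast
  obtain C3 where C3: "C3 \<ge> 1" "\<And>s. \<bar>s\<bar> \<le> 1 \<Longrightarrow> norm (E s - mat 1) \<le> C3 * \<bar>s\<bar>" using E_near by blast
  obtain c4 where c4: "c4 > 0" "\<And>s x. 0 \<le> s \<Longrightarrow> s \<le> 1 \<Longrightarrow> R x + c4 * s * (norm x)\<^sup>2 \<le> R (D s *v x)"
    using R_flow by blast
  obtain C5 where C5: "C5 \<ge> 1" "\<And>x u. \<bar>R u - R x\<bar> \<le> C5 * norm (u - x) * (norm u + norm x)"
    using R_near by blast
  obtain C6 where C6: "C6 \<ge> 0"
    "\<And>t x u. 0 < t \<Longrightarrow> t \<le> 1 \<Longrightarrow> KUO Q B t x u \<le> C6 * exp (- R x) / (sqrt t + norm (x - D t *v u)) ^ CARD('n)"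
    "\<And>t x u. 0 < t \<Longrightarrow> t \<le> 1 \<Longrightarrow> KUO Q B t x u * exp (R u) \<le> C6 * sqrt t / (sqrt t + norm (x - E t *v u)) ^ (CARD('n) + 1)"
    "\<And>t x u. 1 \<le> t \<Longrightarrow> KUO Q B t x u \<le> C6 * exp (- R x) * exp (t * trace B) / (1 + norm (D (- t) *v x - u)) ^ (CARD('n) + 1)"
    "\<And>t x u. 1 \<le> t \<Longrightarrow> KUO Q B t x u * exp (R u) \<le> C6 * exp (t * trace B) / (1 + norm (x - E t *v u)) ^ (CARD('n) + 1)"
    using KUO_bounds by blast
  \<comment> \<open>All summands are nonnegative, so the sum dominates each constant; the rate
    \<open>c\<close> is the smaller of the contraction rate of \<open>D\<close> and the growth rate
    of \<open>R\<close>.\<close>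
  define C where "C = C1 + C2 + C3 + C5 + C6"
  define c where "c = min c2 c4"
  have C: "C1 \<le> C" "C2 \<le> C" "C3 \<le> C" "C5 \<le> C" "C6 \<le> C"
    using C1(1) C2(1) C3(1) C5(1) C6(1) by (auto simp: C_def)
  have c: "c \<le> c2" "c \<le> c4" "c > 0" using C2 c4 by (auto simp: c_def)
  have "ou_kernel (Dt Q B) E R (KUO Q B) (- trace B) C c ((2*pi) powr (real CARD('n) / 2) * sqrt (det Qi))"
  proof
    show "C \<ge> 1" using C(1) C1(1) by simp
    show "c > 0" by (rule c)
    show "(2*pi) powr (real CARD('n) / 2) * sqrt (det Qi) > 0" using P_facts(4) by simp
    show "D 0 = mat 1" by (rule D_0)
    show "D (s + t) = D s ** D t" for s t by (rule D_add)
    show "det (D s) = exp (- trace B * s)" for s by (rule det_D)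
    show "det (E s) = exp (- (- trace B) * s)" for s by (simp add: det_E mult.commute)
    show "continuous_on UNIV (Dt Q B)" by (rule continuous_on_D)
    show "continuous_on UNIV R" by (rule continuous_on_R)
    show "norm (D s *v x) \<le> C * norm x" if "\<bar>s\<bar> \<le> 1" for s x
      by (rule order_trans[OF C1(2)[OF that]]) (intro mult_right_mono C, simp)
    show "norm (D s *v x - x) \<le> C * \<bar>s\<bar> * norm x" if "\<bar>s\<bar> \<le> 1" for s x
      by (rule order_trans[OF C1(3)[OF that]]) (intro mult_right_mono C, auto)
    show "norm (D (- s) *v x) \<le> C * exp (- c * s) * norm x" if "0 \<le> s" for s x
    proof (rule order_trans[OF C2(3)[OF that]], intro mult_right_mono mult_mono C)
      show "exp (- c2 * s) \<le> exp (- c * s)" using c(1) that by (simp add: mult_right_mono)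
    qed (use C C1 in auto)
    show "norm (E s *v x - x) \<le> C * s * norm x" if "0 \<le> s" "s \<le> 1" for s x
    proof -
      have "norm (E s *v x - x) = norm ((E s - mat 1) *v x)" by (simp add: matrix_vector_mult_diff_rdistrib)
      also have "\<dots> \<le> norm (E s - mat 1) * norm x" by (rule norm_matrix_vector_le)
      also have "\<dots> \<le> C3 * \<bar>s\<bar> * norm x" using that by (intro mult_right_mono C3) auto
      also have "\<dots> \<le> C * s * norm x" using that C by (intro mult_right_mono) (auto intro: mult_right_mono)
      finally show ?thesis .
    qed
    show "R x + c * s * (norm x)\<^sup>2 \<le> R (D s *v x)" if "0 \<le> s" "s \<le> 1" for s x
    proof -
      have "c * s * (norm x)\<^sup>2 \<le> c4 * s * (norm x)\<^sup>2" using that c by (intro mult_right_mono) auto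
      then show ?thesis using c4(2)[OF that, of x] by linarith
    qed
    show "\<bar>R u - R x\<bar> \<le> C * norm (u - x) * (norm u + norm x)" for u x
      by (rule order_trans[OF C5(2)]) (intro mult_right_mono C, auto)
    show "0 \<le> KUO Q B t x u" if "0 < t" for t x u using that by (rule KUO_nonneg)
    show "continuous_on UNIV (\<lambda>(x, u). KUO Q B t x u)" if "0 < t" for t
      unfolding KUO_def case_prod_unfold
      by (intro continuous_intros continuous_on_compose2[OF continuous_on_R, of UNIV] bounded_linear.continuous_on[OF matrix_vector_mul_bounded_linear]) auto
    show "KUO Q B t x u \<le> C * exp (- R x) / (sqrt t + norm (x - D t *v u)) ^ CARD('n)" if "0 < t" "t \<le> 1" for t x u
      using that C by (intro order_trans[OF C6(2)[OF that]] divide_right_mono mult_right_mono) auto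
    show "KUO Q B t x u * exp (R u) \<le> C * sqrt t / (sqrt t + norm (x - E t *v u)) ^ (CARD('n) + 1)" if "0 < t" "t \<le> 1" for t x u
      using that C by (intro order_trans[OF C6(3)[OF that]] divide_right_mono mult_right_mono) auto
    show "KUO Q B t x u \<le> C * exp (- R x) * exp (- (- trace B) * t) / (1 + norm (D (- t) *v x - u)) ^ (CARD('n) + 1)" if "1 \<le> t" for t x u
    proof -
      have "- (- trace B) * t = t * trace B" by simp
      then show ?thesis using that C
        by (simp only:) (intro order_trans[OF C6(4)[OF that]] divide_right_mono mult_right_mono, auto)
    qed
    show "KUO Q B t x u * exp (R u) \<le> C * exp (- (- trace B) * t) / (1 + norm (x - E t *v u)) ^ (CARD('n) + 1)" if "1 \<le> t" for t x u
    proof -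
      have "- (- trace B) * t = t * trace B" by simp
      then show ?thesis using that C
        by (simp only:) (intro order_trans[OF C6(5)[OF that]] divide_right_mono mult_right_mono, auto)
    qed
  qed
  then show ?thesis by blast
qed

theorem theorem3p1:
  fixes Q B :: "real^'n^'n"
  assumes hQ: "sym_pos_def Q"
    and hB: "\<forall>z. cplx_eigenvalue B z \<longrightarrow> Re z < 0"
  shows "(\<exists>C<\<infinity>. \<forall>f. \<forall>\<alpha>>0. integrable (inv_gauss Q B) f \<longrightarrow>
            {x. Hstar Q B f x > ennreal \<alpha>} \<in> sets (inv_gauss Q B) \<and>
            emeasure (inv_gauss Q B) {x. Hstar Q B f x > ennreal \<alpha>}
              \<le> C / ennreal \<alpha> * (\<integral>\<^sup>+ u. ennreal \<bar>f u\<bar> \<partial>inv_gauss Q B))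
    \<and> (\<forall>p::real. 1 < p \<longrightarrow> (\<exists>C<\<infinity>. \<forall>f. f \<in> borel_measurable (inv_gauss Q B) \<longrightarrow>
            (\<integral>\<^sup>+ u. ennreal (\<bar>f u\<bar> powr p) \<partial>inv_gauss Q B) < \<infinity> \<longrightarrow>
            Hstar Q B f \<in> borel_measurable (inv_gauss Q B) \<and>
            (\<integral>\<^sup>+ x. ennpow (Hstar Q B f x) p \<partial>inv_gauss Q B)
              \<le> C * (\<integral>\<^sup>+ u. ennreal (\<bar>f u\<bar> powr p) \<partial>inv_gauss Q B)))
    \<and> (\<exists>C<\<infinity>. \<forall>f (M::real). f \<in> borel_measurable (inv_gauss Q B) \<longrightarrow>
            (AE u in inv_gauss Q B. \<bar>f u\<bar> \<le> M) \<longrightarrow>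
            Hstar Q B f \<in> borel_measurable (inv_gauss Q B) \<and>
            (AE x in inv_gauss Q B. Hstar Q B f x \<le> C * ennreal M))"
proof -
  interpret stable_pair Q B by standard (rule hQ, rule hB)
  define \<kappa> where "\<kappa> = (2*pi) powr (real CARD('n) / 2) * sqrt (det Qi)"
  obtain C0 c0 where "ou_kernel (Dt Q B) E R (KUO Q B) (- trace B) C0 c0 \<kappa>"
    using ou_kernel_KUO by (auto simp: \<kappa>_def)
  then interpret K: ou_kernel "Dt Q B" E R "KUO Q B" "- trace B" C0 c0 \<kappa> .
  have \<mu>: "inv_gauss Q B = K.\<mu>"
    unfolding inv_gauss_def K.\<mu>_def by (simp only: \<kappa>_def)
  have meas: "f \<in> borel_measurable K.\<mu> \<longleftrightarrow> f \<in> borel_measurable borel" for f :: "real^'n \<Rightarrow> 'b::topological_space"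
    by (rule arg_cong2[where f = "(\<in>)"]) (auto intro: measurable_cong_sets simp: K.sets_\<mu>)
  \<comment> \<open>Where the integrand is not integrable, the Bochner integral in
    \<open>HUO\<close> takes the default value \<open>0\<close>, so the comparison holds for every
    \<open>f\<close> and \<open>x\<close>.\<close>
  have le_N: "Hstar Q B f x \<le> K.N (\<lambda>u. \<bar>f u\<bar>) x" for f x
    unfolding Hstar_def K.N_def
  proof (rule SUP_mono, intro bexI)
    fix t :: real assume t: "t \<in> {0<..}"
    show "ennreal \<bar>HUO Q B t f x\<bar> \<le> K.T t (\<lambda>u. \<bar>f u\<bar>) x"
    proof (cases "integrable K.\<mu> (\<lambda>u. KUO Q B t x u * f u)")
      case True
      from integral_norm_bound_ennreal[OF this] show ?thesis
        using K.k_nonneg[of t] t by (simp add: HUO_def \<mu> K.T_def abs_mult)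
    next
      case False
      then show ?thesis by (simp add: HUO_def \<mu> not_integrable_integral_eq)
    qed
  qed
  \<comment> \<open>Superlevel sets of a supremum are unions of those at the single times, each open
    by continuity. This holds for \<open>Hstar\<close> itself, whose integrals are signed, and so
    needs more than the Fatou argument used for \<open>N\<close>.\<close>
  have open_H: "open {x. a < Hstar Q B f x}"
    if f: "f \<in> borel_measurable borel" and h: "integrable K.\<mu> h" and fh: "AE u in K.\<mu>. \<bar>f u\<bar> \<le> A + h u" for f h A a
  proof -
    have "open {x. a < ennreal \<bar>HUO Q B t f x\<bar>}" if t: "t > 0" for t
    proof -
      have "continuous_on UNIV (\<lambda>x. HUO Q B t f x)"
        unfolding HUO_def \<mu> by (rule K.continuous_on_semigroup[OF t f h fh])
      then have "continuous_on UNIV (\<lambda>x. ennreal \<bar>HUO Q B t f x\<bar>)"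
        by (intro continuous_on_ennreal continuous_on_rabs)
      then show ?thesis by (intro open_Collect_less continuous_on_const)
    qed
    moreover have "{x. a < Hstar Q B f x} = (\<Union>t\<in>{0<..}. {x. a < ennreal \<bar>HUO Q B t f x\<bar>})"
      by (auto simp: Hstar_def less_SUP_iff)
    ultimately show ?thesis by auto
  qed
  then have meas_H: "Hstar Q B f \<in> borel_measurable borel"
    if "f \<in> borel_measurable borel" "integrable K.\<mu> h" "AE u in K.\<mu>. \<bar>f u\<bar> \<le> A + h u" for f h A
    using that by (intro borel_measurableI_greater) (auto intro!: borel_open)
  have 1: "\<exists>C<\<infinity>. \<forall>f. \<forall>\<alpha>>0. integrable K.\<mu> f \<longrightarrow>
            {x. Hstar Q B f x > ennreal \<alpha>} \<in> sets K.\<mu> \<and>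
            emeasure K.\<mu> {x. Hstar Q B f x > ennreal \<alpha>} \<le> C / ennreal \<alpha> * (\<integral>\<^sup>+ u. ennreal \<bar>f u\<bar> \<partial>K.\<mu>)"
  proof -
    obtain A where A: "A > 0" "\<And>f \<alpha>. f \<in> borel_measurable borel \<Longrightarrow> (\<And>u. 0 \<le> f u) \<Longrightarrow> 0 < \<alpha> \<Longrightarrow>
       emeasure K.\<mu> {x. ennreal \<alpha> < K.N f x} \<le> ennreal (A / \<alpha>) * (\<integral>\<^sup>+u. ennreal (f u) \<partial>K.\<mu>)"
      using K.weak_type by blast
    show ?thesis
    proof (intro exI[of _ "ennreal A"] conjI allI impI)
      fix f :: "real^'n \<Rightarrow> real" and \<alpha> :: real assume \<alpha>: "\<alpha> > 0" and f: "integrable K.\<mu> f"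
      have fm [measurable]: "f \<in> borel_measurable borel" using f meas by auto
      show "{x. Hstar Q B f x > ennreal \<alpha>} \<in> sets K.\<mu>"
        unfolding K.sets_\<mu> by (intro borel_open open_H[OF fm integrable_abs[OF f], of 0]) simp
      have "emeasure K.\<mu> {x. Hstar Q B f x > ennreal \<alpha>} \<le> emeasure K.\<mu> {x. ennreal \<alpha> < K.N (\<lambda>u. \<bar>f u\<bar>) x}"
        using le_N[of f] by (intro emeasure_mono) (auto intro: less_le_trans borel_open K.open_superlevel_N simp: K.sets_\<mu>)
      also have "\<dots> \<le> ennreal (A / \<alpha>) * (\<integral>\<^sup>+ u. ennreal \<bar>f u\<bar> \<partial>K.\<mu>)" using \<alpha> by (intro A) auto
      also have "ennreal (A / \<alpha>) = ennreal A / ennreal \<alpha>" using A \<alpha> by (simp add: divide_ennreal)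
      finally show "emeasure K.\<mu> {x. Hstar Q B f x > ennreal \<alpha>} \<le> ennreal A / ennreal \<alpha> * (\<integral>\<^sup>+ u. ennreal \<bar>f u\<bar> \<partial>K.\<mu>)" .
    qed simp
  qed
  have 2: "\<exists>C<\<infinity>. \<forall>f. f \<in> borel_measurable K.\<mu> \<longrightarrow> (\<integral>\<^sup>+ u. ennreal (\<bar>f u\<bar> powr p) \<partial>K.\<mu>) < \<infinity> \<longrightarrow>
            Hstar Q B f \<in> borel_measurable K.\<mu> \<and>
            (\<integral>\<^sup>+ x. ennpow (Hstar Q B f x) p \<partial>K.\<mu>) \<le> C * (\<integral>\<^sup>+ u. ennreal (\<bar>f u\<bar> powr p) \<partial>K.\<mu>)"
    if p: "1 < p" for p
  proof -
    obtain A where A: "A \<ge> 0" "\<And>f. f \<in> borel_measurable borel \<Longrightarrow> (\<And>u. 0 \<le> f u) \<Longrightarrow>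
       (\<integral>\<^sup>+x. ennpow (K.N f x) p \<partial>K.\<mu>) \<le> ennreal A * (\<integral>\<^sup>+u. ennreal (f u powr p) \<partial>K.\<mu>)"
      using K.strong_type[OF p] by blast
    show ?thesis
    proof (intro exI[of _ "ennreal A"] conjI allI impI)
      fix f :: "real^'n \<Rightarrow> real"
      assume fm: "f \<in> borel_measurable K.\<mu>" and fin: "(\<integral>\<^sup>+ u. ennreal (\<bar>f u\<bar> powr p) \<partial>K.\<mu>) < \<infinity>"
      have fb [measurable]: "f \<in> borel_measurable borel" using fm meas by auto
      have "integrable K.\<mu> (\<lambda>u. \<bar>f u\<bar> powr p)"
        using fin by (intro integrableI_bounded) auto
      \<comment> \<open>Puts a function with integrable \<open>p\<close>-th power into the form
        constant plus integrable, as continuity of the semigroup requires.\<close>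
      moreover have "\<bar>f u\<bar> \<le> 1 + \<bar>f u\<bar> powr p" for u
      proof (cases "\<bar>f u\<bar> \<le> 1")
        case False
        then have "\<bar>f u\<bar> powr 1 \<le> \<bar>f u\<bar> powr p" using p by (intro powr_mono) auto
        then show ?thesis using False by simp
      qed (simp add: add_increasing2)
      ultimately show "Hstar Q B f \<in> borel_measurable K.\<mu>"
        unfolding meas by (intro meas_H[OF fb, of "\<lambda>u. \<bar>f u\<bar> powr p" 1]) auto
      have "(\<integral>\<^sup>+ x. ennpow (Hstar Q B f x) p \<partial>K.\<mu>) \<le> (\<integral>\<^sup>+ x. ennpow (K.N (\<lambda>u. \<bar>f u\<bar>) x) p \<partial>K.\<mu>)"
        using p by (intro nn_integral_mono ennpow_mono le_N) auto
      also have "\<dots> \<le> ennreal A * (\<integral>\<^sup>+ u. ennreal (\<bar>f u\<bar> powr p) \<partial>K.\<mu>)" by (intro A) auto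
      finally show "(\<integral>\<^sup>+ x. ennpow (Hstar Q B f x) p \<partial>K.\<mu>) \<le> ennreal A * (\<integral>\<^sup>+ u. ennreal (\<bar>f u\<bar> powr p) \<partial>K.\<mu>)" .
    qed simp
  qed
  have 3: "\<exists>C<\<infinity>. \<forall>f (M::real). f \<in> borel_measurable K.\<mu> \<longrightarrow> (AE u in K.\<mu>. \<bar>f u\<bar> \<le> M) \<longrightarrow>
            Hstar Q B f \<in> borel_measurable K.\<mu> \<and> (AE x in K.\<mu>. Hstar Q B f x \<le> C * ennreal M)"
  proof -
    obtain A where A: "A \<ge> 0" "\<And>f b x. (AE u in K.\<mu>. f u \<le> b) \<Longrightarrow> K.N f x \<le> ennreal A * ennreal b"
      using K.N_bounded by blast
    show ?thesis
    proof (intro exI[of _ "ennreal A"] conjI allI impI)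
      fix f :: "real^'n \<Rightarrow> real" and M :: real
      assume fm: "f \<in> borel_measurable K.\<mu>" and M: "AE u in K.\<mu>. \<bar>f u\<bar> \<le> M"
      show "Hstar Q B f \<in> borel_measurable K.\<mu>"
        using fm M unfolding meas by (intro meas_H[of f "\<lambda>_. 0" M]) auto
      show "AE x in K.\<mu>. Hstar Q B f x \<le> ennreal A * ennreal M"
        by (intro AE_I2 order_trans[OF le_N] A M)
    qed simp
  qed
  show ?thesis unfolding \<mu> using 1 2 3 by blast
qed

end
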